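(* Let $\mu_1,\mu_2$ be compactly supported probability measures on $\mathbb R_+=[0,\infty)$, both different from $\delta_0$. Then, in the sense of weak limits, $$\lim_{n\to\infty}(\mu_1\angle_n\mu_2)=\mu_1\boxtimes_s\mu_2,\qquad \lim_{n\to\infty}\big(\mu_1\circlearrowright(\mu_2\angle_n\mu_1)\big)=\mu_1\boxtimes\mu_2,$$ and the corresponding $\eta$-transforms converge uniformly on the compact subsets of $\mathbb C\setminus\mathbb R_+$ to the $\eta$-transforms of the limit measures. An analogous result holds for probability measures $\mu_1,\mu_2$ on the unit circle $\mathbb T$ with non-zero mean (with $\mathbb C\setminus\mathbb R_+$ replaced by the open unit disc $\mathbb D$).
   Context: For a probability measure $\mu$ on $\mathbb R_+$ (resp. $\mathbb T$), $\psi_\mu(z)=\int\frac{zt}{1-zt}d\mu(t)$ and $\eta_\mu=\psi_\mu/(1+\psi_\mu)$ on $\mathbb C\setminus\mathbb R_+$ (resp. $\mathbb D$). $\boxtimes$ is free multiplicative convolution. Monotone multiplicative convolution: $\eta_{\mu_1\circlearrowright\mu_2}(z)=\eta_{\mu_1}(\eta_{\mu_2}(z))$. Orthogonal multiplicative convolution $\mu_1\angle\mu_2$ (with $\mu_2\ne\delta_0$): the probability measure with $\eta_{\mu_1\angle\mu_2}(z)=z\,\eta_{\mu_1}(\eta_{\mu_2}(z))/\eta_{\mu_2}(z)$ (on $\mathbb T$, $\eta_{\mu_1}(0)/0$ is understood as $\eta_{\mu_1}'(0)$). Iterations: $\mu_1\angle_1\mu_2=\mu_1\angle\mu_2$, $\mu_1\angle_n\mu_2=\mu_1\angle(\mu_2\angle_{n-1}\mu_1)$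 for $n\ge2$. s-free multiplicative convolution: for $\mu_1,\mu_2\ne\delta_0$ on $\mathbb R_+$ (resp. on $\mathbb T$ with non-zero mean), $\mu_1\boxtimes_s\mu_2=\sigma_1$ and $\mu_2\boxtimes_s\mu_1=\sigma_2$ are the unique probability measures on $\mathbb R_+$ different from $\delta_0$ (resp. on $\mathbb T$) with $\eta_{\mu_1\boxtimes\mu_2}(z)=\eta_{\mu_1}(\eta_{\sigma_2}(z))=\eta_{\mu_2}(\eta_{\sigma_1}(z))$ on $\mathbb C\setminus\mathbb R_+$ (resp. $\mathbb D$). *)

theory Defs
  imports "HOL-Probability.Probability" "HOL-Computational_Algebra.Polynomial"
begin

text \<open>
  The multiplicative convolutions on the half-line and on the unit circle are defined in parallel.
  All measures are Borel measures on the complex plane, carried by a set \<open>S\<close>, and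
  \<open>D\<close> is the domain of the \<open>\<eta>\<close>-transforms; the pair \<open>(S, D)\<close> is
  \<open>(\<real>\<^sub>\<ge>\<^sub>0, - \<real>\<^sub>\<ge>\<^sub>0)\<close> or \<open>(sphere 0 1, ball 0 1)\<close>.
\<close>

definition prob_on :: "complex set \<Rightarrow> complex measure \<Rightarrow> bool" where
  "prob_on S \<mu> \<longleftrightarrow> prob_space \<mu> \<and> sets \<mu> = sets borel \<and> (AE t in \<mu>. t \<in> S)"

definition compactly_supported :: "complex measure \<Rightarrow> bool" where
  "compactly_supported \<mu> \<longleftrightarrow> (\<exists>K. compact K \<and> (AE t in \<mu>. t \<in> K))"

abbreviation delta0 :: "complex measure" where
  "delta0 \<equiv> return borel 0"

definition weakly_converges :: "(nat \<Rightarrow> complex measure) \<Rightarrow> complex measure \<Rightarrow> bool" where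
  "weakly_converges M N \<longleftrightarrow>
     (\<forall>f :: complex \<Rightarrow> real. continuous_on UNIV f \<and> bounded (range f) \<longrightarrow>
        (\<lambda>n. integral\<^sup>L (M n) f) \<longlonglongrightarrow> integral\<^sup>L N f)"

definition moment :: "complex measure \<Rightarrow> nat \<Rightarrow> complex" where
  "moment \<mu> n = (LINT t|\<mu>. t ^ n)"

definition psi :: "complex measure \<Rightarrow> complex \<Rightarrow> complex" where
  "psi \<mu> z = (LINT t|\<mu>. z * t / (1 - z * t))"

definition eta :: "complex measure \<Rightarrow> complex \<Rightarrow> complex" where
  "eta \<mu> z = psi \<mu> z / (1 + psi \<mu> z)"


section \<open>Free multiplicative convolution\<close>

text \<open>
  The joint distribution of two noncommutative random variables is a linear functional on the
  free unital algebra in two indeterminates. It is given by its values \<open>\<phi>\<close> on words, where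
  \<open>False\<close> and \<open>True\<close> are the two indeterminates and \<open>[]\<close> is the unit.

  \<open>joint_moment \<phi> w [(i1, p1), \<dots>, (ik, pk)]\<close> is the value of the linear extension of \<open>\<phi>\<close>
  at the product of the word \<open>w\<close> and of the polynomials \<open>p1\<close> in the indeterminate \<open>i1\<close>,
  and so on up to \<open>pk\<close> in the indeterminate \<open>ik\<close>.
\<close>

primrec joint_moment ::
  "(bool list \<Rightarrow> complex) \<Rightarrow> bool list \<Rightarrow> (bool \<times> complex poly) list \<Rightarrow> complex" where
  "joint_moment \<phi> w [] = \<phi> w"
| "joint_moment \<phi> w (s # ss) =
     (\<Sum>k\<le>degree (snd s). coeff (snd s) k * joint_moment \<phi> (w @ replicate k (fst s)) ss)"

text \<open>Freeness: alternating products of centred elements have expectation zero.\<close>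

definition free_pair :: "(bool list \<Rightarrow> complex) \<Rightarrow> bool" where
  "free_pair \<phi> \<longleftrightarrow> \<phi> [] = 1 \<and>
     (\<forall>ss. ss \<noteq> [] \<and> distinct_adj (map fst ss) \<and> (\<forall>s\<in>set ss. joint_moment \<phi> [] [s] = 0)
        \<longrightarrow> joint_moment \<phi> [] ss = 0)"

text \<open>
  The distribution of the product of two free random variables with distributions \<open>\<mu>1\<close> and
  \<open>\<mu>2\<close>, for compactly supported measures (which are determined by their moments on
  \<open>\<real>\<^sub>\<ge>\<^sub>0\<close> and on the circle). On \<open>\<real>\<^sub>\<ge>\<^sub>0\<close>, the moments of \<open>a b\<close> are those of the
  positive element \<open>sqrt a b sqrt a\<close>, by traciality.
\<close>

definition free_conv :: "complex set \<Rightarrow> complex measure \<Rightarrow> complex measure \<Rightarrow> complex measure" where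
  "free_conv S \<mu>1 \<mu>2 = (THE \<nu>. prob_on S \<nu> \<and> compactly_supported \<nu> \<and>
     (\<exists>\<phi>. free_pair \<phi> \<and>
        (\<forall>n. \<phi> (replicate n False) = moment \<mu>1 n) \<and>
        (\<forall>n. \<phi> (replicate n True) = moment \<mu>2 n) \<and>
        (\<forall>n. \<phi> (concat (replicate n [False, True])) = moment \<nu> n)))"


section \<open>Monotone, orthogonal and s-free multiplicative convolution\<close>

definition monotone_conv ::
  "complex set \<Rightarrow> complex set \<Rightarrow> complex measure \<Rightarrow> complex measure \<Rightarrow> complex measure" where
  "monotone_conv S D \<mu>1 \<mu>2 =
     (THE \<nu>. prob_on S \<nu> \<and> (\<forall>z\<in>D. eta \<nu> z = eta \<mu>1 (eta \<mu>2 z)))"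

text \<open>
  \<open>\<eta>(w) / w\<close>, with the value \<open>\<eta>'(0)\<close> at \<open>w = 0\<close>. The case \<open>w = 0\<close> matters only on the
  circle: on the half-line, \<open>\<eta>\<close> has no zeros off \<open>\<real>\<^sub>\<ge>\<^sub>0\<close> unless the measure is
  \<open>\<delta>\<^sub>0\<close>.
\<close>

definition eta_quot :: "complex measure \<Rightarrow> complex \<Rightarrow> complex" where
  "eta_quot \<mu> w = (if w = 0 then deriv (eta \<mu>) 0 else eta \<mu> w / w)"

definition orth_conv ::
  "complex set \<Rightarrow> complex set \<Rightarrow> complex measure \<Rightarrow> complex measure \<Rightarrow> complex measure" where
  "orth_conv S D \<mu>1 \<mu>2 =
     (THE \<nu>. prob_on S \<nu> \<and> (\<forall>z\<in>D. eta \<nu> z = z * eta_quot \<mu>1 (eta \<mu>2 z)))"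

text \<open>
  The iterations are numbered from \<open>1\<close>; the value at \<open>0\<close> is chosen so that the recursion
  gives \<open>orth_conv S D \<mu>1 \<mu>2\<close> at \<open>1\<close>.
\<close>

primrec orth_iter ::
  "complex set \<Rightarrow> complex set \<Rightarrow> nat \<Rightarrow> complex measure \<Rightarrow> complex measure \<Rightarrow> complex measure" where
  "orth_iter S D 0 = (\<lambda>\<mu>1 \<mu>2. \<mu>1)"
| "orth_iter S D (Suc n) = (\<lambda>\<mu>1 \<mu>2. orth_conv S D \<mu>1 (orth_iter S D n \<mu>2 \<mu>1))"

text \<open>The condition \<open>\<noteq> \<delta>\<^sub>0\<close> is automatic on the circle.\<close>

definition sfree_conv ::
  "complex set \<Rightarrow> complex set \<Rightarrow> complex measure \<Rightarrow> complex measure \<Rightarrow> complex measure" where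
  "sfree_conv S D \<mu>1 \<mu>2 =
     fst (THE (\<sigma>1, \<sigma>2). prob_on S \<sigma>1 \<and> \<sigma>1 \<noteq> delta0 \<and> prob_on S \<sigma>2 \<and> \<sigma>2 \<noteq> delta0 \<and>
       (\<forall>z\<in>D. eta (free_conv S \<mu>1 \<mu>2) z = eta \<mu>1 (eta \<sigma>2 z) \<and>
              eta (free_conv S \<mu>1 \<mu>2) z = eta \<mu>2 (eta \<sigma>1 z)))"

definition eta_converges ::
  "complex set \<Rightarrow> (nat \<Rightarrow> complex measure) \<Rightarrow> complex measure \<Rightarrow> bool" where
  "eta_converges D M N \<longleftrightarrow>
     (\<forall>K. compact K \<and> K \<subseteq> D \<longrightarrow> uniform_limit K (\<lambda>n. eta (M n)) (eta N) sequentially)"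

end

theory Submission
  imports Defs "HOL-Complex_Analysis.Complex_Analysis" "HOL-Library.Poly_Mapping"
begin

text \<open>
  On both domains the \<open>\<eta>\<close>-transforms form a class of holomorphic self-maps that is stable under
  \<open>f (g z)\<close> and \<open>z f (g z) / g z\<close>, and the Herglotz representation realises every map of the class
  by a measure. Writing \<open>q\<^sub>i w = \<eta>\<^sub>i w / w\<close>, the iterates satisfy
  \<open>a\<^sub>n\<^sub>+\<^sub>1 z = z q\<^sub>1 (b\<^sub>n z)\<close> and \<open>b\<^sub>n\<^sub>+\<^sub>1 z = z q\<^sub>2 (a\<^sub>n z)\<close>. They are
  bounded on a fixed disc around \<open>0\<close>, which confines the supports to a fixed compact set, and the
  recursion freezes their \<open>k\<close>-th coefficients after \<open>k\<close> steps. So every moment is eventually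
  constant, and the measures converge weakly to \<open>\<sigma>\<^sub>1, \<sigma>\<^sub>2\<close> with
  \<open>z \<eta>\<^sub>1 (\<eta>\<^bsub>\<sigma>\<^sub>2\<^esub> z) = \<eta>\<^bsub>\<sigma>\<^sub>1\<^esub> z * \<eta>\<^bsub>\<sigma>\<^sub>2\<^esub> z = z \<eta>\<^sub>2 (\<eta>\<^bsub>\<sigma>\<^sub>1\<^esub> z)\<close>.
  That the common value is the transform of the free convolution follows from a factorisation of
  \<open>1 - z a b\<close> through alternating centred elements, in power series over the free algebra.
\<close>

text \<open>Every convolution is a definite description, so each one has to be met by an existence
  statement (a map of the class is realised by a measure) and a uniqueness statement (the transform
  determines the measure). The obstacle on the half-line is that \<open>0\<close> lies on the
  boundary of the slit plane, and that a realised measure may a priori be unbounded, with no power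
  series at \<open>0\<close>. Both domains contain the interval \<open>(-1, 0)\<close>; identities
  travel along it between the domain and the coefficients at \<open>0\<close>, and analytic
  continuation to a fixed disc about \<open>0\<close> bounds the supports. The radius does not
  shrink with \<open>n\<close>: the bound \<open>3 * R * norm z\<close> reproduces itself under
  \<open>z * q (g z)\<close>, because only the disc containing \<open>g z\<close> matters. In the
  free convolution the functional is constrained by algebra alone. One with the prescribed marginals
  is built by recursion on the length of words, the measure is the limit found by analysis, and the
  factorisation shows that every such functional yields its moments.\<close>

unbundle no vec_syntax
unbundle fps_syntax

section \<open>Measures on compact sets\<close>

lemma prob_on_AE: "prob_on A \<mu> \<Longrightarrow> (\<And>t. t \<in> A \<Longrightarrow> P t) \<Longrightarrow> AE t in \<mu>. P t"
  unfolding prob_on_def by (auto elim: eventually_mono)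

lemma prob_on_mono: "prob_on A \<mu> \<Longrightarrow> A \<subseteq> B \<Longrightarrow> prob_on B \<mu>"
  unfolding prob_on_def by (auto elim: eventually_mono)

lemma prob_on_IntI: "prob_on A \<mu> \<Longrightarrow> AE t in \<mu>. t \<in> B \<Longrightarrow> prob_on (A \<inter> B) \<mu>"
  unfolding prob_on_def by auto

lemma prob_on_distr:
  assumes "prob_space M" "f \<in> borel_measurable M" "AE x in M. f x \<in> K" "closed K"
  shows "prob_on K (distr M borel f)"
  unfolding prob_on_def using assms
  by (auto simp: prob_space.prob_space_distr AE_distr_iff)

lemma prob_on_borel_measurable: "prob_on A \<mu> \<Longrightarrow> f \<in> borel_measurable borel \<Longrightarrow> f \<in> borel_measurable \<mu>"
  by (simp add: prob_on_def cong: measurable_cong_sets)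

lemma prob_on_integrable:
  fixes f :: "complex \<Rightarrow> 'b :: {banach, second_countable_topology}"
  assumes "prob_on A \<mu>" "f \<in> borel_measurable borel" "\<And>t. t \<in> A \<Longrightarrow> norm (f t) \<le> B"
  shows "integrable \<mu> f"
proof -
  interpret prob_space \<mu> using assms(1) by (simp add: prob_on_def)
  have "AE t in \<mu>. norm (f t) \<le> B"
    using prob_on_AE[OF assms(1)] assms(3) by auto
  then show ?thesis
    using assms by (intro integrable_const_bound prob_on_borel_measurable[OF assms(1)])
qed

lemma prob_on_integral_bound:
  fixes f :: "complex \<Rightarrow> 'b :: {banach, second_countable_topology}"
  assumes "prob_on A \<mu>" "f \<in> borel_measurable borel" "\<And>t. t \<in> A \<Longrightarrow> norm (f t) \<le> B"
  shows "norm (integral\<^sup>L \<mu> f) \<le> B"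
proof -
  interpret prob_space \<mu> using assms(1) by (simp add: prob_on_def)
  have "norm (integral\<^sup>L \<mu> f) \<le> (LINT t|\<mu>. norm (f t))"
    by (rule integral_norm_bound)
  also have "\<dots> \<le> (LINT t|\<mu>. B)"
    using prob_on_AE[OF assms(1)] assms(3)
    by (intro integral_mono_AE integrable_norm prob_on_integrable[OF assms]) auto
  finally show ?thesis by (simp add: prob_space)
qed

lemma prob_on_integral_cong:
  fixes f g :: "complex \<Rightarrow> 'b :: {banach, second_countable_topology}"
  assumes "prob_on A \<mu>" "\<And>t. t \<in> A \<Longrightarrow> f t = g t"
    "f \<in> borel_measurable borel" "g \<in> borel_measurable borel"
  shows "integral\<^sup>L \<mu> f = integral\<^sup>L \<mu> g"
  using assms prob_on_AE[OF assms(1)]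
  by (intro integral_cong_AE prob_on_borel_measurable[OF assms(1)]) auto

lemma prob_on_prob_space: "prob_on A \<mu> \<Longrightarrow> prob_space \<mu>"
  by (simp add: prob_on_def)

text \<open>Closed sets form an intersection-stable generator of the Borel sets, and the indicator
  of a nonempty closed set is the pointwise limit of the functions
  \<open>max 0 (1 - n * infdist t C)\<close>.\<close>

lemma prob_on_eqI:
  assumes \<mu>: "prob_on A \<mu>" and \<nu>: "prob_on B \<nu>"
    and eq: "\<And>f :: complex \<Rightarrow> real. continuous_on UNIV f \<Longrightarrow> bounded (range f) \<Longrightarrow>
      integral\<^sup>L \<mu> f = integral\<^sup>L \<nu> f"
  shows "\<mu> = \<nu>"
proof -
  interpret M: prob_space \<mu> using \<mu> by (simp add: prob_on_def)
  interpret N: prob_space \<nu> using \<nu> by (simp add: prob_on_def)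
  have sets: "sets \<mu> = sets borel" "sets \<nu> = sets borel"
    using \<mu> \<nu> by (auto simp: prob_on_def)
  have closed: "measure \<mu> C = measure \<nu> C" if C: "closed C" "C \<noteq> {}" for C
  proof -
    define f where "f n t = max 0 (1 - real n * infdist t C)" for n t
    have cont: "continuous_on UNIV (f n)" for n
      unfolding f_def by (intro continuous_intros)
    have bd: "\<bar>f n t\<bar> \<le> 1" for n t
      using mult_nonneg_nonneg[of "real n" "infdist t C"] by (auto simp: f_def max_def infdist_nonneg)
    have lim: "(\<lambda>n. f n t) \<longlonglongrightarrow> indicator C t" for t
    proof (cases "t \<in> C")
      case False
      then have pos: "infdist t C > 0"
        using C by (metis in_closed_iff_infdist_zero infdist_nonneg order_less_le)
      have "eventually (\<lambda>n. f n t = 0) sequentially"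
        using eventually_gt_at_top[of "nat \<lceil>1 / infdist t C\<rceil>"]
      proof eventually_elim
        case (elim n)
        then have "1 / infdist t C < real n" by linarith
        then show ?case using pos by (simp add: f_def field_simps)
      qed
      then show ?thesis using False by (simp add: tendsto_eventually)
    qed (simp add: f_def)
    have conv: "(\<lambda>n. integral\<^sup>L M (f n)) \<longlonglongrightarrow> integral\<^sup>L M (indicator C)"
      if "prob_space M" "sets M = sets borel" for M
    proof -
      interpret prob_space M by fact
      have [measurable]: "f n \<in> borel_measurable M" for n
        using borel_measurable_continuous_onI[OF cont] that(2) by (simp cong: measurable_cong_sets)
      have [measurable]: "indicator C \<in> borel_measurable M"
        using borel_closed[OF C(1)] that(2) by (intro borel_measurable_indicator) simp
      show ?thesis
        using lim bd by (intro integral_dominated_convergence[where w="\<lambda>_. 1"]) auto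
    qed
    have "(\<lambda>n. integral\<^sup>L \<mu> (f n)) = (\<lambda>n. integral\<^sup>L \<nu> (f n))"
      using bd by (intro ext eq cont) (auto simp: bounded_iff intro!: exI[of _ 1])
    then have "integral\<^sup>L \<mu> (indicator C) = (integral\<^sup>L \<nu> (indicator C) :: real)"
      using conv[OF M.prob_space_axioms sets(1)] conv[OF N.prob_space_axioms sets(2)]
      by (metis LIMSEQ_unique)
    then show ?thesis
      using C sets sets_eq_imp_space_eq[OF sets(1)] sets_eq_imp_space_eq[OF sets(2)] by simp
  qed
  show ?thesis
  proof (rule measure_eqI_generator_eq[where E="Collect closed" and \<Omega>=UNIV and A="\<lambda>_. UNIV"])
    show "sets \<mu> = sigma_sets UNIV (Collect closed)" "sets \<nu> = sigma_sets UNIV (Collect closed)"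
      using sets by (simp_all add: borel_eq_closed)
    show "emeasure \<mu> X = emeasure \<nu> X" if "X \<in> Collect closed" for X
      using closed[of X] that by (cases "X = {}") (auto simp: M.emeasure_eq_measure N.emeasure_eq_measure)
  qed (auto simp: Int_stable_def)
qed

text \<open>Complex polynomials in the two real coordinates. Powers of \<open>t\<close> alone would
  not be dense among the continuous functions on the circle.\<close>

inductive_set bipolynomial :: "(complex \<Rightarrow> complex) set" where
  bipolynomial_monom: "(\<lambda>t. c * (t ^ m * cnj t ^ n)) \<in> bipolynomial"
| bipolynomial_add: "f \<in> bipolynomial \<Longrightarrow> g \<in> bipolynomial \<Longrightarrow> (\<lambda>t. f t + g t) \<in> bipolynomial"

lemma bipolynomial_monom_mult:
  "g \<in> bipolynomial \<Longrightarrow> (\<lambda>t. c * (t ^ m * cnj t ^ n) * g t) \<in> bipolynomial"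
proof (induction rule: bipolynomial.induct)
  case (bipolynomial_monom d k l)
  then show ?case
    using bipolynomial.bipolynomial_monom[of "c * d" "m + k" "n + l"] by (simp add: power_add mult_ac)
next
  case (bipolynomial_add f g)
  then show ?case using bipolynomial.bipolynomial_add by (simp add: distrib_left)
qed

lemma bipolynomial_mult:
  "f \<in> bipolynomial \<Longrightarrow> g \<in> bipolynomial \<Longrightarrow> (\<lambda>t. f t * g t) \<in> bipolynomial"
  by (induction rule: bipolynomial.induct)
     (auto intro: bipolynomial_monom_mult bipolynomial_add simp: distrib_right)

lemma real_polynomial_function_bipolynomial:
  fixes f :: "complex \<Rightarrow> real"
  shows "real_polynomial_function f \<Longrightarrow> (\<lambda>t. of_real (f t)) \<in> bipolynomial"
proof (induction rule: real_polynomial_function.induct)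
  case (linear f)
  interpret bounded_linear f by fact
  \<comment> \<open>A real-linear map is \<open>f 1 * Re t + f \<i> * Im t\<close>; the coefficients
    come from \<open>Re t = (t + cnj t) / 2\<close> and
    \<open>Im t = (t - cnj t) / (2 * \<i>)\<close>.\<close>
  let ?a = "(of_real (f 1) - \<i> * of_real (f \<i>)) / 2" and ?b = "(of_real (f 1) + \<i> * of_real (f \<i>)) / 2"
  have "(\<lambda>t. ?a * (t ^ 1 * cnj t ^ 0) + ?b * (t ^ 0 * cnj t ^ 1)) \<in> bipolynomial"
    by (intro bipolynomial.intros)
  moreover have "complex_of_real (f t) = ?a * (t ^ 1 * cnj t ^ 0) + ?b * (t ^ 0 * cnj t ^ 1)" for t
  proof -
    have "f t = f (Re t *\<^sub>R 1 + Im t *\<^sub>R \<i>)"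
      by (intro arg_cong[of _ _ f]) (simp add: complex_eq_iff)
    also have "\<dots> = Re t * f 1 + Im t * f \<i>" by (simp add: add scaleR)
    finally show ?thesis
      by (simp add: complex_eq_iff field_simps)
  qed
  then have "(\<lambda>t. complex_of_real (f t)) = (\<lambda>t. ?a * (t ^ 1 * cnj t ^ 0) + ?b * (t ^ 0 * cnj t ^ 1))"
    by (rule ext)
  ultimately show ?case by (simp only:)
next
  case (const c)
  then show ?case using bipolynomial_monom[of "of_real c" 0 0] by simp
qed (auto intro: bipolynomial_add bipolynomial_mult)

lemma bipolynomial_continuous: "f \<in> bipolynomial \<Longrightarrow> continuous_on UNIV f"
  by (induction rule: bipolynomial.induct) (auto intro!: continuous_intros)

lemma compact_norm_bounded:
  fixes f :: "'a :: topological_space \<Rightarrow> 'b :: real_normed_vector"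
  assumes "compact K" "continuous_on K f"
  obtains B where "\<And>t. t \<in> K \<Longrightarrow> norm (f t) \<le> B"
proof -
  obtain B where "\<forall>x\<in>f ` K. norm x \<le> B"
    using compact_imp_bounded[OF compact_continuous_image[OF assms(2,1)]] bounded_iff by blast
  then show thesis using that by blast
qed

lemma prob_on_continuous_integrable:
  fixes f :: "complex \<Rightarrow> 'b :: {banach, second_countable_topology}"
  assumes "compact K" "prob_on K \<mu>" "continuous_on UNIV f"
  shows "integrable \<mu> f"
proof -
  obtain B where "\<And>t. t \<in> K \<Longrightarrow> norm (f t) \<le> B"
    using compact_norm_bounded[OF assms(1) continuous_on_subset[OF assms(3) subset_UNIV]] by metis
  then show ?thesis
    using prob_on_integrable[OF assms(2)] borel_measurable_continuous_onI[OF assms(3)] by blast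
qed

text \<open>On the common compact support, Stone-Weierstrass approximates the test function
  uniformly by a real polynomial, and the error passes to all integrals at once, independently of
  \<open>n\<close>.\<close>

lemma weakly_converges_moments:
  assumes K: "compact K" and M: "\<And>n. prob_on K (M n)" and N: "prob_on K N"
    and lim: "\<And>i j. (\<lambda>n. LINT t|M n. t ^ i * cnj t ^ j) \<longlonglongrightarrow> (LINT t|N. t ^ i * cnj t ^ j)"
  shows "weakly_converges M N"
  unfolding weakly_converges_def
proof safe
  fix f :: "complex \<Rightarrow> real" assume f: "continuous_on UNIV f" "bounded (range f)"
  have poly: "(\<lambda>n. integral\<^sup>L (M n) g) \<longlonglongrightarrow> integral\<^sup>L N g" if "g \<in> bipolynomial" for g
    using that
  proof induction
    case (bipolynomial_monom c i j)
    show ?case by (simp add: tendsto_mult_left lim)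
  next
    case (bipolynomial_add g h)
    have "integrable \<mu> g" "integrable \<mu> h" if "prob_on K \<mu>" for \<mu>
      using bipolynomial_add bipolynomial_continuous prob_on_continuous_integrable[OF K that] by auto
    then show ?case using bipolynomial_add M N by (simp add: tendsto_add)
  qed
  show "(\<lambda>n. integral\<^sup>L (M n) f) \<longlonglongrightarrow> integral\<^sup>L N f"
  proof (rule LIMSEQ_I)
    fix e :: real assume e: "e > 0"
    obtain g where g: "real_polynomial_function g" "\<And>t. t \<in> K \<Longrightarrow> \<bar>f t - g t\<bar> < e / 4"
      using Stone_Weierstrass_real_polynomial_function[of K f "e / 4"] e K f
      by (metis continuous_on_subset subset_UNIV zero_less_divide_iff zero_less_numeral)
    have gc: "continuous_on UNIV g"
      using g(1) by (simp add: continuous_at_imp_continuous_on continuous_real_polymonial_function)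
    have close: "\<bar>integral\<^sup>L \<mu> f - integral\<^sup>L \<mu> g\<bar> \<le> e / 4" if \<mu>: "prob_on K \<mu>" for \<mu>
    proof -
      have "norm (LINT t|\<mu>. f t - g t) \<le> e / 4"
        using g(2) by (intro prob_on_integral_bound[OF \<mu>] borel_measurable_continuous_onI
            continuous_intros f gc) (auto intro: less_imp_le)
      then show ?thesis
        using prob_on_continuous_integrable[OF K \<mu> f(1)] prob_on_continuous_integrable[OF K \<mu> gc]
        by simp
    qed
    have "(\<lambda>n. complex_of_real (integral\<^sup>L (M n) g)) \<longlonglongrightarrow> of_real (integral\<^sup>L N g)"
      using poly[OF real_polynomial_function_bipolynomial[OF g(1)]] by simp
    then have "(\<lambda>n. integral\<^sup>L (M n) g) \<longlonglongrightarrow> integral\<^sup>L N g"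
      by (simp add: tendsto_of_real_iff)
    then obtain n0 where n0: "\<And>n. n \<ge> n0 \<Longrightarrow> \<bar>integral\<^sup>L (M n) g - integral\<^sup>L N g\<bar> < e / 4"
      using LIMSEQ_D[of _ _ "e / 4"] e by (metis real_norm_def zero_less_divide_iff zero_less_numeral)
    have "norm (integral\<^sup>L (M n) f - integral\<^sup>L N f) < e" if "n \<ge> n0" for n
      using n0[OF that] close[OF M[of n]] close[OF N] e unfolding real_norm_def by linarith
    then show "\<exists>no. \<forall>n\<ge>no. norm (integral\<^sup>L (M n) f - integral\<^sup>L N f) < e"
      by blast
  qed
qed

text \<open>Kernels such as \<open>1 / (1 - z * t)\<close> are continuous on the support but not on
  the plane. Tietze extends real and imaginary part from \<open>K\<close> with a bound, which
  changes no integral.\<close>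

lemma weakly_converges_complex:
  fixes f :: "complex \<Rightarrow> complex"
  assumes K: "compact K" and M: "\<And>n. prob_on K (M n)" and N: "prob_on K N"
    and w: "weakly_converges M N" and f: "continuous_on K f" "f \<in> borel_measurable borel"
  shows "(\<lambda>n. integral\<^sup>L (M n) f) \<longlonglongrightarrow> integral\<^sup>L N f"
proof -
  obtain B where B: "\<And>t. t \<in> K \<Longrightarrow> norm (f t) \<le> B" using compact_norm_bounded[OF K f(1)] by metis
  have real: "(\<lambda>n. LINT t|M n. h (f t)) \<longlonglongrightarrow> (LINT t|N. h (f t))"
    if h: "continuous_on UNIV h" "\<And>z. \<bar>h z\<bar> \<le> norm z" for h :: "complex \<Rightarrow> real"
  proof -
    have hm[measurable]: "h \<in> borel_measurable borel"
      using h(1) by (rule borel_measurable_continuous_onI)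
    have fm: "f \<in> borel_measurable borel" by fact
    obtain g where g: "continuous_on UNIV g" "\<And>t. t \<in> K \<Longrightarrow> g t = h (f t)" "\<And>t. norm (g t) \<le> \<bar>B\<bar>"
    proof (rule Tietze[of K "\<lambda>t. h (f t)" UNIV "\<bar>B\<bar>"])
      show "continuous_on K (\<lambda>t. h (f t))"
        using f(1) h(1) by (metis continuous_on_compose2 subset_UNIV)
      show "closedin (top_of_set UNIV) K" using K by (simp add: compact_imp_closed)
      show "norm (h (f t)) \<le> \<bar>B\<bar>" if "t \<in> K" for t
        using B[OF that] h(2)[of "f t"] by simp
    qed auto
    have "integral\<^sup>L \<mu> g = (LINT t|\<mu>. h (f t))" if "prob_on K \<mu>" for \<mu>
      using that g(1,2) fm
      by (intro prob_on_integral_cong[OF that]) (auto intro: borel_measurable_continuous_onI)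
    moreover have "bounded (range g)" using g(3) by (auto simp: bounded_iff)
    moreover have "(\<lambda>n. integral\<^sup>L (M n) g) \<longlonglongrightarrow> integral\<^sup>L N g"
      using w g(1) \<open>bounded (range g)\<close> unfolding weakly_converges_def by blast
    ultimately show ?thesis using M N by simp
  qed
  have int: "integrable \<mu> f" if "prob_on K \<mu>" for \<mu>
    using prob_on_integrable[OF that f(2) B] .
  have "(\<lambda>n. LINT t|M n. Re (f t)) \<longlonglongrightarrow> (LINT t|N. Re (f t))"
       "(\<lambda>n. LINT t|M n. Im (f t)) \<longlonglongrightarrow> (LINT t|N. Im (f t))"
    by (intro real continuous_intros abs_Re_le_cmod abs_Im_le_cmod)+
  then show ?thesis
    using int M N by (simp add: tendsto_complex_iff)
qed

section \<open>Helly selection on a compact curve\<close>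

text \<open>Selection on the line is transported by a Borel section \<open>j\<close> of a continuous
  parametrisation \<open>p\<close>: test functions are pulled back to \<open>f (p x)\<close> and the
  limit law is pushed forward by \<open>p\<close>. A discontinuous \<open>j\<close> is what allows a
  closed curve to be cut open.\<close>

lemma prob_on_Helly:
  fixes p :: "real \<Rightarrow> complex" and j :: "complex \<Rightarrow> real"
  assumes p: "continuous_on UNIV p" "\<And>x. p x \<in> K" and K: "closed K"
    and j: "j \<in> borel_measurable borel" "\<And>t. t \<in> K \<Longrightarrow> p (j t) = t" "\<And>t. t \<in> K \<Longrightarrow> a < j t \<and> j t \<le> b"
    and M: "\<And>n :: nat. prob_on K (M n)"
  obtains r N where "strict_mono r" "prob_on K N" "weakly_converges (M \<circ> r) N"
proof -
  define P where "P n = distr (M n) borel j" for n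
  have sets: "sets (M n) = sets borel" for n using M by (auto simp: prob_on_def)
  have jm: "j \<in> borel_measurable (M n)" for n using j(1) sets by (simp cong: measurable_cong_sets)
  have dist: "real_distribution (P n)" for n
    using prob_on_prob_space[OF M] jm
    by (simp add: P_def real_distribution_def real_distribution_axioms_def prob_space.prob_space_distr)
  have "a < b" using j(3)[OF p(2)[of 0]] by linarith
  \<comment> \<open>All image measures live in one interval, so tightness holds with the same
    endpoints for every \<open>e\<close>.\<close>
  have full: "measure (P n) {a<..b} = 1" for n
  proof -
    interpret prob_space "M n" using M by (rule prob_on_prob_space)
    have "AE t in M n. j t \<in> {a<..b}" using prob_on_AE[OF M] j(3) by auto
    then have "AE x in P n. x \<in> {a<..b}" unfolding P_def using jm by (subst AE_distr_iff) auto
    then show ?thesis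
      using dist by (intro prob_space.prob_eq_1[THEN iffD2])
         (auto simp: real_distribution_def P_def)
  qed
  have "tight P"
    unfolding tight_def
  proof (intro conjI allI impI)
    fix e :: real assume "e > 0"
    then show "\<exists>a b. a < b \<and> (\<forall>n. 1 - e < measure (P n) {a<..b})"
      using \<open>a < b\<close> by (intro exI[of _ a] exI[of _ b]) (simp add: full)
  qed (rule dist)
  then obtain r Q where r: "strict_mono r" "real_distribution Q" "weak_conv_m (P \<circ> id \<circ> r) Q"
    using tight_imp_convergent_subsubsequence[of P id] by (auto simp: strict_mono_id)
  have pm: "p \<in> borel_measurable borel" using p(1) by (rule borel_measurable_continuous_onI)
  interpret Q: real_distribution Q by fact
  have pmQ: "p \<in> borel_measurable Q" using pm by (simp cong: measurable_cong_sets)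
  have "prob_on K (distr Q borel p)"
    using p K pmQ by (intro prob_on_distr Q.prob_space_axioms) auto
  moreover have "weakly_converges (M \<circ> r) (distr Q borel p)"
    unfolding weakly_converges_def
  proof safe
    fix f :: "complex \<Rightarrow> real" assume f: "continuous_on UNIV f" "bounded (range f)"
    have fm: "f \<in> borel_measurable borel" using f(1) by (rule borel_measurable_continuous_onI)
    obtain B where B: "\<And>t. norm (f t) \<le> B" using f(2) by (auto simp: bounded_iff)
    have cont: "isCont (\<lambda>x. f (p x)) x" for x
      using continuous_on_compose2[OF f(1) p(1)] by (simp add: continuous_on_eq_continuous_at)
    have "(\<lambda>n. integral\<^sup>L ((P \<circ> id \<circ> r) n) (\<lambda>x. f (p x))) \<longlonglongrightarrow> integral\<^sup>L Q (\<lambda>x. f (p x))"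
      using weak_conv_imp_integral_bdd_continuous_conv[of "P \<circ> id \<circ> r" Q "\<lambda>x. f (p x)" B]
        dist r cont B by simp
    moreover have "integral\<^sup>L (P n) (\<lambda>x. f (p x)) = integral\<^sup>L (M n) f" for n
    proof -
      have "integral\<^sup>L (P n) (\<lambda>x. f (p x)) = (LINT t|M n. f (p (j t)))"
        unfolding P_def using jm fm pm by (subst integral_distr) auto
      also have "\<dots> = integral\<^sup>L (M n) f"
        using j(2) fm measurable_compose[OF measurable_compose[OF j(1) pm] fm]
        by (intro prob_on_integral_cong[OF M]) auto
      finally show ?thesis .
    qed
    moreover have "integral\<^sup>L Q (\<lambda>x. f (p x)) = integral\<^sup>L (distr Q borel p) f"
      using fm pmQ by (subst integral_distr) auto
    ultimately show "(\<lambda>n. integral\<^sup>L ((M \<circ> r) n) f) \<longlonglongrightarrow> integral\<^sup>L (distr Q borel p) f"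
      by simp
  qed
  ultimately show thesis using that r(1) by blast
qed

section \<open>Power series of the transforms\<close>

text \<open>At regular points this is \<open>1 + psi\<close>, the generating function of all
  moments, and \<open>eta\<close> becomes \<open>1 - 1 / phi\<close> wherever it does not
  vanish.\<close>

definition phi :: "complex measure \<Rightarrow> complex \<Rightarrow> complex" where
  "phi \<mu> z = (LINT t|\<mu>. 1 / (1 - z * t))"

text \<open>Boundedness of \<open>t / (1 - z * t)\<close> on \<open>A\<close>, written as a product
  so that zeros of the denominator are excluded too. It controls all kernels
  \<open>t ^ n / (1 - z * t) ^ Suc n\<close>, even on unbounded \<open>A\<close>.\<close>

definition regular_at :: "complex set \<Rightarrow> complex \<Rightarrow> bool" where
  "regular_at A z \<longleftrightarrow> (\<exists>C. \<forall>t\<in>A. norm t \<le> C * norm (1 - z * t))"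

lemma regular_at_pos:
  assumes "regular_at A z"
  shows "\<exists>C>0. \<forall>t\<in>A. norm t \<le> C * norm (1 - z * t)"
proof -
  obtain C where C: "\<forall>t\<in>A. norm t \<le> C * norm (1 - z * t)"
    using assms by (auto simp: regular_at_def)
  have "norm t \<le> (\<bar>C\<bar> + 1) * norm (1 - z * t)" if "t \<in> A" for t
  proof -
    have "C * norm (1 - z * t) \<le> (\<bar>C\<bar> + 1) * norm (1 - z * t)"
      by (intro mult_right_mono) auto
    then show ?thesis using C that by fastforce
  qed
  then show ?thesis by (intro exI[of _ "\<bar>C\<bar> + 1"]) auto
qed

lemma regular_at_mono: "regular_at A z \<Longrightarrow> B \<subseteq> A \<Longrightarrow> regular_at B z"
  by (auto simp: regular_at_def)

lemma regular_at_nonzero: "regular_at A z \<Longrightarrow> t \<in> A \<Longrightarrow> 1 - z * t \<noteq> 0"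
proof
  assume "regular_at A z" "t \<in> A" and 0: "1 - z * t = 0"
  then obtain C where "norm t \<le> C * norm (1 - z * t)"
    by (auto simp: regular_at_def)
  then have "t = 0" by (simp only: 0) simp
  then show False using 0 by simp
qed

lemma resolvent_bounds:
  fixes t z :: complex
  assumes C: "C > 0" "norm t \<le> C * norm (1 - z * t)"
  shows "norm (t / (1 - z * t)) \<le> C" "norm (1 / (1 - z * t)) \<le> 1 + norm z * C"
proof -
  have nz: "1 - z * t \<noteq> 0"
    using C by (intro regular_at_nonzero[of "{t}"]) (auto simp: regular_at_def)
  show 1: "norm (t / (1 - z * t)) \<le> C"
    using C nz by (simp add: norm_divide field_simps)
  have "1 / (1 - z * t) = 1 + z * (t / (1 - z * t))"
    using nz by (simp add: field_simps)
  then have "norm (1 / (1 - z * t)) \<le> 1 + norm z * norm (t / (1 - z * t))"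
    by (metis norm_mult norm_one norm_triangle_ineq)
  also have "\<dots> \<le> 1 + norm z * C" using 1 by (intro add_left_mono mult_left_mono) auto
  finally show "norm (1 / (1 - z * t)) \<le> 1 + norm z * C" .
qed

lemma integrable_resolvent:
  assumes "prob_on A \<mu>" "regular_at A z"
  shows "integrable \<mu> (\<lambda>t. 1 / (1 - z * t))"
proof -
  obtain C where C: "C > 0" "\<And>t. t \<in> A \<Longrightarrow> norm t \<le> C * norm (1 - z * t)"
    using regular_at_pos[OF assms(2)] by blast
  show ?thesis
    using resolvent_bounds(2)[OF C(1) C(2)] by (intro prob_on_integrable[OF assms(1)]) auto
qed

lemma psi_eq_phi:
  assumes "prob_on A \<mu>" "regular_at A z"
  shows "psi \<mu> z = phi \<mu> z - 1"
proof -
  interpret prob_space \<mu> using assms(1) by (rule prob_on_prob_space)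
  have "psi \<mu> z = (LINT t|\<mu>. 1 / (1 - z * t) - 1)"
    unfolding psi_def using regular_at_nonzero[OF assms(2)]
    by (intro prob_on_integral_cong[OF assms(1)]) (auto simp: field_simps)
  also have "\<dots> = phi \<mu> z - 1"
    using integrable_resolvent[OF assms] by (simp add: phi_def prob_space)
  finally show ?thesis .
qed

lemma eta_eq_phi:
  assumes "prob_on A \<mu>" "regular_at A z" "phi \<mu> z \<noteq> 0"
  shows "eta \<mu> z = 1 - 1 / phi \<mu> z"
  using psi_eq_phi[OF assms(1,2)] assms(3) by (simp add: eta_def field_simps)

text \<open>The Taylor coefficients of \<open>phi\<close> at the centre \<open>z\<close>. At
  \<open>0\<close> they are the moments; at a negative centre they exist for every probability
  measure on the half-line.\<close>

definition phi_coeff :: "complex measure \<Rightarrow> complex \<Rightarrow> nat \<Rightarrow> complex" where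
  "phi_coeff \<mu> z n = (LINT t|\<mu>. t ^ n / (1 - z * t) ^ Suc n)"

text \<open>With \<open>x = t / (1 - z * t)\<close>, the kernel at \<open>z + h\<close> is the
  kernel at \<open>z\<close> times the geometric series of ratio \<open>x * h\<close>. Since
  \<open>norm x \<le> C\<close>, the domination is uniform in \<open>t\<close> and sum and integral
  may be exchanged.\<close>

lemma phi_sums:
  assumes \<mu>: "prob_on A \<mu>" and C: "C > 0" "\<And>t. t \<in> A \<Longrightarrow> norm t \<le> C * norm (1 - z * t)"
    and h: "norm h * C < 1"
  shows "(\<lambda>n. phi_coeff \<mu> z n * h ^ n) sums phi \<mu> (z + h)"
proof -
  interpret prob_space \<mu> using \<mu> by (rule prob_on_prob_space)
  define B where "B = 1 + norm z * C"
  define f where "f n t = t ^ n / (1 - z * t) ^ Suc n * h ^ n" for n t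
  have f_eq: "f n t = 1 / (1 - z * t) * (t / (1 - z * t) * h) ^ n" for n t
    by (simp add: f_def power_divide power_mult_distrib)
  have bound: "norm (f n t) \<le> B * (C * norm h) ^ n" if "t \<in> A" for n t
    unfolding f_eq norm_mult norm_power B_def
    using resolvent_bounds[OF C(1) C(2)[OF that]] C(1)
    by (intro mult_mono power_mono mult_right_mono) (auto simp: norm_mult intro: mult_right_mono)
  have q: "norm (C * norm h) < 1" using h C by (simp add: mult.commute)
  have gsum: "summable (\<lambda>n. B * (C * norm h) ^ n)"
    by (rule summable_mult[OF summable_geometric[OF q]])
  have meas: "f n \<in> borel_measurable borel" for n unfolding f_def by measurable
  have int: "integrable \<mu> (f n)" for n
    using prob_on_integrable[OF \<mu> meas bound] .
  have "(\<lambda>n. integral\<^sup>L \<mu> (f n)) sums (LINT t|\<mu>. suminf (\<lambda>n. f n t))"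
  proof (rule sums_integral[OF int])
    show "AE t in \<mu>. summable (\<lambda>n. norm (f n t))"
    proof (rule prob_on_AE[OF \<mu>])
      fix t assume "t \<in> A"
      then show "summable (\<lambda>n. norm (f n t))"
        using bound by (intro summable_comparison_test'[OF gsum, of 0]) simp
    qed
    have "norm (LINT t|\<mu>. norm (f n t)) \<le> B * (C * norm h) ^ n" for n
      using bound meas by (intro prob_on_integral_bound[OF \<mu>]) auto
    then show "summable (\<lambda>n. LINT t|\<mu>. norm (f n t))"
      by (intro summable_comparison_test'[OF gsum, of 0]) simp
  qed
  moreover have "(LINT t|\<mu>. suminf (\<lambda>n. f n t)) = phi \<mu> (z + h)"
    unfolding phi_def
  proof (rule prob_on_integral_cong[OF \<mu>])
    fix t assume t: "t \<in> A"
    have nz: "1 - z * t \<noteq> 0"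
      using C t by (intro regular_at_nonzero[of A]) (auto simp: regular_at_def)
    have "norm (t / (1 - z * t) * h) \<le> C * norm h"
      unfolding norm_mult using resolvent_bounds(1)[OF C(1) C(2)[OF t]] by (intro mult_right_mono) auto
    then have lt: "norm (t / (1 - z * t) * h) < 1" using q C by simp
    then have "(\<lambda>n. f n t) sums (1 / (1 - z * t) * (1 / (1 - t / (1 - z * t) * h)))"
      unfolding f_eq by (intro sums_mult geometric_sums)
    moreover have "1 - t / (1 - z * t) * h = (1 - (z + h) * t) / (1 - z * t)"
      using nz by (simp add: field_simps)
    ultimately show "suminf (\<lambda>n. f n t) = 1 / (1 - (z + h) * t)"
      using nz by (simp add: sums_iff)
  next
    show "(\<lambda>t. suminf (\<lambda>n. f n t)) \<in> borel_measurable borel"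
      using meas by measurable
  qed auto
  moreover have "integral\<^sup>L \<mu> (f n) = phi_coeff \<mu> z n * h ^ n" for n
    unfolding f_def phi_coeff_def by (rule integral_mult_left_zero)
  ultimately show ?thesis by simp
qed

lemma phi_has_fps_expansion:
  assumes "prob_on A \<mu>" "regular_at A z"
  shows "(\<lambda>h. phi \<mu> (z + h)) has_fps_expansion Abs_fps (phi_coeff \<mu> z)"
proof -
  obtain C where C: "C > 0" "\<And>t. t \<in> A \<Longrightarrow> norm t \<le> C * norm (1 - z * t)"
    using regular_at_pos[OF assms(2)] by blast
  show ?thesis
  proof (rule has_fps_expansionI)
    have "eventually (\<lambda>h :: complex. h \<in> ball 0 (1 / C)) (nhds 0)"
      using C by (intro eventually_nhds_in_open) auto
    then show "eventually (\<lambda>h. (\<lambda>n. Abs_fps (phi_coeff \<mu> z) $ n * h ^ n) sums phi \<mu> (z + h)) (nhds 0)"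
    proof eventually_elim
      case (elim h)
      then have "norm h * C < 1" using C(1) by (simp add: field_simps)
      then show ?case using phi_sums[OF assms(1) C] by simp
    qed
  qed
qed

lemma phi_analytic: "prob_on A \<mu> \<Longrightarrow> regular_at A z \<Longrightarrow> phi \<mu> analytic_on {z}"
  by (rule has_fps_expansion_imp_analytic[OF phi_has_fps_expansion])

lemma phi_holomorphic:
  assumes "prob_on A \<mu>" "\<And>z. z \<in> U \<Longrightarrow> regular_at A z"
  shows "phi \<mu> holomorphic_on U"
  using phi_analytic[OF assms(1)] assms(2)
  by (meson analytic_imp_holomorphic analytic_on_analytic_at)

lemma eta_holomorphic:
  assumes "prob_on A \<mu>" "\<And>z. z \<in> U \<Longrightarrow> regular_at A z" "\<And>z. z \<in> U \<Longrightarrow> phi \<mu> z \<noteq> 0"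
  shows "eta \<mu> holomorphic_on U"
proof -
  have "(\<lambda>z. 1 - 1 / phi \<mu> z) holomorphic_on U"
    by (intro holomorphic_intros phi_holomorphic[OF assms(1,2)] assms(3))
  then show ?thesis
    by (rule holomorphic_transform) (use eta_eq_phi[OF assms(1,2)] assms(3) in auto)
qed

lemma regular_at_near_0:
  assumes "A \<subseteq> cball 0 R" "norm z * R < 1"
  shows "regular_at A z"
  unfolding regular_at_def
proof (intro exI ballI)
  fix t assume "t \<in> A"
  then have t: "norm t \<le> R" using assms by auto
  then have "R \<ge> 0" using norm_ge_zero[of t] by linarith
  have "norm (z * t) \<le> norm z * R" using t by (simp add: norm_mult mult_left_mono)
  moreover have "1 - norm (z * t) \<le> norm (1 - z * t)"
    using norm_triangle_ineq2[of 1 "z * t"] by simp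
  ultimately have *: "1 - norm z * R \<le> norm (1 - z * t)" by linarith
  have "norm t \<le> R * 1" using t by simp
  also have "\<dots> \<le> R * (norm (1 - z * t) / (1 - norm z * R))"
    using * assms(2) \<open>R \<ge> 0\<close> by (intro mult_left_mono) (auto simp: field_simps)
  finally show "norm t \<le> R / (1 - norm z * R) * norm (1 - z * t)" by (simp add: field_simps)
qed

lemma phi_coeff_0: "phi_coeff \<mu> 0 = moment \<mu>"
  by (simp add: phi_coeff_def moment_def fun_eq_iff)

text \<open>The radius gives \<open>norm (z * t) < 1 / 3\<close>, so \<open>1 - z * t\<close> is at
  least \<open>2 / 3\<close>, \<open>psi\<close> at most \<open>1 / 2\<close> and
  \<open>1 + psi\<close> at least \<open>1 / 2\<close> in norm. The two losses \<open>3 / 2\<close>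
  and \<open>2\<close> multiply to the constant \<open>3\<close>.\<close>

lemma prob_on_cball_eta:
  assumes \<mu>: "prob_on A \<mu>" and A: "A \<subseteq> cball 0 R" and R: "R \<ge> 1" and z: "norm z < 1 / (3 * R)"
  shows "regular_at A z" "phi \<mu> z \<noteq> 0" "norm (eta \<mu> z) \<le> 3 * R * norm z"
proof -
  interpret prob_space \<mu> using \<mu> by (rule prob_on_prob_space)
  have zR: "norm z * R < 1 / 3" using z R by (simp add: field_simps)
  then show reg: "regular_at A z" by (intro regular_at_near_0[OF A]) simp
  have "norm (psi \<mu> z) \<le> norm z * (3 * R / 2)"
    unfolding psi_def
  proof (rule prob_on_integral_bound[OF \<mu>])
    fix t assume "t \<in> A"
    then have t: "norm t \<le> R" using A by auto
    have "norm (z * t) \<le> norm z * R" using t by (simp add: norm_mult mult_left_mono)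
    moreover have "1 - norm (z * t) \<le> norm (1 - z * t)"
      using norm_triangle_ineq2[of 1 "z * t"] by simp
    ultimately have *: "2 / 3 \<le> norm (1 - z * t)" using zR by linarith
    have "norm (z * t / (1 - z * t)) = norm (z * t) / norm (1 - z * t)" by (rule norm_divide)
    also have "\<dots> \<le> (norm z * R) / (2 / 3)"
      using * \<open>norm (z * t) \<le> norm z * R\<close> R by (intro frac_le) auto
    finally show "norm (z * t / (1 - z * t)) \<le> norm z * (3 * R / 2)" by simp
  qed auto
  then have p: "norm (psi \<mu> z) \<le> 3 / 2 * (norm z * R)" by (simp add: algebra_simps)
  then have p2: "norm (psi \<mu> z) \<le> 1 / 2" using zR by linarith
  have "norm (1::complex) - norm (psi \<mu> z) \<le> norm (1 + psi \<mu> z)" by (rule norm_diff_ineq)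
  then have 1: "1 / 2 \<le> norm (1 + psi \<mu> z)" using p2 by simp
  then show "phi \<mu> z \<noteq> 0" using psi_eq_phi[OF \<mu> reg] by auto
  have "norm (eta \<mu> z) \<le> (3 / 2 * (norm z * R)) / (1 / 2)"
    unfolding eta_def norm_divide using p 1 R by (intro frac_le) auto
  then show "norm (eta \<mu> z) \<le> 3 * R * norm z" by (simp add: algebra_simps)
qed

lemma eta_0 [simp]: "eta \<mu> 0 = 0"
  by (simp add: eta_def psi_def)

lemma eta_has_fps_expansion:
  assumes \<mu>: "prob_on A \<mu>" and A: "A \<subseteq> cball 0 R"
  shows "eta \<mu> has_fps_expansion 1 - inverse (Abs_fps (moment \<mu>))"
proof -
  interpret prob_space \<mu> using \<mu> by (rule prob_on_prob_space)
  have phi: "phi \<mu> has_fps_expansion Abs_fps (moment \<mu>)"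
    using phi_has_fps_expansion[OF \<mu> regular_at_near_0[OF A, of 0]] by (simp add: phi_coeff_0)
  have m0: "moment \<mu> 0 = 1" by (simp add: moment_def prob_space)
  have *: "(\<lambda>z. 1 - inverse (phi \<mu> z)) has_fps_expansion 1 - inverse (Abs_fps (moment \<mu>))"
    using phi by (intro fps_expansion_intros) (auto simp: m0)
  \<comment> \<open>The estimates near \<open>0\<close> are stated for radii at least
    \<open>1\<close>, while \<open>R\<close> is arbitrary here.\<close>
  have A': "A \<subseteq> cball 0 (max R 1)" using A by auto
  have "eventually (\<lambda>z :: complex. z \<in> ball 0 (1 / (3 * max R 1))) (nhds 0)"
    by (intro eventually_nhds_in_open) auto
  then have "eventually (\<lambda>z. eta \<mu> z = 1 - inverse (phi \<mu> z)) (nhds 0)"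
  proof eventually_elim
    case (elim z)
    then show ?case
      using prob_on_cball_eta(1,2)[OF \<mu> A' _, of z] eta_eq_phi[OF \<mu>, of z] by (simp add: inverse_eq_divide)
  qed
  then show ?thesis by (subst has_fps_expansion_cong[OF _ refl]) (use * in auto)
qed

lemma deriv_eta_0:
  assumes \<mu>: "prob_on A \<mu>" and A: "A \<subseteq> cball 0 R"
  shows "deriv (eta \<mu>) 0 = moment \<mu> 1"
proof -
  interpret prob_space \<mu> using \<mu> by (rule prob_on_prob_space)
  have m0: "moment \<mu> 0 = 1" by (simp add: moment_def prob_space)
  have "deriv (eta \<mu>) 0 = (1 - inverse (Abs_fps (moment \<mu>))) $ 1"
    using fps_nth_fps_expansion[OF eta_has_fps_expansion[OF assms], of 1] by simp
  also have "\<dots> = moment \<mu> 1"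
    using m0 by (simp add: fps_inverse_def)
  finally show ?thesis .
qed

text \<open>Uniform continuity of the kernel on \<open>L \<times> K\<close> gives a modulus of
  continuity for \<open>phi \<mu>\<close> that is the same for all measures on \<open>K\<close>;
  pointwise convergence on a finite net of \<open>L\<close> is then enough.\<close>

lemma phi_uniform_limit:
  assumes K: "compact K" and M: "\<And>n. prob_on K (M n)" and N: "prob_on K N"
    and w: "weakly_converges M N" and L: "compact L" "\<And>z. z \<in> L \<Longrightarrow> regular_at K z"
  shows "uniform_limit L (\<lambda>n. phi (M n)) (phi N) sequentially"
proof (rule uniform_limitI)
  fix e :: real assume e: "e > 0"
  have lim: "(\<lambda>n. phi (M n) z) \<longlonglongrightarrow> phi N z" if "z \<in> L" for z
    unfolding phi_def using regular_at_nonzero[OF L(2)[OF that]]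
    by (intro weakly_converges_complex[OF K M N w] continuous_intros) auto
  have "uniformly_continuous_on (L \<times> K) (\<lambda>(z, t). 1 / (1 - z * t))"
    using K L regular_at_nonzero unfolding case_prod_unfold
    by (intro compact_uniformly_continuous continuous_intros compact_Times) auto
  then have "\<exists>d>0. \<forall>x\<in>L \<times> K. \<forall>x'\<in>L \<times> K. dist x' x < d \<longrightarrow>
      dist (case x' of (z, t) \<Rightarrow> 1 / (1 - z * t)) (case x of (z, t) \<Rightarrow> 1 / (1 - z * t)) < e / 4"
    unfolding uniformly_continuous_on_def using e by (metis (no_types, lifting) zero_less_divide_iff zero_less_numeral)
  then obtain d where d: "d > 0" "\<forall>x\<in>L \<times> K. \<forall>x'\<in>L \<times> K. dist x' x < d \<longrightarrow>
      dist (case x' of (z, t) \<Rightarrow> 1 / (1 - z * t)) (case x of (z, t) \<Rightarrow> 1 / (1 - z * t)) < e / 4"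
    by blast
  have close: "norm (phi \<mu> z - phi \<mu> z') \<le> e / 4"
    if \<mu>: "prob_on K \<mu>" and z: "z \<in> L" "z' \<in> L" "dist z' z < d" for \<mu> z z'
  proof -
    have "phi \<mu> z - phi \<mu> z' = (LINT t|\<mu>. 1 / (1 - z * t) - 1 / (1 - z' * t))"
      unfolding phi_def using z L by (intro Bochner_Integration.integral_diff[symmetric] integrable_resolvent[OF \<mu>]) auto
    also have "norm \<dots> \<le> e / 4"
    proof (rule prob_on_integral_bound[OF \<mu>])
      fix t assume "t \<in> K"
      then show "norm (1 / (1 - z * t) - 1 / (1 - z' * t)) \<le> e / 4"
        using d(2)[rule_format, of "(z', t)" "(z, t)"] z
        by (simp add: dist_prod_def dist_norm norm_minus_commute)
    qed auto
    finally show ?thesis .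
  qed
  obtain Z where Z: "finite Z" "Z \<subseteq> L" "L \<subseteq> (\<Union>x\<in>Z. ball x d)"
    using seq_compact_imp_totally_bounded[of L] L(1) d(1) compact_imp_seq_compact by metis
  have "eventually (\<lambda>n. \<forall>z\<in>Z. dist (phi (M n) z) (phi N z) < e / 4) sequentially"
    using Z e lim by (intro eventually_ball_finite ballI tendstoD) auto
  then show "eventually (\<lambda>n. \<forall>z\<in>L. dist (phi (M n) z) (phi N z) < e) sequentially"
  proof eventually_elim
    case (elim n)
    show ?case
    proof
      fix z assume z: "z \<in> L"
      then obtain x where x: "x \<in> Z" "dist x z < d" using Z by auto
      then have xL: "x \<in> L" using Z by auto
      have "dist (phi (M n) z) (phi (M n) x) \<le> e / 4" "dist (phi N x) (phi N z) \<le> e / 4"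
        using close[OF M[of n] z xL] close[OF N z xL] x(2) by (auto simp: dist_norm norm_minus_commute)
      moreover have "dist (phi (M n) x) (phi N x) < e / 4" using elim x by blast
      ultimately show "dist (phi (M n) z) (phi N z) < e"
        using e dist_triangle[of "phi (M n) z" "phi N z" "phi (M n) x"]
          dist_triangle[of "phi (M n) x" "phi N z" "phi N x"] by linarith
    qed
  qed
qed

text \<open>Inverting \<open>phi\<close> uniformly needs a lower bound for the limit. It is the
  minimum of \<open>norm (phi N)\<close> on the compact set, positive since \<open>phi N\<close> has
  no zeros there.\<close>

lemma eta_convergesI:
  assumes K: "compact K" and M: "\<And>n. prob_on K (M n)" and N: "prob_on K N"
    and w: "weakly_converges M N" and D: "\<And>z. z \<in> D \<Longrightarrow> regular_at K z"
    and nz: "\<And>z \<mu>. z \<in> D \<Longrightarrow> prob_on K \<mu> \<Longrightarrow> phi \<mu> z \<noteq> 0"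
  shows "eta_converges D M N"
  unfolding eta_converges_def
proof safe
  fix L assume L: "compact L" "L \<subseteq> D"
  show "uniform_limit L (\<lambda>n. eta (M n)) (eta N) sequentially"
  proof (cases "L = {}")
    case False
    have "continuous_on L (\<lambda>z. norm (phi N z))"
      using L D by (intro continuous_intros holomorphic_on_imp_continuous_on phi_holomorphic[OF N]) auto
    then obtain z0 where z0: "z0 \<in> L" "\<And>z. z \<in> L \<Longrightarrow> norm (phi N z0) \<le> norm (phi N z)"
      using continuous_attains_inf[OF L(1) False] by metis
    have "uniform_limit L (\<lambda>n z. inverse (phi (M n) z)) (inverse \<circ> phi N) sequentially"
      using z0 nz[of z0 N] N L D
      by (intro uniform_lim_inverse[of _ _ _ _ "norm (phi N z0)"]
          phi_uniform_limit[OF K M N w]) auto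
    then have "uniform_limit L (\<lambda>n z. 1 - inverse (phi (M n) z)) (\<lambda>z. 1 - inverse (phi N z)) sequentially"
      by (intro uniform_limit_intros) (simp add: comp_def)
    then show ?thesis
    proof (rule uniform_limit_cong'[THEN iffD1, rotated 2])
      show "1 - inverse (phi (M n) z) = eta (M n) z" if "z \<in> L" for n z
        using eta_eq_phi[OF M[of n] D nz] M that L by (auto simp: inverse_eq_divide)
      show "1 - inverse (phi N z) = eta N z" if "z \<in> L" for z
        using eta_eq_phi[OF N D nz] N that L by (auto simp: inverse_eq_divide)
    qed
  qed simp
qed

section \<open>The Herglotz representation\<close>

text \<open>Fourier coefficients of \<open>H\<close> on a circle: those of nonnegative index are
  Taylor coefficients by Cauchy's formula, those of negative index vanish by Cauchy's
  theorem.\<close>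

lemma has_integral_cis_fourier:
  assumes H: "H holomorphic_on ball 0 1" and r: "0 < r" "r < 1"
  shows "((\<lambda>t. H (of_real r * cis t) * cis (- (real k * t))) has_integral
      of_real (2 * pi * r ^ k) * ((deriv ^^ k) H 0 / fact k)) {0..2 * pi}" (is ?coeff)
    and "((\<lambda>t. H (of_real r * cis t) * cis (real (Suc k) * t)) has_integral 0) {0..2 * pi}" (is ?zero)
proof -
  have sub: "cball 0 r \<subseteq> ball (0 :: complex) 1" "ball 0 r \<subseteq> ball (0 :: complex) 1" using r by auto
  have hol: "H holomorphic_on ball 0 r" and cont: "continuous_on (cball 0 r) H"
    using holomorphic_on_subset[OF H] sub holomorphic_on_imp_continuous_on by blast+
  have nz: "complex_of_real r * cis t \<noteq> 0" for t using r by auto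
  have cis_pow: "cis (real n * t) = cis t ^ n" for n t by (simp add: Complex.DeMoivre)
  have cis_neg: "cis (- (real k * t)) = inverse (cis t ^ k)" for t
    by (simp only: cis_inverse[symmetric] cis_pow)
  have "((\<lambda>u. H u / (u - 0) ^ Suc k) has_contour_integral
      ((2 * pi * \<i>) / fact k * (deriv ^^ k) H 0)) (circlepath 0 r)"
    using r by (intro Cauchy_has_contour_integral_higher_derivative_circlepath cont hol) auto
  then have "((\<lambda>t. H (of_real r * cis t) / (of_real r * cis t) ^ Suc k * of_real r * \<i> * cis t)
      has_integral ((2 * pi * \<i>) / fact k * (deriv ^^ k) H 0)) {0..2 * pi}"
    by (simp add: circlepath_def has_contour_integral_part_circlepath_iff)
  then have "((\<lambda>t. of_real r ^ k / \<i> * (H (of_real r * cis t) / (of_real r * cis t) ^ Suc k * of_real r * \<i> * cis t))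
      has_integral of_real r ^ k / \<i> * ((2 * pi * \<i>) / fact k * (deriv ^^ k) H 0)) {0..2 * pi}"
    by (rule has_integral_mult_right)
  moreover have "of_real r ^ k / \<i> * (H (of_real r * cis t) / (of_real r * cis t) ^ Suc k * of_real r * \<i> * cis t)
      = H (of_real r * cis t) * cis (- (real k * t))" for t
    using r nz[of t] unfolding cis_neg by (simp add: field_simps power_mult_distrib)
  moreover have "of_real r ^ k / \<i> * ((2 * pi * \<i>) / fact k * (deriv ^^ k) H 0)
      = of_real (2 * pi * r ^ k) * ((deriv ^^ k) H 0 / fact k)"
    by (simp add: field_simps)
  ultimately show ?coeff by simp
  have "((\<lambda>u. H u * u ^ k) has_contour_integral 0) (circlepath 0 r)"
    using r sub by (intro Cauchy_theorem_disc_simple[of _ 0 1] holomorphic_intros H) (auto simp: path_image_circlepath_nonneg)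
  then have "((\<lambda>t. H (of_real r * cis t) * (of_real r * cis t) ^ k * of_real r * \<i> * cis t)
      has_integral 0) {0..2 * pi}"
    by (simp add: circlepath_def has_contour_integral_part_circlepath_iff)
  then have "((\<lambda>t. 1 / (of_real r ^ Suc k * \<i>) * (H (of_real r * cis t) * (of_real r * cis t) ^ k * of_real r * \<i> * cis t))
      has_integral 1 / (of_real r ^ Suc k * \<i>) * 0) {0..2 * pi}"
    by (rule has_integral_mult_right)
  moreover have "1 / (of_real r ^ Suc k * \<i>) * (H (of_real r * cis t) * (of_real r * cis t) ^ k * of_real r * \<i> * cis t)
      = H (of_real r * cis t) * cis (real (Suc k) * t)" for t
    using r unfolding cis_pow by (simp add: field_simps power_mult_distrib)
  ultimately show ?zero by simp
qed

text \<open>In \<open>Re x = (x + cnj x) / 2\<close> the conjugate half sees the coefficients of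
  negative index: nothing for \<open>k > 0\<close>, and a second copy of \<open>H 0 = 1\<close> for
  \<open>k = 0\<close>. Hence the case distinction.\<close>

lemma has_integral_Re_cis:
  assumes H: "H holomorphic_on ball 0 1" "H 0 = 1" and r: "0 < r" "r < 1"
  shows "((\<lambda>t. of_real (Re (H (of_real r * cis t))) * cis (- (real k * t))) has_integral
      of_real (2 * pi) * (if k = 0 then 1 else of_real (r ^ k) * ((deriv ^^ k) H 0 / fact k) / 2)) {0..2 * pi}"
proof -
  have Re: "of_real (Re x) * y = (1 / 2) * (x * y + cnj (x * cnj y))" for x y
    by (simp add: complex_eq_iff field_simps)
  obtain I where I: "((\<lambda>t. H (of_real r * cis t) * cis (real k * t)) has_integral I) {0..2 * pi}"
    "k = 0 \<Longrightarrow> I = of_real (2 * pi)" "k \<noteq> 0 \<Longrightarrow> I = 0"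
    using has_integral_cis_fourier(1)[OF H(1) r, of 0] has_integral_cis_fourier(2)[OF H(1) r] H(2)
    by (cases k) auto
  have "((\<lambda>t. cnj (H (of_real r * cis t) * cis (real k * t))) has_integral cnj I) {0..2 * pi}"
    using I(1) has_integral_cnj[of "\<lambda>t. H (of_real r * cis t) * cis (real k * t)" I] by (simp only: comp_def)
  from has_integral_mult_right[OF has_integral_add[OF has_integral_cis_fourier(1)[OF H(1) r, of k] this], of "1 / 2"]
  have "((\<lambda>t. of_real (Re (H (of_real r * cis t))) * cis (- (real k * t))) has_integral
      1 / 2 * (of_real (2 * pi * r ^ k) * ((deriv ^^ k) H 0 / fact k) + cnj I)) {0..2 * pi}"
    by (simp only: Re cis_cnj minus_minus)
  moreover have "1 / 2 * (of_real (2 * pi * r ^ k) * ((deriv ^^ k) H 0 / fact k) + cnj I) =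
      of_real (2 * pi) * (if k = 0 then 1 else of_real (r ^ k) * ((deriv ^^ k) H 0 / fact k) / 2)"
    using I(2,3) H(2) by (cases "k = 0") (simp_all add: field_simps)
  ultimately show ?thesis by (simp only:)
qed

text \<open>\<open>Re H\<close> on the circle of radius \<open>r\<close>, divided by
  \<open>2 * pi\<close>, is a probability density by positivity and the mean value property; staying
  at \<open>r < 1\<close> avoids boundary values of \<open>H\<close>.\<close>

lemma sphere_moments:
  assumes H: "H holomorphic_on ball 0 1" "H 0 = 1" "\<And>z. norm z < 1 \<Longrightarrow> Re (H z) \<ge> 0"
    and r: "0 < r" "r < 1"
  shows "\<exists>\<nu>. prob_on (sphere 0 1) \<nu> \<and>
    (\<forall>k. moment \<nu> k = (if k = 0 then 1 else of_real (r ^ k) * ((deriv ^^ k) H 0 / fact k) / 2))"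
proof -
  define w where "w t = Re (H (of_real r * cis t)) / (2 * pi)" for t
  have in_ball: "norm (of_real r * cis t) < 1" for t using r by (simp add: norm_mult)
  have w_nonneg: "w t \<ge> 0" for t using H(3)[OF in_ball] by (simp add: w_def)
  have "continuous_on UNIV (\<lambda>t. H (of_real r * cis t))"
  proof (rule continuous_on_compose2[OF holomorphic_on_imp_continuous_on[OF H(1)]])
    show "continuous_on UNIV (\<lambda>t. of_real r * cis t)" by (intro continuous_intros)
    show "(\<lambda>t. of_real r * cis t) ` UNIV \<subseteq> ball 0 1"
      using r by (auto simp: norm_mult)
  qed
  then have w_cont: "continuous_on A w" for A
    unfolding w_def by (intro continuous_intros) (auto intro: continuous_on_subset)
  define g where "g t = indicator {0..2 * pi} t * w t" for t
  have g_meas[measurable]: "g \<in> borel_measurable borel"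
    using borel_measurable_continuous_on_indicator[of "{0..2 * pi}" w] w_cont by (simp add: g_def[abs_def])
  have g_nonneg: "g t \<ge> 0" for t using w_nonneg by (simp add: g_def)
  define P where "P = density lborel (\<lambda>t. ennreal (g t))"
  have int: "(LINT t|P. cis (- (real k * t))) =
      (if k = 0 then 1 else of_real (r ^ k) * ((deriv ^^ k) H 0 / fact k) / 2)" (is "_ = ?c k") for k
  proof -
    have "((\<lambda>t. of_real (1 / (2 * pi)) * (of_real (Re (H (of_real r * cis t))) * cis (- (real k * t)))) has_integral
        of_real (1 / (2 * pi)) * (of_real (2 * pi) * ?c k)) {0..2 * pi}"
      by (intro has_integral_mult_right has_integral_Re_cis H r)
    moreover have "of_real (1 / (2 * pi)) * (of_real (2 * pi) * ?c k) = ?c k" by simp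
    moreover have "of_real (1 / (2 * pi)) * (of_real (Re (H (of_real r * cis t))) * cis (- (real k * t)))
        = w t *\<^sub>R cis (- (real k * t))" for t
      by (simp add: w_def scaleR_conv_of_real)
    ultimately have hi: "((\<lambda>t. w t *\<^sub>R cis (- (real k * t))) has_integral ?c k) {0..2 * pi}"
      by (simp only:)
    have si: "set_integrable lborel {0..2 * pi} (\<lambda>t. w t *\<^sub>R cis (- (real k * t)))"
      by (intro borel_integrable_atLeastAtMost' continuous_intros w_cont)
    have "(LINT t|P. cis (- (real k * t))) = (LINT t|lborel. g t *\<^sub>R cis (- (real k * t)))"
      unfolding P_def using g_nonneg by (intro integral_density) (auto intro!: borel_measurable_continuous_onI continuous_intros)
    also have "\<dots> = (LINT t:{0..2 * pi}|lborel. w t *\<^sub>R cis (- (real k * t)))"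
      by (simp add: g_def set_lebesgue_integral_def)
    also have "\<dots> = ?c k"
      using set_borel_integral_eq_integral(2)[OF si] integral_unique[OF hi] by simp
    finally show ?thesis .
  qed
  have "prob_space P"
  proof
    have gi: "integrable lborel g"
      using borel_integrable_atLeastAtMost'[OF w_cont, of 0 "2 * pi"] by (simp add: set_integrable_def g_def[abs_def])
    have "(LINT t|P. cis (- (real 0 * t))) = (LINT t|lborel. g t *\<^sub>R 1)"
      unfolding P_def using g_nonneg by (subst integral_density) auto
    also have "\<dots> = of_real (integral\<^sup>L lborel g)"
      by (simp add: scaleR_conv_of_real)
    finally have "integral\<^sup>L lborel g = 1" using int[of 0] by simp
    then have "(\<integral>\<^sup>+t. ennreal (g t) \<partial>lborel) = 1"
      using nn_integral_eq_integral[OF gi] g_nonneg by simp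
    then show "emeasure P (space P) = 1"
      unfolding P_def by (subst emeasure_density) auto
  qed
  then interpret P: prob_space P .
  have cm: "(\<lambda>t. cis (- t)) \<in> borel_measurable P"
    unfolding P_def by (auto intro!: borel_measurable_continuous_onI continuous_intros)
  \<comment> \<open>The image under \<open>cis (- t)\<close>, rather than \<open>cis t\<close>,
    makes the integrals of \<open>cis (- (real k * t))\<close> moments of nonnegative order.\<close>
  have "prob_on (sphere 0 1) (distr P borel (\<lambda>t. cis (- t)))"
    using cm by (intro prob_on_distr P.prob_space_axioms) auto
  moreover have "moment (distr P borel (\<lambda>t. cis (- t))) k = ?c k" for k
  proof -
    have "moment (distr P borel (\<lambda>t. cis (- t))) k = (LINT t|P. cis (- t) ^ k)"
      unfolding moment_def using cm by (subst integral_distr) auto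
    also have "(\<lambda>t. cis (- t) ^ k) = (\<lambda>t. cis (- (real k * t)))"
      by (simp add: Complex.DeMoivre)
    finally show ?thesis by (simp only: int)
  qed
  ultimately show ?thesis by blast
qed

text \<open>The circle is cut open by the argument, computed as \<open>arccos (Re t)\<close> with
  the sign of \<open>Im t\<close>. Clamping makes \<open>a\<close> continuous on the whole line,
  hence \<open>j\<close> Borel; \<open>- 4\<close> and \<open>4\<close> are simple bounds beyond
  \<open>pi\<close>.\<close>

lemma sphere_Helly:
  assumes "\<And>n :: nat. prob_on (sphere 0 1) (M n)"
  obtains r N where "strict_mono r" "prob_on (sphere 0 1) N" "weakly_converges (M \<circ> r) N"
proof -
  define a where "a x = arccos (max (- 1) (min 1 x))" for x :: real
  have "continuous_on UNIV a"
    unfolding a_def by (intro continuous_on_compose2[OF continuous_on_arccos'] continuous_intros) auto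
  then have am[measurable]: "a \<in> borel_measurable borel" by (rule borel_measurable_continuous_onI)
  have a_bd: "0 \<le> a x" "a x \<le> pi" for x
    unfolding a_def by (auto intro!: arccos_lbound arccos_ubound)
  have a_cos: "cos (a x) = x" if "\<bar>x\<bar> \<le> 1" for x
    using that by (simp add: a_def max_def min_def abs_le_iff)
  define j where "j t = (if Im t \<ge> 0 then a (Re t) else - a (Re t))" for t
  have jm: "j \<in> borel_measurable borel" unfolding j_def by measurable
  have cj: "cis (j t) = t" if "t \<in> sphere 0 1" for t
  proof -
    have n: "(Re t)\<^sup>2 + (Im t)\<^sup>2 = 1" using that by (simp add: cmod_def)
    have "\<bar>Re t\<bar> \<le> 1" using that abs_Re_le_cmod[of t] by simp
    then have c: "cos (a (Re t)) = Re t" by (rule a_cos)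
    have "sin (a (Re t)) = sqrt (1 - (cos (a (Re t)))\<^sup>2)"
      using a_bd[of "Re t"] sin_ge_zero[of "a (Re t)"] by (simp add: sin_squared_eq[symmetric])
    also have "\<dots> = sqrt ((Im t)\<^sup>2)"
      unfolding c using n by (intro arg_cong[where f=sqrt]) linarith
    finally have s: "sin (a (Re t)) = \<bar>Im t\<bar>" by simp
    show ?thesis using c s by (auto simp: j_def complex_eq_iff)
  qed
  show thesis
  proof (rule prob_on_Helly[of cis "sphere 0 1" j "- 4" 4 M])
    show "- 4 < j t \<and> j t \<le> 4" for t
      using a_bd[of "Re t"] pi_less_4 by (auto simp: j_def)
  qed (use jm cj assms that in \<open>auto intro!: continuous_intros\<close>)
qed

lemma regular_at_sphere: "norm z < 1 \<Longrightarrow> regular_at (sphere 0 1) z"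
  by (rule regular_at_near_0[of _ 1]) auto

lemma phi_sphere_sums:
  assumes "prob_on (sphere 0 1) \<nu>" "norm z < 1"
  shows "(\<lambda>k. moment \<nu> k * z ^ k) sums phi \<nu> z"
  using phi_sums[OF assms(1), of 1 0 z] assms(2) by (simp add: phi_coeff_0)

text \<open>The measures on radii tending to \<open>1\<close> have moments damped by
  \<open>r ^ k\<close>, and a weak limit point has the undamped ones. The form
  \<open>2 * phi - 1\<close> is the integral of \<open>(1 + z * t) / (1 - z * t)\<close>.\<close>

lemma Herglotz_representation:
  assumes H: "H holomorphic_on ball 0 1" "H 0 = 1" "\<And>z. norm z < 1 \<Longrightarrow> Re (H z) \<ge> 0"
  shows "\<exists>\<nu>. prob_on (sphere 0 1) \<nu> \<and> (\<forall>z. norm z < 1 \<longrightarrow> H z = 2 * phi \<nu> z - 1)"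
proof -
  define a where "a k = (deriv ^^ k) H 0 / fact k" for k
  define r where "r n = 1 - 1 / real (n + 2)" for n
  have r: "0 < r n" "r n < 1" for n by (auto simp: r_def field_simps)
  have r_lim: "r \<longlonglongrightarrow> 1" unfolding r_def by real_asymp
  have "\<forall>n. \<exists>\<nu>. prob_on (sphere 0 1) \<nu> \<and>
      (\<forall>k. moment \<nu> k = (if k = 0 then 1 else of_real (r n ^ k) * a k / 2))"
    unfolding a_def using sphere_moments[OF H r] by blast
  then obtain M where M: "\<And>n. prob_on (sphere 0 1) (M n)"
    "\<And>n k. moment (M n) k = (if k = 0 then 1 else of_real (r n ^ k) * a k / 2)"
    by (metis (no_types, lifting))
  obtain s N where s: "strict_mono s" and N: "prob_on (sphere 0 1) N" and w: "weakly_converges (M \<circ> s) N"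
    using sphere_Helly[OF M(1)] .
  have mom: "moment N k = (if k = 0 then 1 else a k / 2)" for k
  proof (rule LIMSEQ_unique)
    show "(\<lambda>n. moment ((M \<circ> s) n) k) \<longlonglongrightarrow> moment N k"
      unfolding moment_def using M(1) N w
      by (intro weakly_converges_complex[OF _ _ N w]) (auto intro!: continuous_intros)
    have "(\<lambda>n. r (s n)) \<longlonglongrightarrow> 1"
      using LIMSEQ_subseq_LIMSEQ[OF r_lim s] by (simp add: comp_def)
    then have "(\<lambda>n. of_real (r (s n) ^ k) * a k / 2) \<longlonglongrightarrow> of_real (1 ^ k) * a k / 2"
      by (intro tendsto_intros) auto
    then show "(\<lambda>n. moment ((M \<circ> s) n) k) \<longlonglongrightarrow> (if k = 0 then 1 else a k / 2)"
      using M(2) by (cases "k = 0") simp_all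
  qed
  have "H z = 2 * phi N z - 1" if z: "norm z < 1" for z
  proof (rule sums_unique2)
    show "(\<lambda>k. a k * z ^ k) sums H z"
      using holomorphic_power_series[OF H(1), of z] z by (simp add: a_def)
    have "(\<lambda>k. 2 * (moment N k * z ^ k) - (if k = 0 then 1 else 0)) sums (2 * phi N z - 1)"
      by (intro sums_diff sums_mult phi_sphere_sums N z sums_single[of 0 "\<lambda>_. 1"])
    moreover have "2 * (moment N k * z ^ k) - (if k = 0 then 1 else 0) = a k * z ^ k" for k
      using H(2) by (auto simp: mom a_def)
    ultimately show "(\<lambda>k. a k * z ^ k) sums (2 * phi N z - 1)" by simp
  qed
  then show ?thesis using N by blast
qed

section \<open>The unit circle\<close>

text \<open>By Schwarz's lemma these are exactly the holomorphic self-maps of the disc that fix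
  \<open>0\<close>; the bound by \<open>norm z\<close> composes without further argument.\<close>

definition disc_class :: "(complex \<Rightarrow> complex) \<Rightarrow> bool" where
  "disc_class f \<longleftrightarrow> f holomorphic_on ball 0 1 \<and> (\<forall>z\<in>ball 0 1. norm (f z) \<le> norm z)"

text \<open>The map \<open>1 / (1 - w)\<close> sends the disc into the half-plane
  \<open>Re > 1 / 2\<close>. The explicit \<open>c\<close>, which comes from
  \<open>norm (1 - w) \<le> 2\<close>, is a bound uniform in \<open>t\<close>, so that strictness
  survives integration.\<close>

lemma Re_phi_sphere:
  assumes "prob_on (sphere 0 1) \<nu>" "norm z < 1"
  shows "Re (phi \<nu> z) > 1 / 2"
proof -
  interpret prob_space \<nu> using assms(1) by (rule prob_on_prob_space)
  define c where "c = 1 / 2 + (1 - (norm z)\<^sup>2) / 8"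
  have "(LINT t|\<nu>. c) \<le> (LINT t|\<nu>. Re (1 / (1 - z * t)))"
  proof (rule integral_mono_AE)
    show "integrable \<nu> (\<lambda>t. Re (1 / (1 - z * t)))"
      using integrable_resolvent[OF assms(1) regular_at_sphere[OF assms(2)]] by (rule integrable_Re)
    show "AE t in \<nu>. c \<le> Re (1 / (1 - z * t))"
    proof (rule prob_on_AE[OF assms(1)])
      fix t :: complex assume "t \<in> sphere 0 1"
      then have t: "norm (z * t) = norm z" by (simp add: norm_mult)
      define w where "w = z * t"
      have nz: "1 - w \<noteq> 0" using t assms(2) by (auto simp: w_def)
      have "norm (1 - w) \<le> 2" using norm_triangle_ineq4[of 1 w] t assms(2) by (simp add: w_def)
      then have n4: "(norm (1 - w))\<^sup>2 \<le> 4" using power_mono[of "norm (1 - w)" 2 2] by simp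
      have pos: "(norm (1 - w))\<^sup>2 > 0" using nz by simp
      have sq: "(norm (1 - w))\<^sup>2 = 1 - 2 * Re w + (norm w)\<^sup>2"
        unfolding cmod_power2 by (simp add: power2_eq_square algebra_simps)
      have "Re (1 / (1 - w)) = (1 - Re w) / (norm (1 - w))\<^sup>2"
        by (simp add: Re_divide cmod_power2)
      also have "1 - Re w = ((norm (1 - w))\<^sup>2 + (1 - (norm w)\<^sup>2)) / 2"
        using sq by simp
      also have "\<dots> / (norm (1 - w))\<^sup>2 = 1 / 2 + (1 - (norm w)\<^sup>2) / (2 * (norm (1 - w))\<^sup>2)"
        using pos by (simp add: add_divide_distrib)
      finally have "Re (1 / (1 - w)) = 1 / 2 + (1 - (norm w)\<^sup>2) / (2 * (norm (1 - w))\<^sup>2)" .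
      moreover have "(1 - (norm w)\<^sup>2) / 8 \<le> (1 - (norm w)\<^sup>2) / (2 * (norm (1 - w))\<^sup>2)"
        using pos n4 t assms(2) by (intro divide_left_mono) (auto simp: w_def power_le_one)
      ultimately show "c \<le> Re (1 / (1 - z * t))"
        using t by (simp add: c_def w_def)
    qed
  qed simp
  then have "c \<le> Re (phi \<nu> z)"
    using integrable_resolvent[OF assms(1) regular_at_sphere[OF assms(2)]]
    by (simp add: prob_space phi_def)
  moreover have "c > 1 / 2" using assms(2) by (simp add: c_def power_less_one_iff abs_square_less_1)
  ultimately show ?thesis by linarith
qed

lemma phi_sphere_nonzero: "prob_on (sphere 0 1) \<nu> \<Longrightarrow> norm z < 1 \<Longrightarrow> phi \<nu> z \<noteq> 0"
  using Re_phi_sphere[of \<nu> z] by auto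

text \<open>Here \<open>eta = (phi - 1) / phi\<close>, and \<open>Re phi > 1 / 2\<close> says that
  \<open>phi\<close> is closer to \<open>1\<close> than to \<open>0\<close>. Schwarz's lemma
  sharpens the bound \<open>1\<close> to \<open>norm z\<close>.\<close>

lemma disc_class_eta:
  assumes \<nu>: "prob_on (sphere 0 1) \<nu>"
  shows "disc_class (eta \<nu>)"
proof -
  have hol: "eta \<nu> holomorphic_on ball 0 1"
    using phi_sphere_nonzero[OF \<nu>] regular_at_sphere by (intro eta_holomorphic[OF \<nu>]) auto
  have lt: "norm (eta \<nu> z) < 1" if z: "norm z < 1" for z
  proof -
    have e: "eta \<nu> z = (phi \<nu> z - 1) / phi \<nu> z"
      using eta_eq_phi[OF \<nu> regular_at_sphere[OF z] phi_sphere_nonzero[OF \<nu> z]] phi_sphere_nonzero[OF \<nu> z]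
      by (simp add: field_simps)
    have "(norm (phi \<nu> z - 1))\<^sup>2 = (norm (phi \<nu> z))\<^sup>2 - 2 * Re (phi \<nu> z) + 1"
      unfolding cmod_power2 by (simp add: power2_eq_square algebra_simps)
    then have "(norm (phi \<nu> z - 1))\<^sup>2 < (norm (phi \<nu> z))\<^sup>2"
      using Re_phi_sphere[OF \<nu> z] by linarith
    then have "norm (phi \<nu> z - 1) < norm (phi \<nu> z)"
      by (rule power2_less_imp_less) simp
    then show ?thesis using phi_sphere_nonzero[OF \<nu> z] by (simp add: e norm_divide)
  qed
  show ?thesis
    using Schwarz_Lemma(1)[OF hol eta_0 lt] hol by (auto simp: disc_class_def)
qed

text \<open>The Cayley transform \<open>(1 + f) / (1 - f)\<close> has nonnegative real part, and its
  Herglotz measure satisfies \<open>phi = 1 / (1 - f)\<close>.\<close>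

lemma disc_class_realize:
  assumes f: "disc_class f"
  shows "\<exists>\<nu>. prob_on (sphere 0 1) \<nu> \<and> (\<forall>z\<in>ball 0 1. eta \<nu> z = f z)"
proof -
  have hol: "f holomorphic_on ball 0 1" and le: "\<And>z. norm z < 1 \<Longrightarrow> norm (f z) \<le> norm z"
    using f by (auto simp: disc_class_def)
  have nz: "1 - f z \<noteq> 0" if "norm z < 1" for z
    using le[OF that] that by auto
  define H where "H z = (1 + f z) / (1 - f z)" for z
  have "H holomorphic_on ball 0 1"
    unfolding H_def using nz by (intro holomorphic_intros hol) auto
  moreover have "H 0 = 1" using le[of 0] by (simp add: H_def)
  moreover have "Re (H z) \<ge> 0" if "norm z < 1" for z
  proof -
    have "(norm (f z))\<^sup>2 \<le> 1" using le[OF that] that by (intro power_le_one) auto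
    then have "(Re (f z))\<^sup>2 + (Im (f z))\<^sup>2 \<le> 1" by (simp add: cmod_power2)
    moreover have "Re (H z) = (1 - ((Re (f z))\<^sup>2 + (Im (f z))\<^sup>2)) / ((1 - Re (f z))\<^sup>2 + (Im (f z))\<^sup>2)"
      by (simp add: H_def Re_divide power2_eq_square algebra_simps)
    ultimately show ?thesis by simp
  qed
  ultimately obtain \<nu> where \<nu>: "prob_on (sphere 0 1) \<nu>" "\<And>z. norm z < 1 \<Longrightarrow> H z = 2 * phi \<nu> z - 1"
    using Herglotz_representation by blast
  have "eta \<nu> z = f z" if z: "norm z < 1" for z
  proof -
    have "phi \<nu> z = (H z + 1) / 2" using \<nu>(2)[OF z] by simp
    also have "\<dots> = 1 / (1 - f z)" using nz[OF z] by (simp add: H_def field_simps)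
    finally show ?thesis
      using eta_eq_phi[OF \<nu>(1) regular_at_sphere[OF z] phi_sphere_nonzero[OF \<nu>(1) z]] by simp
  qed
  then show ?thesis using \<nu>(1) by auto
qed

lemma disc_class_comp:
  assumes "disc_class f" "disc_class g"
  shows "disc_class (\<lambda>z. f (g z))"
proof -
  have g: "g z \<in> ball 0 1" if "z \<in> ball 0 1" for z
    using assms(2) that unfolding disc_class_def by (metis dist_0_norm mem_ball order_le_less_trans)
  have "(f \<circ> g) holomorphic_on ball 0 1"
    using assms g by (intro holomorphic_on_compose_gen[of _ _ _ "ball 0 1"]) (auto simp: disc_class_def)
  moreover have "norm (f (g z)) \<le> norm z" if "z \<in> ball 0 1" for z
    using assms g[OF that] that unfolding disc_class_def by (meson order_trans)
  ultimately show ?thesis by (simp add: disc_class_def comp_def)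
qed

section \<open>The half-line\<close>

lemma half_line_norm: "t \<in> \<real>\<^sub>\<ge>\<^sub>0 \<Longrightarrow> t = of_real (Re t)" "t \<in> \<real>\<^sub>\<ge>\<^sub>0 \<Longrightarrow> norm t = Re t"
  "t \<in> \<real>\<^sub>\<ge>\<^sub>0 \<Longrightarrow> Re t \<ge> 0"
  by (auto simp: complex_nonneg_Reals_iff complex_eq_iff cmod_def)

text \<open>For \<open>t \<noteq> 0\<close> the quotient \<open>t / (1 - z * t)\<close> is the
  reciprocal of \<open>1 / t - z\<close> with \<open>1 / t\<close> on the half-line, so the constant
  is the reciprocal distance of \<open>z\<close> from the half-line.\<close>

lemma regular_at_half_line:
  assumes "z \<notin> \<real>\<^sub>\<ge>\<^sub>0"
  shows "regular_at \<real>\<^sub>\<ge>\<^sub>0 z"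
  unfolding regular_at_def
proof (intro exI ballI)
  let ?d = "infdist z \<real>\<^sub>\<ge>\<^sub>0"
  fix t :: complex assume t: "t \<in> \<real>\<^sub>\<ge>\<^sub>0"
  have ne: "(\<real>\<^sub>\<ge>\<^sub>0 :: complex set) \<noteq> {}" by (metis empty_iff nonneg_Reals_zero_I)
  have pos: "?d > 0"
    using assms in_closed_iff_infdist_zero[OF closed_nonneg_Reals_complex ne, of z]
      infdist_nonneg[of z "\<real>\<^sub>\<ge>\<^sub>0"] by linarith
  show "norm t \<le> 1 / ?d * norm (1 - z * t)"
  proof (cases "t = 0")
    case False
    have "?d \<le> dist z (inverse t)" using t by (intro infdist_le) auto
    then have "?d * norm t \<le> norm (z - inverse t) * norm t"
      by (intro mult_right_mono) (auto simp: dist_norm)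
    also have "\<dots> = norm (z * t - 1)"
      using False by (simp add: norm_mult[symmetric] algebra_simps)
    also have "\<dots> = norm (1 - z * t)" by (rule norm_minus_commute)
    finally show ?thesis using pos by (simp add: field_simps)
  qed (simp add: infdist_nonneg)
qed

text \<open>If a point of the cone spanned by \<open>z\<close> and \<open>- 1\<close> were real and
  nonnegative with \<open>s > 0\<close>, then \<open>z\<close> would be real and at least
  \<open>t / s\<close>.\<close>

lemma cone_notin_half_line:
  fixes z :: complex
  assumes z: "z \<notin> \<real>\<^sub>\<ge>\<^sub>0" and st: "s \<ge> 0" "t \<ge> 0" "s + t > 0"
  shows "of_real s * z - of_real t \<notin> \<real>\<^sub>\<ge>\<^sub>0"
proof
  assume "of_real s * z - of_real t \<in> \<real>\<^sub>\<ge>\<^sub>0"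
  then have *: "s * Re z - t \<ge> 0" "s * Im z = 0" by (auto simp: complex_nonneg_Reals_iff)
  show False
  proof (cases "s = 0")
    case False
    then have "Im z = 0" "s > 0" using * st by auto
    moreover have "Re z \<ge> 0"
      using * st \<open>s > 0\<close> by (metis diff_ge_0_iff_ge order_trans zero_le_mult_iff not_less)
    ultimately show False using z by (simp add: complex_nonneg_Reals_iff)
  qed (use * st in auto)
qed

lemma prob_on_0_eq_delta0:
  assumes "prob_on {0} \<mu>"
  shows "\<mu> = delta0"
proof -
  interpret prob_space \<mu> using assms by (rule prob_on_prob_space)
  have \<delta>0: "prob_on {0} delta0" by (auto simp: prob_on_def prob_space_return AE_return)
  show ?thesis
  proof (rule prob_on_eqI[OF assms \<delta>0])
    fix f :: "complex \<Rightarrow> real" assume "continuous_on UNIV f"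
    then have fm: "f \<in> borel_measurable borel" by (rule borel_measurable_continuous_onI)
    have "integral\<^sup>L \<mu> f = (LINT t|\<mu>. f 0)"
      using fm by (intro prob_on_integral_cong[OF assms]) auto
    then show "integral\<^sup>L \<mu> f = integral\<^sup>L delta0 f"
      using fm by (simp add: prob_space integral_return)
  qed
qed

lemma half_line_moment_1_nonzero:
  assumes \<mu>: "prob_on (\<real>\<^sub>\<ge>\<^sub>0 \<inter> cball 0 R) \<mu>" "\<mu> \<noteq> delta0"
  shows "moment \<mu> 1 \<noteq> 0"
proof
  assume 0: "moment \<mu> 1 = 0"
  have int: "integrable \<mu> (\<lambda>t. t)"
    by (rule prob_on_integrable[OF \<mu>(1), of _ R]) auto
  have nn: "AE t in \<mu>. 0 \<le> Re t"
    using half_line_norm(3) by (intro prob_on_AE[OF \<mu>(1)]) auto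
  have "integral\<^sup>L \<mu> Re = 0"
    using 0 integral_Re[OF int] by (simp add: moment_def)
  then have "AE t in \<mu>. Re t = 0"
    using integral_nonneg_eq_0_iff_AE[OF integrable_Re[OF int] nn] by simp
  moreover have "AE t in \<mu>. t = of_real (Re t)"
    using half_line_norm(1) by (intro prob_on_AE[OF \<mu>(1)]) auto
  ultimately have "AE t in \<mu>. t \<in> {0}" by eventually_elim auto
  then have "prob_on {0} \<mu>" using \<mu>(1) by (simp add: prob_on_def)
  then show False using prob_on_0_eq_delta0 \<mu>(2) by blast
qed

text \<open>The kernel satisfies \<open>cnj K = (1 - z * t) * norm K ^ 2\<close>, so integrating
  gives cone coordinates of \<open>cnj phi\<close> as integrals of nonnegative functions. The
  inequality for \<open>P\<close> is Cauchy-Schwarz, in the form that a variance is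
  nonnegative.\<close>

lemma phi_half_line:
  assumes \<mu>: "prob_on \<real>\<^sub>\<ge>\<^sub>0 \<mu>" and z: "z \<notin> \<real>\<^sub>\<ge>\<^sub>0"
  obtains P Q where "cnj (phi \<mu> z) = of_real P - z * of_real Q" "(norm (phi \<mu> z))\<^sup>2 \<le> P" "P > 0" "Q \<ge> 0"
    "Q = 0 \<Longrightarrow> \<mu> = delta0"
proof -
  interpret prob_space \<mu> using \<mu> by (rule prob_on_prob_space)
  obtain C where C: "C > 0" "\<And>t. t \<in> \<real>\<^sub>\<ge>\<^sub>0 \<Longrightarrow> norm t \<le> C * norm (1 - z * t)"
    using regular_at_pos[OF regular_at_half_line[OF z]] by blast
  note nz = regular_at_nonzero[OF regular_at_half_line[OF z]]
  define K where "K t = 1 / (1 - z * t)" for t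
  have Km[measurable]: "K \<in> borel_measurable borel" unfolding K_def by measurable
  define B where "B = 1 + norm z * C"
  have KB: "norm (K t) \<le> B" "norm (t * K t) \<le> C" if "t \<in> \<real>\<^sub>\<ge>\<^sub>0" for t
    using resolvent_bounds[OF C(1) C(2)[OF that]] by (simp_all add: K_def B_def)
  have B0: "B \<ge> 0" "C \<ge> 0" using C(1) by (auto simp: B_def)
  have intK: "integrable \<mu> K" using KB by (intro prob_on_integrable[OF \<mu> Km])
  have intK2: "integrable \<mu> (\<lambda>t. (norm (K t))\<^sup>2)"
    using KB B0 by (intro prob_on_integrable[OF \<mu>, of _ "B\<^sup>2"]) (auto intro!: power_mono)
  have "norm (Re t * (norm (K t))\<^sup>2) \<le> C * B" if "t \<in> \<real>\<^sub>\<ge>\<^sub>0" for t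
  proof -
    have "norm (Re t * (norm (K t))\<^sup>2) = norm (t * K t) * norm (K t)"
      using half_line_norm(2,3)[OF that] by (simp add: norm_mult power2_eq_square abs_mult)
    also have "\<dots> \<le> C * B" using KB[OF that] B0 by (intro mult_mono) auto
    finally show ?thesis .
  qed
  then have intQ: "integrable \<mu> (\<lambda>t. Re t * (norm (K t))\<^sup>2)"
    by (intro prob_on_integrable[OF \<mu>]) auto
  define P where "P = (LINT t|\<mu>. (norm (K t))\<^sup>2)"
  define Q where "Q = (LINT t|\<mu>. Re t * (norm (K t))\<^sup>2)"
  have phiK: "phi \<mu> z = integral\<^sup>L \<mu> K" by (simp add: phi_def K_def[abs_def])
  have "cnj (phi \<mu> z) = (LINT t|\<mu>. cnj (K t))" using intK by (simp add: phiK)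
  also have "\<dots> = (LINT t|\<mu>. of_real ((norm (K t))\<^sup>2) - z * of_real (Re t * (norm (K t))\<^sup>2))"
  proof (rule prob_on_integral_cong[OF \<mu>])
    fix t :: complex assume t: "t \<in> \<real>\<^sub>\<ge>\<^sub>0"
    have "of_real ((norm (K t))\<^sup>2) - z * of_real (Re t * (norm (K t))\<^sup>2) = (1 - z * t) * (K t * cnj (K t))"
      using half_line_norm(1)[OF t] by (simp add: complex_norm_square[symmetric] algebra_simps)
    also have "\<dots> = cnj (K t)" using nz[OF t] by (simp add: K_def)
    finally show "cnj (K t) = of_real ((norm (K t))\<^sup>2) - z * of_real (Re t * (norm (K t))\<^sup>2)" by simp
  next
    show "(\<lambda>t. cnj (K t)) \<in> borel_measurable borel"
      by (rule measurable_compose[OF Km borel_measurable_continuous_onI]) (intro continuous_intros)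
  qed auto
  also have "\<dots> = of_real P - z * of_real Q"
    unfolding P_def Q_def using intK2 intQ
    by (subst Bochner_Integration.integral_diff) (auto simp: integrable_of_real simp del: of_real_mult of_real_power)
  finally have 1: "cnj (phi \<mu> z) = of_real P - z * of_real Q" .
  have "(norm (phi \<mu> z))\<^sup>2 \<le> (LINT t|\<mu>. norm (K t))\<^sup>2"
    unfolding phiK by (intro power_mono integral_norm_bound) auto
  also have "\<dots> \<le> P"
    using variance_eq[OF integrable_norm[OF intK]] intK2 variance_positive[of "\<lambda>t. norm (K t)"]
    by (simp add: P_def)
  finally have 2: "(norm (phi \<mu> z))\<^sup>2 \<le> P" .
  have "P \<noteq> 0"
  proof
    assume "P = 0"
    then have "AE t in \<mu>. (norm (K t))\<^sup>2 = 0"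
      unfolding P_def using integral_nonneg_eq_0_iff_AE[OF intK2] by simp
    moreover have "AE t in \<mu>. K t \<noteq> 0" using nz by (intro prob_on_AE[OF \<mu>]) (auto simp: K_def)
    ultimately have "AE t in \<mu>. False" by eventually_elim simp
    then show False by simp
  qed
  moreover have "P \<ge> 0" unfolding P_def by simp
  ultimately have 3: "P > 0" by simp
  have Qnn: "AE t in \<mu>. 0 \<le> Re t * (norm (K t))\<^sup>2"
    using half_line_norm(3) by (intro prob_on_AE[OF \<mu>]) auto
  have 4: "Q \<ge> 0" unfolding Q_def by (rule integral_nonneg_AE[OF Qnn])
  have 5: "\<mu> = delta0" if "Q = 0"
  proof -
    have "AE t in \<mu>. Re t * (norm (K t))\<^sup>2 = 0"
      using that integral_nonneg_eq_0_iff_AE[OF intQ Qnn] by (simp add: Q_def)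
    moreover have "AE t in \<mu>. K t \<noteq> 0 \<and> t = of_real (Re t)"
      using nz half_line_norm(1) by (intro prob_on_AE[OF \<mu>]) (auto simp: K_def)
    ultimately have "AE t in \<mu>. t \<in> {0}" by eventually_elim auto
    then have "prob_on {0} \<mu>" using \<mu> by (simp add: prob_on_def)
    then show ?thesis by (rule prob_on_0_eq_delta0)
  qed
  show thesis by (rule that[OF 1 2 3 4 5])
qed

lemma phi_half_line_nonzero:
  assumes "prob_on \<real>\<^sub>\<ge>\<^sub>0 \<mu>" "z \<notin> \<real>\<^sub>\<ge>\<^sub>0"
  shows "phi \<mu> z \<noteq> 0"
proof
  assume 0: "phi \<mu> z = 0"
  obtain P Q where PQ: "cnj (phi \<mu> z) = of_real P - z * of_real Q" "P > 0" "Q \<ge> 0"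
    using phi_half_line[OF assms] by metis
  then have "of_real Q * z - of_real P = (0 :: complex)" using 0 by (simp add: algebra_simps)
  moreover have "of_real Q * z - of_real P \<notin> (\<real>\<^sub>\<ge>\<^sub>0 :: complex set)"
    using PQ by (intro cone_notin_half_line assms(2)) auto
  ultimately show False by simp
qed

text \<open>The cone condition says that \<open>arg z \<le> arg (f z) \<le> \<pi>\<close> in the upper half-plane; written
  without arguments it is stable under the convolutions by pure algebra.\<close>

definition slit_class :: "(complex \<Rightarrow> complex) \<Rightarrow> bool" where
  "slit_class f \<longleftrightarrow> f holomorphic_on - \<real>\<^sub>\<ge>\<^sub>0 \<and>
     (\<forall>z\<in>- \<real>\<^sub>\<ge>\<^sub>0. \<exists>s t. s \<ge> 0 \<and> t \<ge> 0 \<and> s + t > 0 \<and> f z = of_real s * z - of_real t) \<and>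
     (f \<longlongrightarrow> 0) (at 0 within of_real ` {..<0})"

lemma slit_classE:
  assumes "slit_class f" "z \<notin> \<real>\<^sub>\<ge>\<^sub>0"
  obtains s t where "s \<ge> 0" "t \<ge> 0" "s + t > 0" "f z = of_real s * z - of_real t"
  using assms unfolding slit_class_def by (metis ComplI)

lemma slit_class_notin: "slit_class f \<Longrightarrow> z \<notin> \<real>\<^sub>\<ge>\<^sub>0 \<Longrightarrow> f z \<notin> \<real>\<^sub>\<ge>\<^sub>0"
  by (metis slit_classE cone_notin_half_line)

lemma slit_class_negative:
  assumes "slit_class f" "z \<in> of_real ` {..<0}"
  shows "f z \<in> of_real ` {..<0}"
proof -
  obtain x where x: "z = of_real x" "x < 0" using assms(2) by auto
  have "z \<notin> \<real>\<^sub>\<ge>\<^sub>0" using x by (simp add: complex_nonneg_Reals_iff)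
  then obtain s t where st: "s \<ge> 0" "t \<ge> 0" "s + t > 0" "f z = of_real s * z - of_real t"
    using slit_classE[OF assms(1)] by blast
  have "s * x - t < 0"
  proof (cases "s = 0")
    case False
    then have "s * x < 0" using st(1) x(2) by (simp add: mult_pos_neg)
    then show ?thesis using st(2) by simp
  qed (use st in auto)
  moreover have "f z = of_real (s * x - t)" using st(4) x(1) by simp
  ultimately show ?thesis by blast
qed

lemma half_line_neg_notin: "z \<in> of_real ` {..<0} \<Longrightarrow> z \<notin> (\<real>\<^sub>\<ge>\<^sub>0 :: complex set)"
  by (auto simp: complex_nonneg_Reals_iff)

text \<open>For \<open>z\<close> on the negative axis the kernel is bounded by \<open>1\<close> at
  every \<open>t \<ge> 0\<close>, so dominated convergence covers unbounded supports as
  well.\<close>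

lemma phi_half_line_tendsto:
  assumes \<mu>: "prob_on \<real>\<^sub>\<ge>\<^sub>0 \<mu>"
  shows "(phi \<mu> \<longlongrightarrow> 1) (at 0 within of_real ` {..<0})"
  unfolding tendsto_at_iff_sequentially comp_def
proof safe
  interpret prob_space \<mu> using \<mu> by (rule prob_on_prob_space)
  fix X :: "nat \<Rightarrow> complex" assume X: "\<forall>i. X i \<in> of_real ` {..<0} - {0}" "X \<longlonglongrightarrow> 0"
  have "(\<lambda>n. LINT t|\<mu>. 1 / (1 - X n * t)) \<longlonglongrightarrow> (LINT t|\<mu>. 1)"
  proof (rule integral_dominated_convergence[where w="\<lambda>_. 1"])
    show "(\<lambda>t. 1 / (1 - X n * t)) \<in> borel_measurable \<mu>" for n
      by (intro prob_on_borel_measurable[OF \<mu>]) auto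
    have "(\<lambda>n. 1 / (1 - X n * t)) \<longlonglongrightarrow> 1 / (1 - 0 * t)" for t
      by (intro tendsto_intros X) auto
    then show "AE t in \<mu>. (\<lambda>n. 1 / (1 - X n * t)) \<longlonglongrightarrow> 1" by simp
    show "AE t in \<mu>. norm (1 / (1 - X n * t)) \<le> 1" for n
    proof (rule prob_on_AE[OF \<mu>])
      fix t :: complex assume t: "t \<in> \<real>\<^sub>\<ge>\<^sub>0"
      obtain x where x: "X n = of_real x" "x < 0" using X(1) by blast
      have "1 - X n * t = of_real (1 - x * Re t)"
        using half_line_norm(1)[OF t] x(1) by simp
      moreover have "1 - x * Re t \<ge> 1"
        using half_line_norm(3)[OF t] x(2) by (simp add: mult_nonpos_nonneg)
      ultimately have "norm (1 - X n * t) \<ge> 1" by (simp only: norm_of_real)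
      then show "norm (1 / (1 - X n * t)) \<le> 1" by (auto simp: norm_divide divide_le_eq)
    qed
  qed auto
  then show "(\<lambda>n. phi \<mu> (X n)) \<longlonglongrightarrow> 1" by (simp add: phi_def prob_space)
qed

lemma eta_half_line: "prob_on \<real>\<^sub>\<ge>\<^sub>0 \<mu> \<Longrightarrow> z \<notin> \<real>\<^sub>\<ge>\<^sub>0 \<Longrightarrow> eta \<mu> z = 1 - 1 / phi \<mu> z"
  by (intro eta_eq_phi[of "\<real>\<^sub>\<ge>\<^sub>0"] regular_at_half_line phi_half_line_nonzero)

lemma slit_class_eta:
  assumes \<mu>: "prob_on \<real>\<^sub>\<ge>\<^sub>0 \<mu>" "\<mu> \<noteq> delta0"
  shows "slit_class (eta \<mu>)"
  unfolding slit_class_def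
proof (intro conjI ballI)
  show "eta \<mu> holomorphic_on - \<real>\<^sub>\<ge>\<^sub>0"
    using phi_half_line_nonzero[OF \<mu>(1)] regular_at_half_line by (intro eta_holomorphic[OF \<mu>(1)]) auto
  fix z :: complex assume "z \<in> - \<real>\<^sub>\<ge>\<^sub>0"
  then have z: "z \<notin> \<real>\<^sub>\<ge>\<^sub>0" by simp
  obtain P Q where PQ: "cnj (phi \<mu> z) = of_real P - z * of_real Q" "(norm (phi \<mu> z))\<^sup>2 \<le> P" "P > 0" "Q \<ge> 0"
    "Q = 0 \<Longrightarrow> \<mu> = delta0"
    using phi_half_line[OF \<mu>(1) z] by blast
  define n where "n = (norm (phi \<mu> z))\<^sup>2"
  have nz: "phi \<mu> z \<noteq> 0" by (rule phi_half_line_nonzero[OF \<mu>(1) z])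
  then have n: "n > 0" by (simp add: n_def)
  \<comment> \<open>The cone coordinates of \<open>eta = 1 - 1 / phi\<close> are thus
    \<open>Q / n\<close> and \<open>P / n - 1\<close>; the first is positive because
    \<open>\<mu>\<close> is not \<open>delta0\<close>.\<close>
  have "1 / phi \<mu> z = cnj (phi \<mu> z) / of_real n"
    unfolding n_def complex_norm_square using nz by simp
  then have "eta \<mu> z = of_real (Q / n) * z - of_real (P / n - 1)"
    using n by (simp add: eta_half_line[OF \<mu>(1) z] PQ(1) field_simps)
  moreover have "Q / n > 0" using PQ(4,5) \<mu>(2) n by (metis divide_pos_pos order_less_le)
  moreover have "P / n - 1 \<ge> 0" using PQ(2) n by (simp add: n_def)
  ultimately show "\<exists>s t. s \<ge> 0 \<and> t \<ge> 0 \<and> s + t > 0 \<and> eta \<mu> z = of_real s * z - of_real t"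
    by (intro exI[of _ "Q / n"] exI[of _ "P / n - 1"]) auto
next
  have "((\<lambda>z. 1 - 1 / phi \<mu> z) \<longlongrightarrow> 1 - 1 / 1) (at 0 within of_real ` {..<0})"
    by (intro tendsto_intros phi_half_line_tendsto \<mu>) auto
  then have "((\<lambda>z. 1 - 1 / phi \<mu> z) \<longlongrightarrow> 0) (at 0 within of_real ` {..<0})" by simp
  moreover have "eventually (\<lambda>z. 1 - 1 / phi \<mu> z = eta \<mu> z) (at 0 within of_real ` {..<0})"
    unfolding eventually_at_filter
    using eta_half_line[OF \<mu>(1)] half_line_neg_notin by (intro always_eventually) auto
  ultimately show "(eta \<mu> \<longlongrightarrow> 0) (at 0 within of_real ` {..<0})"
    by (rule Lim_transform_eventually)
qed

lemma slit_class_filterlim: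
  assumes "slit_class g"
  shows "filterlim g (at 0 within of_real ` {..<0}) (at 0 within of_real ` {..<0})"
proof -
  have "eventually (\<lambda>z. g z \<in> of_real ` {..<0} \<and> g z \<noteq> 0) (at 0 within of_real ` {..<0})"
    unfolding eventually_at_filter
    using slit_class_negative[OF assms] by (intro always_eventually) fastforce
  then show ?thesis
    using assms by (simp add: filterlim_at slit_class_def)
qed

lemma slit_class_comp:
  assumes f: "slit_class f" and g: "slit_class g"
  shows "slit_class (\<lambda>z. f (g z))"
  unfolding slit_class_def
proof (intro conjI ballI)
  have "(f \<circ> g) holomorphic_on - \<real>\<^sub>\<ge>\<^sub>0"
    using f g slit_class_notin[OF g] by (intro holomorphic_on_compose_gen[of _ _ _ "- \<real>\<^sub>\<ge>\<^sub>0"]) (auto simp: slit_class_def)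
  then show "(\<lambda>z. f (g z)) holomorphic_on - \<real>\<^sub>\<ge>\<^sub>0" by (simp add: comp_def)
  show "((\<lambda>z. f (g z)) \<longlongrightarrow> 0) (at 0 within of_real ` {..<0})"
    using f by (intro filterlim_compose[OF _ slit_class_filterlim[OF g]]) (simp add: slit_class_def)
  fix z :: complex assume "z \<in> - \<real>\<^sub>\<ge>\<^sub>0"
  then have z: "z \<notin> \<real>\<^sub>\<ge>\<^sub>0" by simp
  obtain s t where st: "s \<ge> 0" "t \<ge> 0" "s + t > 0" "g z = of_real s * z - of_real t"
    using slit_classE[OF g z] .
  obtain s' t' where st': "s' \<ge> 0" "t' \<ge> 0" "s' + t' > 0" "f (g z) = of_real s' * g z - of_real t'"
    using slit_classE[OF f slit_class_notin[OF g z]] .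
  have "s' * s + (s' * t + t') > 0"
  proof (cases "s' = 0")
    case False
    then have "s' * (s + t) > 0" using st st' by (intro mult_pos_pos) auto
    then show ?thesis using st'(2) by (simp add: algebra_simps)
  qed (use st' in auto)
  then show "\<exists>s t. s \<ge> 0 \<and> t \<ge> 0 \<and> s + t > 0 \<and> f (g z) = of_real s * z - of_real t"
  proof (intro exI conjI)
    show "f (g z) = of_real (s' * s) * z - of_real (s' * t + t')"
      by (subst st'(4), subst st(4)) (simp add: algebra_simps)
  qed (use st st' in auto)
qed

text \<open>With \<open>f w = s' * w - t'\<close> at \<open>w = g z\<close> the map is
  \<open>s' * z - t' * z / g z\<close>, and \<open>g z = s * z - t\<close> gives
  \<open>z / g z = (s * norm z ^ 2 - t * z) / norm (g z) ^ 2\<close>; all signs fit the cone. The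
  local bound on \<open>f w / w\<close> serves the limit at \<open>0\<close>.\<close>

lemma slit_class_orth:
  assumes f: "slit_class f" and g: "slit_class g"
    and bd: "eventually (\<lambda>w. norm (f w / w) \<le> B) (at 0 within of_real ` {..<0})"
  shows "slit_class (\<lambda>z. z * (f (g z) / g z))"
  unfolding slit_class_def
proof (intro conjI ballI)
  have nz: "g z \<noteq> 0" if "z \<notin> \<real>\<^sub>\<ge>\<^sub>0" for z
    using slit_class_notin[OF g that] by auto
  have "(\<lambda>z. f (g z)) holomorphic_on - \<real>\<^sub>\<ge>\<^sub>0" "g holomorphic_on - \<real>\<^sub>\<ge>\<^sub>0"
    using slit_class_comp[OF f g] g by (auto simp: slit_class_def)
  then show "(\<lambda>z. z * (f (g z) / g z)) holomorphic_on - \<real>\<^sub>\<ge>\<^sub>0"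
    using nz by (intro holomorphic_intros) auto
  have "eventually (\<lambda>z. norm (f (g z) / g z) \<le> B) (at 0 within of_real ` {..<0})"
    by (rule slit_class_filterlim[OF g, unfolded filterlim_iff, rule_format, OF bd])
  then have ev: "eventually (\<lambda>z. norm (z * (f (g z) / g z)) \<le> norm (z * of_real B)) (at 0 within of_real ` {..<0})"
  proof eventually_elim
    case (elim z)
    then have "norm z * norm (f (g z) / g z) \<le> norm z * \<bar>B\<bar>" by (intro mult_left_mono) auto
    then show ?case unfolding norm_mult norm_of_real .
  qed
  have "((\<lambda>z :: complex. z * of_real B) \<longlongrightarrow> 0 * of_real B) (at 0 within of_real ` {..<0})"
    by (intro tendsto_intros)
  then have "((\<lambda>z :: complex. z * of_real B) \<longlongrightarrow> 0) (at 0 within of_real ` {..<0})" by simp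
  then show "((\<lambda>z. z * (f (g z) / g z)) \<longlongrightarrow> 0) (at 0 within of_real ` {..<0})"
    by (rule Lim_null_comparison[OF ev tendsto_norm_zero])
  fix z :: complex assume "z \<in> - \<real>\<^sub>\<ge>\<^sub>0"
  then have z: "z \<notin> \<real>\<^sub>\<ge>\<^sub>0" by simp
  then have "z \<noteq> 0" by auto
  obtain s t where st: "s \<ge> 0" "t \<ge> 0" "s + t > 0" "g z = of_real s * z - of_real t"
    using slit_classE[OF g z] .
  obtain s' t' where st': "s' \<ge> 0" "t' \<ge> 0" "s' + t' > 0" "f (g z) = of_real s' * g z - of_real t'"
    using slit_classE[OF f slit_class_notin[OF g z]] .
  define n where "n = (norm (g z))\<^sup>2"
  have n: "n > 0" using nz[OF z] by (simp add: n_def)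
  have inv: "1 / g z = cnj (g z) / of_real n"
    unfolding n_def complex_norm_square using nz[OF z] by simp
  have "z * (f (g z) / g z) = of_real s' * z - of_real t' * z * (1 / g z)"
    using nz[OF z] by (simp add: st'(4) field_simps)
  also have "\<dots> = of_real s' * z - of_real t' * (of_real s * (z * cnj z) - of_real t * z) / of_real n"
    unfolding inv by (subst st(4)) (simp add: algebra_simps)
  also have "\<dots> = of_real (s' + t' * t / n) * z - of_real (t' * s * (norm z)\<^sup>2 / n)"
    using n by (simp add: complex_norm_square[symmetric] field_simps)
  finally have eq: "z * (f (g z) / g z) = of_real (s' + t' * t / n) * z - of_real (t' * s * (norm z)\<^sup>2 / n)" .
  have pos: "s' + t' * t / n + t' * s * (norm z)\<^sup>2 / n > 0"
  proof (cases "s' > 0")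
    case True
    then show ?thesis using st st' n by (intro add_pos_nonneg) auto
  next
    case False
    then have "t' > 0" using st' by auto
    then have "t' * t / n + t' * s * (norm z)\<^sup>2 / n > 0"
      using st n \<open>z \<noteq> 0\<close> by (cases "t = 0") (auto intro!: add_pos_nonneg)
    then show ?thesis using st'(1) by simp
  qed
  show "\<exists>s t. s \<ge> 0 \<and> t \<ge> 0 \<and> s + t > 0 \<and> z * (f (g z) / g z) = of_real s * z - of_real t"
    using eq pos st st' n by (intro exI[of _ "s' + t' * t / n"] exI[of _ "t' * s * (norm z)\<^sup>2 / n"]) auto
qed

section \<open>The identity theorem along the negative axis\<close>

lemma connected_slit: "connected (- \<real>\<^sub>\<ge>\<^sub>0 :: complex set)"
proof (rule starlike_imp_connected)
  show "starlike (- \<real>\<^sub>\<ge>\<^sub>0 :: complex set)"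
    unfolding starlike_def
  proof (intro bexI[of _ "- 1"] ballI subsetI)
    fix x y :: complex assume x: "x \<in> - \<real>\<^sub>\<ge>\<^sub>0" and "y \<in> closed_segment (- 1) x"
    then obtain u where u: "0 \<le> u" "u \<le> 1" "y = of_real u * x - of_real (1 - u)"
      by (auto simp: in_segment scaleR_conv_of_real algebra_simps)
    then show "y \<in> - \<real>\<^sub>\<ge>\<^sub>0" using cone_notin_half_line[of x u "1 - u"] x by simp
  qed simp
qed

lemma open_slit: "open (- \<real>\<^sub>\<ge>\<^sub>0 :: complex set)"
  by (simp add: open_Compl)

text \<open>The identity theorem needs an accumulation point inside the domain, and the natural
  candidate \<open>0\<close> is missing from the slit plane.\<close>

lemma islimpt_negative:
  assumes "e > 0"
  shows "complex_of_real (- e / 2) islimpt of_real ` {- e<..<0}"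
  unfolding islimpt_approachable
proof (intro allI impI)
  fix d :: real assume "d > 0"
  define m where "m = min d e / 4"
  have m: "m > 0" "m < d" "m \<le> e / 4" using \<open>d > 0\<close> assms by (auto simp: m_def)
  have "complex_of_real (- e / 2 + m) \<in> of_real ` {- e<..<0}"
    by (rule imageI) (use m assms in auto)
  moreover have "complex_of_real (- e / 2 + m) \<noteq> of_real (- e / 2)"
    unfolding of_real_eq_iff using m by simp
  moreover have "dist (complex_of_real (- e / 2 + m)) (of_real (- e / 2)) < d"
    unfolding dist_of_real using m by (simp add: dist_real_def)
  ultimately show "\<exists>x'\<in>of_real ` {- e<..<0}. x' \<noteq> complex_of_real (- e / 2) \<and> dist x' (of_real (- e / 2)) < d"
    by blast
qed

lemma holomorphic_eq_negative:
  assumes "f holomorphic_on D" "g holomorphic_on D" "open D" "connected D"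
    and e: "e > 0" "of_real ` {- e<..<0} \<subseteq> D"
    and eq: "\<And>x. - e < x \<Longrightarrow> x < 0 \<Longrightarrow> f (of_real x) = g (of_real x)" and z: "z \<in> D"
  shows "f z = g z"
proof -
  have "f z - g z = 0"
  proof (rule analytic_continuation[of "\<lambda>z. f z - g z" D "of_real ` {- e<..<0}" "of_real (- e / 2)"])
    show "of_real (- e / 2) \<in> D" using e by (intro subsetD[OF e(2)] imageI) auto
    show "complex_of_real (- e / 2) islimpt of_real ` {- e<..<0}" by (rule islimpt_negative[OF e(1)])
  qed (use assms in \<open>auto intro!: holomorphic_intros\<close>)
  then show ?thesis by simp
qed


section \<open>From the disc to the half-line: the Stieltjes representation\<close>

lemma neg_square_notin_half_line:
  assumes "Re \<zeta> > 0"
  shows "- (\<zeta>\<^sup>2) \<notin> \<real>\<^sub>\<ge>\<^sub>0"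
proof
  assume "- (\<zeta>\<^sup>2) \<in> \<real>\<^sub>\<ge>\<^sub>0"
  then have "(Im \<zeta>)\<^sup>2 \<ge> (Re \<zeta>)\<^sup>2" "Re \<zeta> * Im \<zeta> = 0"
    by (auto simp: complex_nonneg_Reals_iff power2_eq_square)
  then show False using assms by auto
qed

lemma Re_cayley_pos:
  assumes "norm (s :: complex) < 1"
  shows "Re ((1 - s) / (1 + s)) > 0" "1 + s \<noteq> 0"
proof -
  show nz: "1 + s \<noteq> 0"
    using assms by (metis add.commute add_eq_0_iff less_irrefl norm_minus_cancel norm_one)
  have "(norm s)\<^sup>2 < 1" using assms by (simp add: power_less_one_iff abs_square_less_1)
  then have lt: "(Re s)\<^sup>2 + (Im s)\<^sup>2 < 1" by (simp add: cmod_power2)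
  have "Re ((1 - s) / (1 + s)) = (1 - ((Re s)\<^sup>2 + (Im s)\<^sup>2)) / ((1 + Re s)\<^sup>2 + (Im s)\<^sup>2)"
    by (simp add: Re_divide power2_eq_square algebra_simps)
  moreover have "(1 + Re s)\<^sup>2 + (Im s)\<^sup>2 > 0"
    using nz by (metis complex_neq_0 plus_complex.simps one_complex.simps add.left_neutral)
  ultimately show "Re ((1 - s) / (1 + s)) > 0" using lt by simp
qed

text \<open>The substitution \<open>z = - ((1 - s) / (1 + s))\<^sup>2\<close> maps the disc onto the slit plane; the kernel
  of the symmetrised Herglotz formula becomes \<open>1 / (u - z (1 - u))\<close> with \<open>u = (1 - Re t) / 2\<close>.\<close>

lemma slit_class_stieltjes:
  assumes f: "slit_class f"
  obtains \<rho> c where "prob_on (sphere 0 1) \<rho>" "c > 0"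
    "\<And>y. y > 0 \<Longrightarrow> of_real c / (1 - f (- of_real y)) =
       of_real (LINT t|\<rho>. 1 / ((1 - Re t) / 2 + y * (1 - (1 - Re t) / 2)))"
proof -
  obtain s1 t1 where st1: "s1 \<ge> 0" "t1 \<ge> 0" "s1 + t1 > 0" "f (- 1) = of_real s1 * (- 1) - of_real t1"
    by (rule slit_classE[OF f nonneg_Reals_minus_one_I])
  \<comment> \<open>As \<open>\<zeta> 0 = 1\<close>, the number \<open>c = 1 - f (- 1)\<close>, real
    and greater than \<open>1\<close>, is the factor that normalises \<open>H 0\<close> to
    \<open>1\<close>.\<close>
  define c where "c = 1 + s1 + t1"
  have c: "c > 0" "1 - f (- 1) = of_real c" using st1 by (auto simp: c_def)
  define \<zeta> where "\<zeta> s = (1 - s) / (1 + s)" for s :: complex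
  have \<zeta>: "Re (\<zeta> s) > 0" "1 + s \<noteq> 0" if "norm s < 1" for s
    using Re_cayley_pos[OF that] by (auto simp: \<zeta>_def)
  have notin: "- ((\<zeta> s)\<^sup>2) \<notin> \<real>\<^sub>\<ge>\<^sub>0" if "norm s < 1" for s
    using neg_square_notin_half_line[OF \<zeta>(1)[OF that]] .
  have f1: "1 - f z \<noteq> 0" if "z \<notin> \<real>\<^sub>\<ge>\<^sub>0" for z
    using slit_class_notin[OF f that] by auto
  define H where "H s = of_real c * (\<zeta> s / (1 - f (- ((\<zeta> s)\<^sup>2))))" for s
  have \<zeta>_hol: "\<zeta> holomorphic_on ball 0 1"
    unfolding \<zeta>_def using \<zeta>(2) by (intro holomorphic_intros) auto
  have "(f \<circ> (\<lambda>s. - ((\<zeta> s)\<^sup>2))) holomorphic_on ball 0 1"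
    using f notin
    by (intro holomorphic_on_compose_gen[of _ _ _ "- \<real>\<^sub>\<ge>\<^sub>0"] holomorphic_intros \<zeta>_hol) (auto simp: slit_class_def)
  then have "(\<lambda>s. f (- ((\<zeta> s)\<^sup>2))) holomorphic_on ball 0 1" by (simp add: comp_def)
  then have "H holomorphic_on ball 0 1"
    unfolding H_def using f1 notin by (intro holomorphic_intros \<zeta>_hol) auto
  moreover have "H 0 = 1"
    using c by (simp add: H_def \<zeta>_def)
  moreover have "Re (H s) \<ge> 0" if s: "norm s < 1" for s
  proof -
    define w where "w = \<zeta> s"
    have w: "Re w > 0" "w \<noteq> 0" using \<zeta>(1)[OF s] by (auto simp: w_def)
    obtain a b where ab: "a \<ge> 0" "b \<ge> 0" "f (- (w\<^sup>2)) = of_real a * (- (w\<^sup>2)) - of_real b"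
      using slit_classE[OF f notin[OF s]] unfolding w_def by blast
    \<comment> \<open>The cone condition gives
      \<open>1 - f (- (w ^ 2)) = (1 + b) + a * w ^ 2\<close>, so \<open>H\<close> is
      \<open>c\<close> times the reciprocal of a sum of two terms with nonnegative real
      part.\<close>
    define y where "y = of_real (1 + b) / w + of_real a * w"
    have "(1 - f (- (w\<^sup>2))) = w * y"
      unfolding ab(3) y_def using w by (simp add: power2_eq_square field_simps)
    then have Hs: "H s = of_real c * (1 / y)"
      using w by (simp add: H_def w_def[symmetric])
    have "Re (of_real c * x) = c * Re x" for x by simp
    from this[of "1 / y"] have "Re (H s) = c * Re (1 / y)"
      by (simp only: Hs)
    moreover have "Re y \<ge> 0"
    proof -
      have "Re (1 / w) \<ge> 0" using w(1) by (simp add: Re_divide)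
      then have "(1 + b) * Re (1 / w) + a * Re w \<ge> 0" using ab w by simp
      moreover have "Re y = (1 + b) * Re (1 / w) + a * Re w"
        unfolding y_def by (simp add: Re_divide field_simps)
      ultimately show ?thesis by simp
    qed
    moreover have "Re (1 / y) \<ge> 0" using \<open>Re y \<ge> 0\<close> by (simp add: Re_divide)
    ultimately show ?thesis using c(1) by simp
  qed
  ultimately obtain \<rho> where \<rho>: "prob_on (sphere 0 1) \<rho>" "\<And>s. norm s < 1 \<Longrightarrow> H s = 2 * phi \<rho> s - 1"
    using Herglotz_representation by blast
  interpret prob_space \<rho> using \<rho>(1) by (rule prob_on_prob_space)
  show thesis
  proof (rule that[OF \<rho>(1) c(1)])
    fix y :: real assume y: "y > 0"
    define q where "q = sqrt y"
    have q: "q > 0" "q\<^sup>2 = y" using y by (auto simp: q_def)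
    \<comment> \<open>The real point of the disc with \<open>\<zeta> x = sqrt y\<close>, so that
      \<open>- (\<zeta> x) ^ 2\<close> is \<open>- y\<close>.\<close>
    define x where "x = (1 - q) / (1 + q)"
    have x: "\<bar>x\<bar> < 1" using q(1) by (auto simp: x_def abs_less_iff field_simps)
    then have nx: "norm (complex_of_real x) < 1" by simp
    have "(1 - x) / (1 + x) = q" using q(1) by (simp add: x_def field_simps)
    then have \<zeta>x: "\<zeta> (of_real x) = of_real q"
      unfolding \<zeta>_def by (metis of_real_1 of_real_add of_real_diff of_real_divide)
    have my: "- of_real y \<notin> (\<real>\<^sub>\<ge>\<^sub>0 :: complex set)" using y by (simp add: complex_nonneg_Reals_iff)
    obtain a b where ab: "a \<ge> 0" "b \<ge> 0" "a + b > 0" "f (- of_real y) = of_real a * (- of_real y) - of_real b"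
      by (rule slit_classE[OF f my])
    define h where "h = 1 + a * y + b"
    have h: "h > 0" "1 - f (- of_real y) = of_real h"
      unfolding ab(4) using ab(1,2) y by (auto simp: h_def intro!: add_pos_nonneg)
    have "H (of_real x) = of_real (q * (c / h))"
      unfolding H_def \<zeta>x of_real_power[symmetric] q(2) h(2) by simp
    \<comment> \<open>The value is real, so only the real part of the kernel counts, and on the
      circle this depends on \<open>t\<close> through \<open>Re t\<close> alone.\<close>
    then have "q * (c / h) = Re (2 * phi \<rho> (of_real x) - 1)"
      using \<rho>(2)[OF nx] by (metis Re_complex_of_real)
    also have "\<dots> = (LINT t|\<rho>. 2 * Re (1 / (1 - of_real x * t)) - 1)"
      using integrable_resolvent[OF \<rho>(1) regular_at_sphere[OF nx]] by (simp add: phi_def prob_space)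
    also have "\<dots> = (LINT t|\<rho>. q * (1 / ((1 - Re t) / 2 + y * (1 - (1 - Re t) / 2))))"
    proof (rule prob_on_integral_cong[OF \<rho>(1)])
      fix t :: complex assume "t \<in> sphere 0 1"
      then have t: "(Re t)\<^sup>2 + (Im t)\<^sup>2 = 1" "\<bar>Re t\<bar> \<le> 1"
        using abs_Re_le_cmod[of t] by (simp_all add: cmod_def)
      define d where "d = (1 - Re t) + y * (1 + Re t)"
      have d: "d > 0"
      proof (cases "Re t = 1")
        case False
        then show ?thesis using t(2) y unfolding d_def by (intro add_pos_nonneg) auto
      qed (use y in \<open>simp add: d_def\<close>)
      have "(1 - x * Re t)\<^sup>2 + (x * Im t)\<^sup>2 = 1 - 2 * x * Re t + x\<^sup>2 * ((Re t)\<^sup>2 + (Im t)\<^sup>2)"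
        by (simp add: power2_eq_square algebra_simps)
      also have "\<dots> = 1 - 2 * x * Re t + x\<^sup>2" using t by simp
      finally have n: "(1 - x * Re t)\<^sup>2 + (x * Im t)\<^sup>2 = 1 - 2 * x * Re t + x\<^sup>2" .
      \<comment> \<open>Clearing the factor \<open>1 + q\<close> turns denominator and numerator
        \<open>1 - x ^ 2\<close> of the Poisson kernel into polynomials in \<open>q\<close>, where
        \<open>q ^ 2 = y\<close>.\<close>
      have xq: "x * (1 + q) = 1 - q" using q(1) by (simp add: x_def)
      have "(1 - 2 * x * Re t + x\<^sup>2) * (1 + q)\<^sup>2
          = (1 + q)\<^sup>2 - 2 * (x * (1 + q)) * (1 + q) * Re t + (x * (1 + q))\<^sup>2"
        by (simp add: power2_eq_square algebra_simps)
      also have "\<dots> = 2 * d"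
        unfolding xq d_def q(2)[symmetric] by (simp add: power2_eq_square algebra_simps)
      finally have den: "(1 - 2 * x * Re t + x\<^sup>2) = 2 * d / (1 + q)\<^sup>2"
        using q(1) by (simp add: field_simps)
      have "(2 - 2 * x * Re t - (1 - 2 * x * Re t + x\<^sup>2)) * (1 + q)\<^sup>2 = (1 + q)\<^sup>2 - (x * (1 + q))\<^sup>2"
        by (simp add: power2_eq_square algebra_simps)
      also have "\<dots> = 4 * q" unfolding xq by (simp add: power2_eq_square algebra_simps)
      finally have num: "2 - 2 * x * Re t - (1 - 2 * x * Re t + x\<^sup>2) = 4 * q / (1 + q)\<^sup>2"
        using q(1) by (simp add: field_simps)
      have D: "1 - 2 * x * Re t + x\<^sup>2 > 0" unfolding den using d q(1) by simp
      have frac: "2 * (a / b) - 1 = (2 * a - b) / b" if "b > 0" for a b :: real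
        using that by (simp add: field_simps)
      have "Re (1 / (1 - of_real x * t)) = (1 - x * Re t) / (1 - 2 * x * Re t + x\<^sup>2)"
        unfolding n[symmetric] by (simp add: Re_divide)
      then have "2 * Re (1 / (1 - of_real x * t)) - 1
          = (2 * (1 - x * Re t) - (1 - 2 * x * Re t + x\<^sup>2)) / (1 - 2 * x * Re t + x\<^sup>2)"
        using frac[OF D] by (simp only:)
      also have "2 * (1 - x * Re t) = 2 - 2 * x * Re t" by simp
      also have "(2 - 2 * x * Re t - (1 - 2 * x * Re t + x\<^sup>2)) / (1 - 2 * x * Re t + x\<^sup>2) = 2 * q / d"
        unfolding num unfolding den using q(1) d by (simp add: field_simps)
      also have "\<dots> = q * (1 / ((1 - Re t) / 2 + y * (1 - (1 - Re t) / 2)))"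
        using d by (simp add: d_def field_simps)
      finally show "2 * Re (1 / (1 - of_real x * t)) - 1
          = q * (1 / ((1 - Re t) / 2 + y * (1 - (1 - Re t) / 2)))" .
    qed auto
    also have "\<dots> = q * (LINT t|\<rho>. 1 / ((1 - Re t) / 2 + y * (1 - (1 - Re t) / 2)))"
      by (rule integral_mult_right_zero)
    finally have "c / h = (LINT t|\<rho>. 1 / ((1 - Re t) / 2 + y * (1 - (1 - Re t) / 2)))"
      using q(1) mult_left_cancel[of q] by blast
    then show "of_real c / (1 - f (- of_real y)) =
       of_real (LINT t|\<rho>. 1 / ((1 - Re t) / 2 + y * (1 - (1 - Re t) / 2)))"
      unfolding h(2) by (metis of_real_divide)
  qed
qed

text \<open>The representing measure is the law of \<open>(1 - u) / u\<close> under
  \<open>\<rho>\<close> reweighted by \<open>1 / (c * u)\<close>. That the weight is finite almost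
  everywhere and has total mass \<open>1\<close> is extracted from the limit of \<open>f\<close> at
  \<open>0\<close>, which is why that limit belongs to the class.\<close>

lemma slit_class_realize:
  assumes f: "slit_class f"
  shows "\<exists>\<nu>. prob_on \<real>\<^sub>\<ge>\<^sub>0 \<nu> \<and> \<nu> \<noteq> delta0 \<and> (\<forall>z\<in>- \<real>\<^sub>\<ge>\<^sub>0. eta \<nu> z = f z)"
proof -
  obtain \<rho> c where \<rho>: "prob_on (sphere 0 1) \<rho>" and c: "c > 0"
    and rep: "\<And>y. y > 0 \<Longrightarrow> of_real c / (1 - f (- of_real y)) =
       of_real (LINT t|\<rho>. 1 / ((1 - Re t) / 2 + y * (1 - (1 - Re t) / 2)))"
    by (rule slit_class_stieltjes[OF f]) blast
  interpret prob_space \<rho> using \<rho> by (rule prob_on_prob_space)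
  define u where "u t = (1 - Re t) / 2" for t
  have um[measurable]: "u \<in> borel_measurable borel" unfolding u_def by measurable
  have um\<rho>[measurable]: "u \<in> borel_measurable \<rho>" by (rule prob_on_borel_measurable[OF \<rho> um])
  have u01: "0 \<le> u t" "u t \<le> 1" if "t \<in> sphere 0 1" for t
    using that abs_Re_le_cmod[of t] by (auto simp: u_def)
  define k where "k y t = 1 / (u t + y * (1 - u t))" for y t
  have km[measurable]: "k y \<in> borel_measurable borel" for y unfolding k_def by measurable
  have lower: "min 1 y \<le> u t + y * (1 - u t)" if "y > 0" "t \<in> sphere 0 1" for y t
  proof -
    have "min 1 y * u t + min 1 y * (1 - u t) \<le> 1 * u t + y * (1 - u t)"
      using u01[OF that(2)] that(1) by (intro add_mono mult_right_mono) auto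
    then show ?thesis by (simp add: algebra_simps)
  qed
  have kint: "integrable \<rho> (k y)" if "y > 0" for y
  proof (rule prob_on_integrable[OF \<rho> km])
    fix t :: complex assume t: "t \<in> sphere 0 1"
    have "min 1 y > 0" using that by simp
    then show "norm (k y t) \<le> 1 / min 1 y"
      unfolding k_def using lower[OF that t] by (simp add: frac_le abs_of_pos)
  qed
  define G where "G y = integral\<^sup>L \<rho> (k y)" for y
  have rep': "of_real (G y) = of_real c / (1 - f (- of_real y))" if "y > 0" for y
    using rep[OF that] by (simp add: G_def k_def[abs_def] u_def)
  have Y: "- complex_of_real y \<in> of_real ` {..<0}" if "y > 0" for y
    using that by (intro image_eqI[of _ _ "- y"]) auto
  have f_lim: "(\<lambda>n. f (- of_real (inverse (real (Suc n))))) \<longlonglongrightarrow> 0"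
  proof -
    have "(f \<longlongrightarrow> 0) (at 0 within of_real ` {..<0})" using f by (simp add: slit_class_def)
    moreover have "(\<lambda>n. - complex_of_real (inverse (real (Suc n)))) \<longlonglongrightarrow> - of_real 0"
      by (intro tendsto_minus tendsto_of_real LIMSEQ_inverse_real_of_nat)
    moreover have "- complex_of_real (inverse (real (Suc n))) \<in> of_real ` {..<0} - {0}" for n
      using Y[of "inverse (real (Suc n))"] by (simp del: of_nat_Suc)
    ultimately show ?thesis
      unfolding tendsto_at_iff_sequentially by (simp add: comp_def)
  qed
  have G_lim: "(\<lambda>n. G (inverse (real (Suc n)))) \<longlonglongrightarrow> c"
  proof -
    have "(\<lambda>n. of_real c / (1 - f (- of_real (inverse (real (Suc n)))))) \<longlonglongrightarrow> of_real c / (1 - 0)"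
      by (intro tendsto_intros f_lim) auto
    then have "(\<lambda>n. complex_of_real (G (inverse (real (Suc n))))) \<longlonglongrightarrow> of_real c"
      by (simp add: rep' del: of_nat_Suc)
    then show ?thesis by (simp only: tendsto_of_real_iff)
  qed
  have mono: "k y' t \<le> k y t" if "0 < y" "y \<le> y'" "t \<in> sphere 0 1" for y y' t
  proof -
    have "0 < u t + y * (1 - u t)" using lower[OF that(1,3)] that(1) by (smt (verit))
    moreover have "u t + y * (1 - u t) \<le> u t + y' * (1 - u t)"
      using u01[OF that(3)] that by (intro add_left_mono mult_right_mono) auto
    ultimately show ?thesis unfolding k_def by (intro divide_left_mono mult_pos_pos) auto
  qed
  \<comment> \<open>Where \<open>u = 0\<close> the kernel equals \<open>1 / y\<close>, so an atom
    there has mass at most \<open>y * G y\<close>, which tends to \<open>0 * c\<close>.\<close>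
  have no_atom: "AE t in \<rho>. u t > 0"
  proof -
    define A where "A = {t \<in> space \<rho>. u t = 0}"
    have A: "A \<in> sets \<rho>" unfolding A_def by measurable
    have "(\<lambda>n. inverse (real (Suc n)) * G (inverse (real (Suc n)))) \<longlonglongrightarrow> 0 * c"
      by (intro tendsto_mult LIMSEQ_inverse_real_of_nat G_lim)
    moreover have "measure \<rho> A \<le> inverse (real (Suc n)) * G (inverse (real (Suc n)))" for n
    proof -
      let ?y = "inverse (real (Suc n))"
      have y: "?y > 0" by simp
      have "measure \<rho> A = (LINT t|\<rho>. indicator A t)" using A by simp
      also have "\<dots> \<le> (LINT t|\<rho>. ?y * k ?y t)"
      proof (rule integral_mono_AE)
        show "integrable \<rho> (\<lambda>t. ?y * k ?y t)" by (intro integrable_mult_right kint y)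
        show "AE t in \<rho>. indicator A t \<le> ?y * k ?y t"
        proof (rule prob_on_AE[OF \<rho>])
          fix t :: complex assume t: "t \<in> sphere 0 1"
          have "0 < u t + ?y * (1 - u t)" using lower[OF y t] y by (smt (verit))
          then have "k ?y t \<ge> 0" by (simp add: k_def)
          moreover have "?y * k ?y t = 1" if "u t = 0" using y that by (simp add: k_def)
          ultimately show "indicator A t \<le> ?y * k ?y t"
            using y unfolding A_def indicator_def by (auto simp del: of_nat_Suc)
        qed
        show "integrable \<rho> (indicator A :: complex \<Rightarrow> real)"
          using A by (intro integrable_real_indicator) (auto simp: less_top[symmetric])
      qed
      also have "\<dots> = ?y * G ?y" by (simp add: G_def)
      finally show ?thesis .
    qed
    ultimately have "measure \<rho> A \<le> 0"
      by (intro LIMSEQ_le_const[of _ "0 :: real"]) auto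
    then have "A \<in> null_sets \<rho>"
      using A by (simp add: null_sets_def emeasure_eq_measure measure_le_0_iff)
    then have "AE t in \<rho>. t \<notin> A" by (rule AE_not_in)
    moreover have "AE t in \<rho>. u t \<ge> 0" using u01 by (intro prob_on_AE[OF \<rho>])
    moreover have "AE t in \<rho>. t \<in> space \<rho>" by simp
    ultimately show ?thesis by eventually_elim (auto simp: A_def)
  qed
  \<comment> \<open>Monotone convergence along \<open>y = 1 / (n + 1)\<close>: the kernels increase
    to \<open>1 / u\<close> while their integrals tend to \<open>c\<close>.\<close>
  have inv: "integrable \<rho> (\<lambda>t. 1 / u t) \<and> (LINT t|\<rho>. 1 / u t) = c"
  proof -
    have "AE t in \<rho>. mono (\<lambda>n. k (inverse (real (Suc n))) t)"
      by (rule prob_on_AE[OF \<rho>]) (auto intro!: monoI mono le_imp_inverse_le simp del: of_nat_Suc)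
    moreover have "AE t in \<rho>. (\<lambda>n. k (inverse (real (Suc n))) t) \<longlonglongrightarrow> 1 / u t"
      using no_atom
    proof eventually_elim
      case (elim t)
      have "(\<lambda>n. 1 / (u t + inverse (real (Suc n)) * (1 - u t))) \<longlonglongrightarrow> 1 / (u t + 0 * (1 - u t))"
        using elim by (intro tendsto_intros LIMSEQ_inverse_real_of_nat) auto
      then show ?case by (simp add: k_def del: of_nat_Suc)
    qed
    moreover have "(\<lambda>n. integral\<^sup>L \<rho> (k (inverse (real (Suc n))))) \<longlonglongrightarrow> c"
      using G_lim by (simp add: G_def del: of_nat_Suc)
    moreover have "integrable \<rho> (k (inverse (real (Suc n))))" for n
      by (rule kint) simp
    moreover have "(\<lambda>t. 1 / u t) \<in> borel_measurable \<rho>" by measurable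
    ultimately show ?thesis
      using integrable_monotone_convergence[of \<rho> "\<lambda>n. k (inverse (real (Suc n)))" "\<lambda>t. 1 / u t" c]
        integral_monotone_convergence[of \<rho> "\<lambda>n. k (inverse (real (Suc n)))" "\<lambda>t. 1 / u t" c]
      by blast
  qed
  define w where "w t = max 0 (1 / (c * u t))" for t
  have wm[measurable]: "w \<in> borel_measurable borel" unfolding w_def by measurable
  have wm\<rho>[measurable]: "w \<in> borel_measurable \<rho>" by (rule prob_on_borel_measurable[OF \<rho> wm])
  have w_AE: "AE t in \<rho>. w t = 1 / c * (1 / u t)"
    using no_atom by eventually_elim (use c in \<open>auto simp: w_def\<close>)
  have u_le: "AE t in \<rho>. u t \<le> 1" using u01 by (intro prob_on_AE[OF \<rho>])
  define P where "P = density \<rho> (\<lambda>t. ennreal (w t))"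
  have "integrable \<rho> (\<lambda>t. 1 / c * (1 / u t))"
    using inv by (intro integrable_mult_right) simp
  then have w_int: "integrable \<rho> w"
    using w_AE by (subst integrable_cong_AE[where g="\<lambda>t. 1 / c * (1 / u t)"]) auto
  have "(\<integral>\<^sup>+t. ennreal (w t) \<partial>\<rho>) = ennreal (integral\<^sup>L \<rho> w)"
    by (rule nn_integral_eq_integral[OF w_int]) (simp add: w_def)
  also have "integral\<^sup>L \<rho> w = (LINT t|\<rho>. 1 / c * (1 / u t))"
    using w_AE by (intro integral_cong_AE) auto
  also have "\<dots> = 1 / c * (LINT t|\<rho>. 1 / u t)" by (rule integral_mult_right_zero)
  also have "\<dots> = 1" using inv c by simp
  finally have "prob_space P"
    unfolding P_def by (intro prob_spaceI) (simp add: emeasure_density)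
  then interpret P: prob_space P .
  \<comment> \<open>Pulling \<open>1 / u\<close> out of \<open>1 / (u + y * (1 - u))\<close> leaves
    the kernel of \<open>phi\<close> at \<open>- y\<close> in the variable
    \<open>(1 - u) / u\<close>. The \<open>max 0\<close> keeps the value on the half-line also for
    \<open>t\<close> off the circle.\<close>
  define T where "T t = complex_of_real (max 0 ((1 - u t) / u t))" for t
  have Tm[measurable]: "T \<in> borel_measurable borel" unfolding T_def by measurable
  have TmP: "T \<in> borel_measurable P" unfolding P_def using prob_on_borel_measurable[OF \<rho> Tm] by simp
  define \<nu> where "\<nu> = distr P borel T"
  have \<nu>: "prob_on \<real>\<^sub>\<ge>\<^sub>0 \<nu>"
    unfolding \<nu>_def using TmP by (intro prob_on_distr P.prob_space_axioms) (auto simp: T_def)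
  have phi_\<nu>: "phi \<nu> (- of_real y) = 1 / (1 - f (- of_real y))" if y: "y > 0" for y
  proof -
    have "phi \<nu> (- of_real y) = (LINT t|P. 1 / (1 - - of_real y * T t))"
      unfolding phi_def \<nu>_def using TmP by (subst integral_distr) auto
    also have "\<dots> = (LINT t|\<rho>. w t *\<^sub>R (1 / (1 - - of_real y * T t)))"
      unfolding P_def using prob_on_borel_measurable[OF \<rho> Tm] by (subst integral_density) (auto simp: w_def)
    also have "\<dots> = (LINT t|\<rho>. complex_of_real (1 / c * k y t))"
    proof (rule integral_cong_AE)
      show "AE t in \<rho>. w t *\<^sub>R (1 / (1 - - of_real y * T t)) = complex_of_real (1 / c * k y t)"
        using no_atom w_AE u_le
      proof eventually_elim
        case (elim t)
        have "T t = of_real ((1 - u t) / u t)" using elim by (simp add: T_def)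
        then have "w t *\<^sub>R (1 / (1 - - of_real y * T t)) = of_real (1 / c * (1 / u t) * (1 / (1 + y * ((1 - u t) / u t))))"
          using elim(2) by (simp add: scaleR_conv_of_real)
        also have "1 / c * (1 / u t) * (1 / (1 + y * ((1 - u t) / u t))) = 1 / c * k y t"
        proof -
          have "u t * (1 + y * ((1 - u t) / u t)) = u t + y * (1 - u t)"
            using elim by (simp add: field_simps)
          then show ?thesis unfolding k_def by (metis (no_types, lifting) divide_divide_eq_left mult.assoc mult_1 times_divide_eq_right times_divide_eq_left)
        qed
        finally show ?case .
      qed
      show "(\<lambda>t. w t *\<^sub>R (1 / (1 - - of_real y * T t))) \<in> borel_measurable \<rho>"
        "(\<lambda>t. complex_of_real (1 / c * k y t)) \<in> borel_measurable \<rho>"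
        by (rule prob_on_borel_measurable[OF \<rho>], measurable)+
    qed
    also have "\<dots> = of_real (1 / c * G y)"
      unfolding integral_complex_of_real G_def by simp
    also have "\<dots> = 1 / (1 - f (- of_real y))"
      using rep'[OF y] c by simp
    finally show ?thesis .
  qed
  have neg: "eta \<nu> (of_real x) = f (of_real x)" if "x < 0" for x
  proof -
    have x: "of_real x \<notin> (\<real>\<^sub>\<ge>\<^sub>0 :: complex set)" using that by (simp add: complex_nonneg_Reals_iff)
    have "phi \<nu> (of_real x) = 1 / (1 - f (of_real x))" using phi_\<nu>[of "- x"] that by simp
    then show ?thesis by (simp add: eta_half_line[OF \<nu> x])
  qed
  have ne: "\<nu> \<noteq> delta0"
  proof
    assume "\<nu> = delta0"
    then have "eta \<nu> (of_real (- 1)) = 0"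
      by (simp add: eta_def psi_def integral_return)
    then have "f (of_real (- 1)) = 0" using neg[of "- 1"] by simp
    moreover have "f (of_real (- 1)) \<notin> \<real>\<^sub>\<ge>\<^sub>0" by (rule slit_class_notin[OF f]) simp
    ultimately show False by simp
  qed
  have "eta \<nu> z = f z" if "z \<in> - \<real>\<^sub>\<ge>\<^sub>0" for z
  proof (rule holomorphic_eq_negative[where f = "eta \<nu>" and g = f and e = 1, OF _ _ open_slit connected_slit])
    show "eta \<nu> holomorphic_on - \<real>\<^sub>\<ge>\<^sub>0" "f holomorphic_on - \<real>\<^sub>\<ge>\<^sub>0"
      using slit_class_eta[OF \<nu> ne] f by (simp_all add: slit_class_def)
    show "complex_of_real ` {- 1<..<0} \<subseteq> - \<real>\<^sub>\<ge>\<^sub>0"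
      by (auto simp: complex_nonneg_Reals_iff)
  qed (use neg that in auto)
  then show ?thesis using \<nu> ne by blast
qed


section \<open>Uniqueness of the measure with given moments or transform\<close>

lemma eqI_mixed_moments:
  assumes K: "compact K" and M: "prob_on K M" and N: "prob_on K N"
    and eq: "\<And>i j. (LINT t|M. t ^ i * cnj t ^ j) = (LINT t|N. t ^ i * cnj t ^ j)"
  shows "M = N"
proof (rule prob_on_eqI[OF M N])
  fix f :: "complex \<Rightarrow> real" assume f: "continuous_on UNIV f" "bounded (range f)"
  \<comment> \<open>The constant sequence \<open>M\<close> converges weakly to \<open>N\<close>, so
    both have the same integrals.\<close>
  have "weakly_converges (\<lambda>n. M) N"
    using eq by (intro weakly_converges_moments[OF K M N]) simp
  then have "(\<lambda>n. integral\<^sup>L M f) \<longlonglongrightarrow> integral\<^sup>L N f"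
    using f by (simp add: weakly_converges_def)
  then show "integral\<^sup>L M f = integral\<^sup>L N f" by (rule LIMSEQ_unique[OF tendsto_const])
qed

lemma half_line_mixed_moment:
  assumes "prob_on \<real>\<^sub>\<ge>\<^sub>0 M"
  shows "(LINT t|M. t ^ i * cnj t ^ j) = moment M (i + j)"
  unfolding moment_def
proof (rule prob_on_integral_cong[OF assms])
  show "t ^ i * cnj t ^ j = t ^ (i + j)" if "t \<in> \<real>\<^sub>\<ge>\<^sub>0" for t
    using that half_line_norm(1)[OF that] by (metis complex_cnj_complex_of_real power_add)
  show "(\<lambda>t. t ^ i * cnj t ^ j) \<in> borel_measurable borel"
    by (intro borel_measurable_continuous_onI continuous_intros)
qed auto

lemma phi_coeff_eqI:
  assumes "prob_on A \<mu>" "prob_on A \<nu>" "regular_at A z" "eventually (\<lambda>h. phi \<mu> (z + h) = phi \<nu> (z + h)) (nhds 0)"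
  shows "phi_coeff \<mu> z = phi_coeff \<nu> z"
proof -
  have "(\<lambda>h. phi \<mu> (z + h)) has_fps_expansion Abs_fps (phi_coeff \<nu> z)"
    using phi_has_fps_expansion[OF assms(2,3)] has_fps_expansion_cong[OF assms(4) refl] by simp
  then have "Abs_fps (phi_coeff \<mu> z) = Abs_fps (phi_coeff \<nu> z)"
    by (rule fps_expansion_unique_complex[OF phi_has_fps_expansion[OF assms(1,3)]])
  then show ?thesis by (simp add: fps_eq_iff fun_eq_iff)
qed

text \<open>The measures may lack moments, so the half-line is compactified by
  \<open>v = t / (1 + t)\<close>, with inverse \<open>w\<close>. The Taylor coefficients of
  \<open>phi\<close> at \<open>- 1\<close> are the integrals of \<open>v ^ n * (1 - v)\<close>, from
  which the moments of \<open>v\<close> follow by telescoping.\<close>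

lemma half_line_eta_determines:
  assumes \<mu>: "prob_on \<real>\<^sub>\<ge>\<^sub>0 \<mu>" and \<nu>: "prob_on \<real>\<^sub>\<ge>\<^sub>0 \<nu>" and eq: "\<And>z. z \<notin> \<real>\<^sub>\<ge>\<^sub>0 \<Longrightarrow> eta \<mu> z = eta \<nu> z"
  shows "\<mu> = \<nu>"
proof -
  define v where "v t = t / (1 + t)" for t :: complex
  define w where "w t = t / (1 - t)" for t :: complex
  define K where "K = \<real>\<^sub>\<ge>\<^sub>0 \<inter> cball (0 :: complex) 1"
  have K: "compact K" unfolding K_def by (simp add: closed_Int_compact)
  have vm: "v \<in> borel_measurable borel" and wm: "w \<in> borel_measurable borel"
    unfolding v_def w_def by measurable
  have nz: "1 + t \<noteq> 0" if "t \<in> \<real>\<^sub>\<ge>\<^sub>0" for t :: complex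
    using that by (auto simp: complex_nonneg_Reals_iff complex_eq_iff)
  have v_real: "v t = of_real (Re t / (1 + Re t))" if "t \<in> \<real>\<^sub>\<ge>\<^sub>0" for t
    using half_line_norm(1)[OF that] unfolding v_def by (metis of_real_1 of_real_add of_real_divide)
  have v_K: "v t \<in> K" if "t \<in> \<real>\<^sub>\<ge>\<^sub>0" for t
    unfolding v_real[OF that] using half_line_norm(3)[OF that]
    by (simp add: K_def del: of_real_divide of_real_add)
  have wv: "w (v t) = t" if "t \<in> \<real>\<^sub>\<ge>\<^sub>0" for t
    using nz[OF that] by (simp add: w_def v_def field_simps)
  have m1: "(- 1 :: complex) \<notin> \<real>\<^sub>\<ge>\<^sub>0" by (rule nonneg_Reals_minus_one_I)
  have "eventually (\<lambda>h :: complex. h \<in> (+) 1 ` (- \<real>\<^sub>\<ge>\<^sub>0)) (nhds 0)"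
    using open_translation[OF open_slit, of 1]
    by (intro eventually_nhds_in_open) (auto simp: image_iff intro!: bexI[of _ "- 1"])
  then have "eventually (\<lambda>h. phi \<mu> (- 1 + h) = phi \<nu> (- 1 + h)) (nhds 0)"
  proof eventually_elim
    case (elim h)
    then have z: "- 1 + h \<notin> \<real>\<^sub>\<ge>\<^sub>0" by auto
    have "1 / phi \<mu> (- 1 + h) = 1 / phi \<nu> (- 1 + h)"
      using eq[OF z] eta_half_line[OF \<mu> z] eta_half_line[OF \<nu> z] by simp
    then show ?case by (metis divide_divide_eq_right div_by_1 mult_1)
  qed
  then have coeff: "phi_coeff \<mu> (- 1) = phi_coeff \<nu> (- 1)"
    by (rule phi_coeff_eqI[OF \<mu> \<nu> regular_at_half_line[OF m1]])
  have step: "(LINT t|M. v t ^ n) = (LINT t|M. v t ^ Suc n) + phi_coeff M (- 1) n"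
    if M: "prob_on \<real>\<^sub>\<ge>\<^sub>0 M" for M n
  proof -
    have int: "integrable M (\<lambda>t. v t ^ k)" for k
    proof (rule prob_on_integrable[OF M])
      show "norm (v t ^ k) \<le> 1" if "t \<in> \<real>\<^sub>\<ge>\<^sub>0" for t
        using v_K[OF that] by (auto simp: K_def norm_power intro: power_le_one)
    qed (use vm in measurable)
    have "phi_coeff M (- 1) n = (LINT t|M. v t ^ n - v t ^ Suc n)"
      unfolding phi_coeff_def
    proof (rule prob_on_integral_cong[OF M])
      fix t :: complex assume t: "t \<in> \<real>\<^sub>\<ge>\<^sub>0"
      have "1 - v t = 1 / (1 + t)" using nz[OF t] by (simp add: v_def field_simps)
      then have "v t ^ n * (1 - v t) = t ^ n / (1 + t) ^ n * (1 / (1 + t))"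
        by (simp add: v_def power_divide)
      then show "t ^ n / (1 - - 1 * t) ^ Suc n = v t ^ n - v t ^ Suc n"
        by (simp add: algebra_simps)
    qed (use vm in measurable)
    also have "\<dots> = (LINT t|M. v t ^ n) - (LINT t|M. v t ^ Suc n)"
      by (intro Bochner_Integration.integral_diff int)
    finally show ?thesis by simp
  qed
  have mom: "(LINT t|\<mu>. v t ^ n) = (LINT t|\<nu>. v t ^ n)" for n
  proof (induction n)
    case 0
    show ?case
      using prob_space.prob_space[OF prob_on_prob_space[OF \<mu>]] prob_space.prob_space[OF prob_on_prob_space[OF \<nu>]] by simp
  next
    case (Suc n)
    then show ?case using step[OF \<mu>, of n] step[OF \<nu>, of n] coeff by simp
  qed
  have vM: "v \<in> borel_measurable M" if "prob_on \<real>\<^sub>\<ge>\<^sub>0 M" for M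
    by (rule prob_on_borel_measurable[OF that vm])
  have push: "prob_on K (distr M borel v)" "moment (distr M borel v) n = (LINT t|M. v t ^ n)"
    if M: "prob_on \<real>\<^sub>\<ge>\<^sub>0 M" for M n
  proof -
    show "prob_on K (distr M borel v)"
      using v_K K by (intro prob_on_distr prob_on_prob_space[OF M] vM M prob_on_AE[OF M]) (auto intro: compact_imp_closed)
    show "moment (distr M borel v) n = (LINT t|M. v t ^ n)"
      unfolding moment_def using vM[OF M] by (subst integral_distr) auto
  qed
  have sub: "K \<subseteq> \<real>\<^sub>\<ge>\<^sub>0" by (auto simp: K_def)
  have distr_eq: "distr \<mu> borel v = distr \<nu> borel v"
    by (rule eqI_mixed_moments[OF K push(1)[OF \<mu>] push(1)[OF \<nu>]])
       (simp add: half_line_mixed_moment prob_on_mono[OF push(1)[OF \<mu>] sub]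
          prob_on_mono[OF push(1)[OF \<nu>] sub] push(2)[OF \<mu>] push(2)[OF \<nu>] mom)
  show ?thesis
  proof (rule prob_on_eqI[OF \<mu> \<nu>])
    fix f :: "complex \<Rightarrow> real" assume "continuous_on UNIV f"
    then have fm: "f \<in> borel_measurable borel" by (rule borel_measurable_continuous_onI)
    have "integral\<^sup>L M f = integral\<^sup>L (distr M borel v) (\<lambda>t. f (w t))" if M: "prob_on \<real>\<^sub>\<ge>\<^sub>0 M" for M
    proof -
      have "integral\<^sup>L M f = (LINT t|M. f (w (v t)))"
        using wv fm measurable_compose[OF measurable_compose[OF vm wm] fm]
        by (intro prob_on_integral_cong[OF M]) auto
      then show ?thesis
        using vM[OF M] measurable_compose[OF wm fm] by (subst integral_distr) auto
    qed
    then show "integral\<^sup>L \<mu> f = integral\<^sup>L \<nu> f" using \<mu> \<nu> distr_eq by simp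
  qed
qed

text \<open>The Taylor coefficients of \<open>phi\<close> at \<open>- r / 4\<close> are integrals of positive functions; if
  \<open>phi\<close> continues to the disc of radius \<open>r\<close>, Cauchy's inequality makes them too small for mass
  beyond \<open>8 / r\<close>.\<close>

lemma half_line_support:
  assumes \<nu>: "prob_on \<real>\<^sub>\<ge>\<^sub>0 \<nu>" and r: "r > 0"
    and F: "F holomorphic_on ball 0 r" "\<And>z. norm z < r \<Longrightarrow> norm (F z) \<le> 1 / 2"
    and eq: "\<And>z. z \<notin> \<real>\<^sub>\<ge>\<^sub>0 \<Longrightarrow> norm z < r \<Longrightarrow> eta \<nu> z = F z"
  shows "prob_on (\<real>\<^sub>\<ge>\<^sub>0 \<inter> cball 0 (8 / r)) \<nu>"
proof -
  interpret prob_space \<nu> using \<nu> by (rule prob_on_prob_space)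
  \<comment> \<open>The centre lies off the half-line, and the disc of radius \<open>r / 2\<close>
    around it stays inside \<open>ball 0 r\<close> because \<open>r / 4 + r / 2 < r\<close>.\<close>
  define z0 where "z0 = - complex_of_real (r / 4)"
  have z0: "z0 \<notin> \<real>\<^sub>\<ge>\<^sub>0" "norm z0 = r / 4" using r by (auto simp: z0_def complex_nonneg_Reals_iff)
  define G where "G h = 1 / (1 - F (z0 + h))" for h
  have in_ball: "norm (z0 + h) < r" if "norm h \<le> r / 2" for h
    using norm_triangle_ineq[of z0 h] that z0 r by simp
  have den: "1 / 2 \<le> norm (1 - F z)" if "norm z < r" for z
    using norm_triangle_ineq2[of 1 "F z"] F(2)[OF that] by simp
  have G_bd: "norm (G h) \<le> 2" if "norm h \<le> r / 2" for h
    using den[OF in_ball[OF that]] by (auto simp: G_def norm_divide divide_le_eq)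
  have "(\<lambda>h. z0 + h) ` cball 0 (r / 2) \<subseteq> ball 0 r"
  proof (rule image_subsetI)
    show "z0 + h \<in> ball 0 r" if "h \<in> cball 0 (r / 2)" for h
      using in_ball[of h] that by simp
  qed
  then have "(F \<circ> (\<lambda>h. z0 + h)) holomorphic_on cball 0 (r / 2)"
    using F(1) by (intro holomorphic_on_compose_gen[of _ _ _ "ball 0 r"] holomorphic_intros) auto
  then have G_hol: "G holomorphic_on cball 0 (r / 2)"
    unfolding G_def using den[OF in_ball] by (intro holomorphic_intros) (force simp: comp_def)+
  have "eventually (\<lambda>h. h \<in> (\<lambda>x. x - z0) ` (- \<real>\<^sub>\<ge>\<^sub>0)) (nhds 0)"
    using open_translation_subtract[OF open_slit, of z0] z0
    by (intro eventually_nhds_in_open) (auto simp: image_iff intro!: bexI[of _ z0])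
  moreover have "eventually (\<lambda>h :: complex. h \<in> ball 0 (r / 2)) (nhds 0)"
    using r by (intro eventually_nhds_in_open) auto
  ultimately have "eventually (\<lambda>h. phi \<nu> (z0 + h) = G h) (nhds 0)"
  proof eventually_elim
    case (elim h)
    then have z: "z0 + h \<notin> \<real>\<^sub>\<ge>\<^sub>0" and h: "norm h \<le> r / 2" by auto
    have "F (z0 + h) = 1 - 1 / phi \<nu> (z0 + h)"
      using eq[OF z in_ball[OF h]] eta_half_line[OF \<nu> z] by simp
    then show ?case by (simp add: G_def)
  qed
  then have "G has_fps_expansion Abs_fps (phi_coeff \<nu> z0)"
    using phi_has_fps_expansion[OF \<nu> regular_at_half_line[OF z0(1)]]
      has_fps_expansion_cong[OF _ refl, of "\<lambda>h. phi \<nu> (z0 + h)" G] by simp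
  then have coeff: "phi_coeff \<nu> z0 n = (deriv ^^ n) G 0 / fact n" for n
    using fps_nth_fps_expansion by fastforce
  \<comment> \<open>Cauchy's inequality on the radius \<open>r / 2\<close>; the bound
    \<open>2\<close> for \<open>G = 1 / (1 - F)\<close> comes from
    \<open>norm F \<le> 1 / 2\<close>.\<close>
  have bound: "norm (phi_coeff \<nu> z0 n) \<le> 2 * (2 / r) ^ n" for n
  proof -
    have "norm ((deriv ^^ n) G 0) \<le> fact n * 2 / (r / 2) ^ n"
      using r G_bd G_hol
      by (intro Cauchy_inequality holomorphic_on_imp_continuous_on) (auto intro: holomorphic_on_subset)
    then show ?thesis
      by (simp add: coeff norm_divide field_simps power_divide)
  qed
  define A where "A = {t :: complex. 8 / r \<le> norm t}"
  have A: "A \<in> sets borel" unfolding A_def by measurable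
  define g where "g t = indicator A t / (1 + r / 4 * norm t)" for t :: complex
  have gm: "g \<in> borel_measurable borel" unfolding g_def using A by measurable
  have g_nonneg: "g t \<ge> 0" for t using r by (simp add: g_def)
  have pos: "0 < 1 + r / 4 * norm t" for t :: complex using r by (intro add_pos_nonneg) auto
  have g_int: "integrable \<nu> g"
    by (rule prob_on_integrable[OF \<nu> gm, of 1]) (use r in \<open>auto simp: g_def indicator_def divide_le_eq\<close>)
  have I: "integral\<^sup>L \<nu> g \<le> 2 * (3 / 4) ^ n" for n
  proof -
    let ?k = "\<lambda>t. norm t ^ n / (1 + r / 4 * norm t) ^ Suc n"
    have den_eq: "1 - z0 * t = of_real (1 + r / 4 * norm t)" if "t \<in> \<real>\<^sub>\<ge>\<^sub>0" for t
      using half_line_norm(1,2)[OF that] by (simp add: z0_def)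
    have km: "?k \<in> borel_measurable borel" by measurable
    have kint: "integrable \<nu> ?k"
    proof (rule prob_on_integrable[OF \<nu> km])
      fix t :: complex assume t: "t \<in> \<real>\<^sub>\<ge>\<^sub>0"
      have "norm t \<le> 4 / r * (1 + r / 4 * norm t)" using r by (simp add: field_simps)
      then have "norm t ^ n \<le> (4 / r) ^ n * (1 + r / 4 * norm t) ^ n"
        unfolding power_mult_distrib[symmetric] by (intro power_mono) auto
      also have "\<dots> \<le> (4 / r) ^ n * (1 + r / 4 * norm t) ^ Suc n"
        using r by (intro mult_left_mono power_increasing) auto
      finally show "norm (?k t) \<le> (4 / r) ^ n"
        using pos[of t] by (simp add: divide_le_eq abs_of_pos)
    qed
    have "phi_coeff \<nu> z0 n = (LINT t|\<nu>. of_real (?k t))"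
      unfolding phi_coeff_def
    proof (rule prob_on_integral_cong[OF \<nu>])
      show "t ^ n / (1 - z0 * t) ^ Suc n = of_real (?k t)" if "t \<in> \<real>\<^sub>\<ge>\<^sub>0" for t
        unfolding den_eq[OF that] using half_line_norm(1,2)[OF that]
        by (metis of_real_divide of_real_power)
    qed (use km in measurable)
    also have "\<dots> = of_real (integral\<^sup>L \<nu> ?k)" by (rule integral_complex_of_real)
    finally have "integral\<^sup>L \<nu> ?k \<le> 2 * (2 / r) ^ n"
      using bound[of n] by simp
    \<comment> \<open>On \<open>A\<close> the increasing function
      \<open>norm t / (1 + r / 4 * norm t)\<close> is at least \<open>8 / (3 * r)\<close>, its value
      at \<open>norm t = 8 / r\<close>. Against the growth \<open>(2 / r) ^ n\<close> of the
      coefficients this leaves the ratio \<open>3 / 4\<close>.\<close>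
    moreover have "(8 / (3 * r)) ^ n * integral\<^sup>L \<nu> g \<le> integral\<^sup>L \<nu> ?k"
    proof -
      have "(LINT t|\<nu>. (8 / (3 * r)) ^ n * g t) \<le> integral\<^sup>L \<nu> ?k"
      proof (rule integral_mono)
        fix t :: complex
        show "(8 / (3 * r)) ^ n * g t \<le> ?k t"
        proof (cases "t \<in> A")
          case True
          then have "8 \<le> r * norm t" using r by (simp add: A_def field_simps)
          then have "8 / (3 * r) \<le> norm t / (1 + r / 4 * norm t)"
            using r pos[of t] by (simp add: field_simps)
          then have "(8 / (3 * r)) ^ n \<le> (norm t / (1 + r / 4 * norm t)) ^ n"
            using r by (intro power_mono) auto
          then have "(8 / (3 * r)) ^ n * (1 / (1 + r / 4 * norm t)) \<le> (norm t / (1 + r / 4 * norm t)) ^ n * (1 / (1 + r / 4 * norm t))"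
            using pos[of t] by (intro mult_right_mono) auto
          then show ?thesis using True by (simp add: g_def power_divide mult.commute)
        qed (use r in \<open>simp add: g_def\<close>)
      qed (use g_int kint in auto)
      then show ?thesis by simp
    qed
    ultimately have "(8 / (3 * r)) ^ n * integral\<^sup>L \<nu> g \<le> 2 * (2 / r) ^ n" by linarith
    then have "integral\<^sup>L \<nu> g \<le> 2 * ((2 / r) ^ n / (8 / (3 * r)) ^ n)"
      using r by (simp add: field_simps)
    also have "(2 / r) ^ n / (8 / (3 * r)) ^ n = ((2 / r) / (8 / (3 * r))) ^ n"
      by (rule power_divide[symmetric])
    also have "(2 / r) / (8 / (3 * r)) = 3 / 4" using r by (simp add: field_simps)
    finally show ?thesis .
  qed
  have "(\<lambda>n. 2 * (3 / 4) ^ n :: real) \<longlonglongrightarrow> 2 * 0"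
    by (intro tendsto_intros) auto
  then have "integral\<^sup>L \<nu> g \<le> 2 * 0"
    by (rule LIMSEQ_le_const) (use I in auto)
  moreover have "integral\<^sup>L \<nu> g \<ge> 0" using g_nonneg by simp
  ultimately have "integral\<^sup>L \<nu> g = 0" by linarith
  then have "AE t in \<nu>. g t = 0"
    using integral_nonneg_eq_0_iff_AE[OF g_int] g_nonneg by simp
  then have "AE t in \<nu>. t \<in> cball 0 (8 / r)"
  proof eventually_elim
    case (elim t)
    then have "t \<notin> A" using pos[of t] by (auto simp: g_def)
    then show ?case by (simp add: A_def)
  qed
  then show ?thesis by (rule prob_on_IntI[OF \<nu>])
qed

section \<open>Free products in the free algebra\<close>

text \<open>A copy of the lists, made an additive monoid under concatenation so that finitely
  supported functions on it multiply as in the free algebra.\<close>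

datatype word = Word (letters: "bool list")

instantiation word :: monoid_add
begin
definition zero_word :: word where "0 = Word []"
definition plus_word :: "word \<Rightarrow> word \<Rightarrow> word" where "u + v = Word (letters u @ letters v)"
instance by standard (simp_all add: zero_word_def plus_word_def)
end

type_synonym free_alg = "word \<Rightarrow>\<^sub>0 complex"

definition word_functional :: "(bool list \<Rightarrow> complex) \<Rightarrow> free_alg \<Rightarrow> complex" where
  "word_functional \<phi> x =
     (\<Sum>w\<in>Poly_Mapping.keys x. Poly_Mapping.lookup x w * \<phi> (letters w))"

lemma word_functional_superset:
  assumes "finite A" "Poly_Mapping.keys x \<subseteq> A"
  shows "word_functional \<phi> x = (\<Sum>w\<in>A. Poly_Mapping.lookup x w * \<phi> (letters w))"
  unfolding word_functional_def using assms
  by (intro sum.mono_neutral_left) (auto simp: in_keys_iff)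

lemma word_functional_0 [simp]: "word_functional \<phi> 0 = 0"
  by (simp add: word_functional_def)

lemma word_functional_add: "word_functional \<phi> (x + y) = word_functional \<phi> x + word_functional \<phi> y"
proof -
  let ?A = "Poly_Mapping.keys x \<union> Poly_Mapping.keys y"
  show ?thesis
    using Poly_Mapping.keys_add[of x y]
    by (simp add: word_functional_superset[of ?A] lookup_add sum.distrib algebra_simps)
qed

lemma word_functional_sum: "word_functional \<phi> (\<Sum>i\<in>A. f i) = (\<Sum>i\<in>A. word_functional \<phi> (f i))"
  by (induction A rule: infinite_finite_induct) (auto simp: word_functional_add)

lemma word_functional_single: "word_functional \<phi> (Poly_Mapping.single w c) = c * \<phi> (letters w)"
  by (subst word_functional_superset[of "{w}"]) auto

abbreviation scal :: "complex \<Rightarrow> free_alg" where "scal c \<equiv> Poly_Mapping.single 0 c"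

lemma free_alg_sum_singles:
  "(x :: free_alg) = (\<Sum>w\<in>Poly_Mapping.keys x. Poly_Mapping.single w (Poly_Mapping.lookup x w))"
  by (rule poly_mapping_eqI) (auto simp: lookup_sum lookup_single when_def in_keys_iff)

lemma word_functional_scal: "word_functional \<phi> (scal c * x) = c * word_functional \<phi> x"
  by (subst (1 2) free_alg_sum_singles)
     (simp add: sum_distrib_left mult_single word_functional_sum word_functional_single mult.assoc)

lemma scal_commute: "scal c * x = x * scal c"
  by (subst (1 2) free_alg_sum_singles)
     (simp add: sum_distrib_left sum_distrib_right mult_single mult.commute)

lemma scal_add: "scal (c + d) = scal c + scal d"
  by (simp add: single_add)

lemma scal_mult: "scal (c * d) = scal c * scal d"
  by (simp add: mult_single)

lemma scal_sum: "scal (\<Sum>i\<in>A. f i) = (\<Sum>i\<in>A. scal (f i))"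
  by (induction A rule: infinite_finite_induct) (auto simp: scal_add)

section \<open>Polynomials in one indeterminate\<close>

definition gen :: "bool \<Rightarrow> free_alg" where "gen i = Poly_Mapping.single (Word [i]) 1"

lemma gen_power: "gen i ^ k = Poly_Mapping.single (Word (replicate k i)) 1"
  by (induction k) (auto simp: gen_def mult_single plus_word_def zero_word_def
      simp flip: single_one)

definition poly_gen :: "bool \<Rightarrow> complex poly \<Rightarrow> free_alg" where
  "poly_gen i p = (\<Sum>k\<le>degree p. scal (coeff p k) * gen i ^ k)"

lemma poly_gen_upto:
  assumes "degree p \<le> n"
  shows "poly_gen i p = (\<Sum>k\<le>n. scal (coeff p k) * gen i ^ k)"
  unfolding poly_gen_def using assms
  by (intro sum.mono_neutral_left) (auto simp: coeff_eq_0)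

lemma poly_gen_0 [simp]: "poly_gen i 0 = 0"
  by (simp add: poly_gen_def)

lemma poly_gen_add: "poly_gen i (p + q) = poly_gen i p + poly_gen i q"
  using degree_add_le_max[of p q]
  by (simp add: poly_gen_upto[of _ "max (degree p) (degree q)"] scal_add algebra_simps sum.distrib)

lemma poly_gen_monom: "poly_gen i (monom c k) = scal c * gen i ^ k"
  by (subst poly_gen_upto[of _ k])
     (auto simp: degree_monom_le if_distrib[of "Poly_Mapping.single 0"] if_distrib[of "\<lambda>x. x * _"]
        cong: if_cong)

text \<open>Carries the recursively defined moments into the ring, where freeness can be combined
  with algebraic identities. The word \<open>w\<close> is the prefix accumulated by the
  recursion.\<close>

lemma joint_moment_eq_word_functional:
  "word_functional \<phi> (Poly_Mapping.single (Word w) 1 * prod_list (map (\<lambda>(i, p). poly_gen i p) ss))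
     = joint_moment \<phi> w ss"
proof (induction ss arbitrary: w)
  case Nil
  then show ?case by (simp add: word_functional_single)
next
  case (Cons s ss)
  obtain i p where s: "s = (i, p)" by (cases s)
  let ?P = "prod_list (map (\<lambda>(i, p). poly_gen i p) ss)"
  have *: "Poly_Mapping.single (Word w) 1 * (scal c * gen i ^ k * ?P)
          = scal c * (Poly_Mapping.single (Word (w @ replicate k i)) 1 * ?P)" for c k
    by (simp add: gen_power mult.assoc[symmetric] mult_single plus_word_def zero_word_def)
  show ?case
    by (simp add: s poly_gen_def[of i] sum_distrib_left sum_distrib_right * word_functional_sum
        word_functional_scal Cons)
qed

lemma joint_moment_Nil_eq_word_functional:
  "word_functional \<phi> (prod_list (map (\<lambda>(i, p). poly_gen i p) ss)) = joint_moment \<phi> [] ss"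
  using joint_moment_eq_word_functional[of \<phi> "[]" ss] by (simp flip: zero_word_def)

definition centred :: "(bool list \<Rightarrow> complex) \<Rightarrow> bool \<Rightarrow> free_alg set" where
  "centred \<phi> i = {poly_gen i p |p. joint_moment \<phi> [] [(i, p)] = 0}"

lemma centredI: "x \<in> range (poly_gen i) \<Longrightarrow> word_functional \<phi> x = 0 \<Longrightarrow> x \<in> centred \<phi> i"
  using joint_moment_Nil_eq_word_functional[of \<phi> "[(i, _)]"]
  by (auto simp: centred_def simp del: joint_moment.simps)

text \<open>Recording the indeterminate of the leftmost factor allows a centred element in the other
  one to be multiplied on from the left without breaking the alternation.\<close>

inductive_set alt_span :: "(bool list \<Rightarrow> complex) \<Rightarrow> bool \<Rightarrow> free_alg set" for \<phi> i where
  alt_span_0: "0 \<in> alt_span \<phi> i"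
| alt_span_prod: "distinct_adj (map fst ss) \<Longrightarrow> fst (hd ss) = i \<Longrightarrow> ss \<noteq> [] \<Longrightarrow>
     (\<forall>s\<in>set ss. joint_moment \<phi> [] [s] = 0) \<Longrightarrow>
     prod_list (map (\<lambda>(i, p). poly_gen i p) ss) \<in> alt_span \<phi> i"
| alt_span_add: "x \<in> alt_span \<phi> i \<Longrightarrow> y \<in> alt_span \<phi> i \<Longrightarrow> x + y \<in> alt_span \<phi> i"

lemma word_functional_alt_span:
  assumes "free_pair \<phi>" "x \<in> alt_span \<phi> i"
  shows "word_functional \<phi> x = 0"
  using assms(2)
proof induction
  case (alt_span_prod ss)
  then show ?case
    using joint_moment_Nil_eq_word_functional[of \<phi> ss] assms(1)
    by (simp add: free_pair_def)
qed (auto simp: word_functional_add)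

lemma centred_subset_alt_span: "centred \<phi> i \<subseteq> alt_span \<phi> i"
proof
  fix x assume "x \<in> centred \<phi> i"
  then obtain p where p: "x = poly_gen i p" "joint_moment \<phi> [] [(i, p)] = 0"
    by (auto simp: centred_def)
  show "x \<in> alt_span \<phi> i"
    using alt_span_prod[of "[(i, p)]" i \<phi>] p by simp
qed

lemma alt_span_sum: "(\<And>j. j \<in> A \<Longrightarrow> f j \<in> alt_span \<phi> i) \<Longrightarrow> (\<Sum>j\<in>A. f j) \<in> alt_span \<phi> i"
  by (induction A rule: infinite_finite_induct) (auto intro: alt_span.intros)

lemma centred_mult_alt_span:
  assumes "c \<in> centred \<phi> i" "x \<in> alt_span \<phi> (\<not> i)"
  shows "c * x \<in> alt_span \<phi> i"
  using assms(2)
proof induction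
  case (alt_span_prod ss)
  obtain p where p: "c = poly_gen i p" "joint_moment \<phi> [] [(i, p)] = 0"
    using assms(1) by (auto simp: centred_def)
  have "prod_list (map (\<lambda>(i, p). poly_gen i p) ((i, p) # ss)) \<in> alt_span \<phi> i"
    using alt_span_prod p
    by (intro alt_span.alt_span_prod) (auto simp: distinct_adj_Cons hd_map)
  then show ?case by (simp add: p)
qed (auto simp: algebra_simps intro: alt_span.intros)

text \<open>The scalar is absorbed by the leftmost polynomial, which remains centred; so closure
  under sums already makes the set a linear span.\<close>

lemma alt_span_scal: "x \<in> alt_span \<phi> i \<Longrightarrow> scal c * x \<in> alt_span \<phi> i"
proof (induction rule: alt_span.induct)
  case (alt_span_prod ss)
  then obtain p ss' where ss: "ss = (i, p) # ss'"
    by (cases ss) auto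
  have *: "poly_gen i (smult c p) = scal c * poly_gen i p"
    by (subst poly_gen_upto[of "smult c p" "degree p"])
       (auto simp: poly_gen_def degree_smult_le scal_mult sum_distrib_left mult.assoc)
  have "joint_moment \<phi> [] [(i, smult c p)] = c * joint_moment \<phi> [] [(i, p)]"
    by (simp add: sum_distrib_left mult.assoc)
  then have "prod_list (map (\<lambda>(i, p). poly_gen i p) ((i, smult c p) # ss')) \<in> alt_span \<phi> i"
    using alt_span_prod ss by (intro alt_span.alt_span_prod) (auto simp del: joint_moment.simps)
  then show ?case by (simp add: ss * mult.assoc)
qed (auto simp: algebra_simps intro: alt_span.intros)


section \<open>Power series with coefficients in the free algebra\<close>

definition fps_functional :: "(bool list \<Rightarrow> complex) \<Rightarrow> free_alg fps \<Rightarrow> complex fps" where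
  "fps_functional \<phi> F = Abs_fps (\<lambda>n. word_functional \<phi> (F $ n))"

definition fps_scal :: "complex fps \<Rightarrow> free_alg fps" where
  "fps_scal f = Abs_fps (\<lambda>n. scal (f $ n))"

lemma fps_functional_nth [simp]: "fps_functional \<phi> F $ n = word_functional \<phi> (F $ n)"
  by (simp add: fps_functional_def)

lemma fps_scal_nth [simp]: "fps_scal f $ n = scal (f $ n)"
  by (simp add: fps_scal_def)

lemma word_functional_uminus: "word_functional \<phi> (- x) = - word_functional \<phi> x"
  using word_functional_add[of \<phi> x "- x"] by (simp add: add_eq_0_iff)

lemma word_functional_diff: "word_functional \<phi> (x - y) = word_functional \<phi> x - word_functional \<phi> y"
  using word_functional_add[of \<phi> x "- y"] by (simp add: word_functional_uminus)

lemma fps_functional_add: "fps_functional \<phi> (F + G) = fps_functional \<phi> F + fps_functional \<phi> G"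
  by (simp add: fps_eq_iff word_functional_add)

lemma fps_functional_diff: "fps_functional \<phi> (F - G) = fps_functional \<phi> F - fps_functional \<phi> G"
  by (simp add: fps_eq_iff word_functional_diff)

lemma fps_functional_scal: "fps_functional \<phi> (fps_scal f * F) = f * fps_functional \<phi> F"
  by (simp add: fps_eq_iff fps_mult_nth word_functional_sum word_functional_scal)

lemma word_functional_1: "word_functional \<phi> 1 = \<phi> []"
  using word_functional_single[of \<phi> 0 1] by simp (simp add: zero_word_def)

lemma fps_functional_1: "\<phi> [] = 1 \<Longrightarrow> fps_functional \<phi> 1 = 1"
  by (simp add: fps_eq_iff word_functional_1)

lemma fps_scal_mult: "fps_scal (f * g) = fps_scal f * fps_scal g"
  by (simp add: fps_eq_iff fps_mult_nth scal_sum scal_mult)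

lemma fps_scal_X [simp]: "fps_scal fps_X = fps_X"
  by (simp add: fps_eq_iff fps_X_def)

lemma fps_scal_1 [simp]: "fps_scal 1 = 1"
  by (simp add: fps_eq_iff)

lemma fps_scal_diff: "fps_scal (f - g) = fps_scal f - fps_scal g"
  by (simp add: fps_eq_iff single_diff)

lemma fps_scal_commute: "fps_scal f * F = F * fps_scal f"
proof (rule fps_ext)
  fix n
  have "(fps_scal f * F) $ n = (\<Sum>i=0..n. F $ (n - i) * scal (f $ i))"
    by (simp add: fps_mult_nth scal_commute)
  also have "\<dots> = (\<Sum>i=0..n. F $ i * scal (f $ (n - i)))"
    by (rule sum.reindex_bij_witness[of _ "\<lambda>i. n - i" "\<lambda>i. n - i"]) auto
  finally show "(fps_scal f * F) $ n = (F * fps_scal f) $ n"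
    by (simp add: fps_mult_nth)
qed

text \<open>The inverse of \<open>1 - w * gen i\<close> for \<open>w\<close> without constant term:
  then \<open>w ^ n\<close> starts at order \<open>n\<close>, so the powers \<open>n \<le> k\<close>
  suffice for the coefficient \<open>k\<close>.\<close>

definition geom :: "complex fps \<Rightarrow> bool \<Rightarrow> free_alg fps" where
  "geom w i = Abs_fps (\<lambda>k. \<Sum>n\<le>k. scal ((w ^ n) $ k) * gen i ^ n)"

lemma geom_nth_upto:
  assumes "w $ 0 = 0" "k \<le> m"
  shows "geom w i $ k = (\<Sum>n\<le>m. scal ((w ^ n) $ k) * gen i ^ n)"
  unfolding geom_def using assms startsby_zero_power_prefix[OF assms(1)]
  by (simp, intro sum.mono_neutral_left) auto

lemma geom_rec:
  assumes w: "w $ 0 = 0"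
  shows "geom w i = 1 + fps_scal w * (fps_const (gen i) * geom w i)"
proof (rule fps_ext)
  fix k
  have "(fps_scal w * (fps_const (gen i) * geom w i)) $ k =
      (\<Sum>j=0..k. scal (w $ j) * (gen i * (\<Sum>n\<le>k. scal ((w ^ n) $ (k - j)) * gen i ^ n)))"
    by (simp add: fps_mult_nth[of "fps_scal w"] geom_nth_upto[OF w, of _ k])
  also have "\<dots> = (\<Sum>j=0..k. \<Sum>n\<le>k. scal (w $ j * (w ^ n) $ (k - j)) * gen i ^ Suc n)"
    unfolding sum_distrib_left scal_mult
    by (intro sum.cong refl) (metis (no_types, lifting) mult.assoc power_Suc scal_commute)
  also have "\<dots> = (\<Sum>n\<le>k. scal ((w ^ Suc n) $ k) * gen i ^ Suc n)"
    by (subst sum.swap) (simp add: fps_mult_nth scal_sum sum_distrib_right)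
  finally have "(1 + fps_scal w * (fps_const (gen i) * geom w i)) $ k =
      scal ((w ^ 0) $ k) * gen i ^ 0 + (\<Sum>n\<le>k. scal ((w ^ Suc n) $ k) * gen i ^ Suc n)"
    by simp
  also have "\<dots> = (\<Sum>n\<le>Suc k. scal ((w ^ n) $ k) * gen i ^ n)"
    by (rule sum.atMost_Suc_shift[symmetric])
  also have "\<dots> = geom w i $ k"
    by (rule geom_nth_upto[OF w, symmetric]) simp
  finally show "geom w i $ k = (1 + fps_scal w * (fps_const (gen i) * geom w i)) $ k"
    by simp
qed

lemma geom_commute: "fps_const (gen i) * geom w i = geom w i * fps_const (gen i)"
proof (rule fps_ext)
  fix k
  have "gen i * (scal c * gen i ^ n) = scal c * gen i ^ n * gen i" for c n
    by (metis mult.assoc power_commutes scal_commute)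
  then show "(fps_const (gen i) * geom w i) $ k = (geom w i * fps_const (gen i)) $ k"
    by (simp add: geom_def sum_distrib_left sum_distrib_right)
qed

lemma fps_functional_geom:
  "fps_functional \<phi> (geom w i) = Abs_fps (\<lambda>n. \<phi> (replicate n i)) oo w"
  by (simp add: fps_eq_iff geom_def word_functional_sum word_functional_scal gen_power
      word_functional_single fps_compose_nth mult.commute atLeast0AtMost)

lemma range_poly_gen_sum: "(\<And>j. j \<in> A \<Longrightarrow> f j \<in> range (poly_gen i)) \<Longrightarrow> (\<Sum>j\<in>A. f j) \<in> range (poly_gen i)"
proof (induction A rule: infinite_finite_induct)
  case (insert x A)
  then obtain p q where "f x = poly_gen i p" "sum f A = poly_gen i q" by fastforce
  then show ?case using insert by (auto simp flip: poly_gen_add)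
qed (use poly_gen_0[of i] in \<open>auto simp del: poly_gen_0 intro: range_eqI[OF sym]\<close>)

lemma range_poly_gen_scal_power: "scal c * gen i ^ n \<in> range (poly_gen i)"
  using poly_gen_monom[of i c n] by (metis rangeI)

lemma range_poly_gen_scal_mult:
  assumes "x \<in> range (poly_gen i)"
  shows "scal c * x \<in> range (poly_gen i)" "scal c * (x * gen i) \<in> range (poly_gen i)"
proof -
  obtain p where x: "x = poly_gen i p" using assms by auto
  have "scal c * x = (\<Sum>k\<le>degree p. scal (c * coeff p k) * gen i ^ k)"
       "scal c * (x * gen i) = (\<Sum>k\<le>degree p. scal (c * coeff p k) * gen i ^ Suc k)"
    by (simp_all only: x poly_gen_def sum_distrib_left sum_distrib_right scal_mult mult.assoc
        power_Suc2)
  then show "scal c * x \<in> range (poly_gen i)" "scal c * (x * gen i) \<in> range (poly_gen i)"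
    by (auto intro!: range_poly_gen_sum range_poly_gen_scal_power simp del: power_Suc)
qed

lemma range_poly_gen_diff:
  assumes "x \<in> range (poly_gen i)" "y \<in> range (poly_gen i)"
  shows "x - y \<in> range (poly_gen i)"
proof -
  have "scal (- 1) * y = - y"
    using scal_add[of 1 "- 1"] by (simp add: single_uminus)
  then obtain q where "- y = poly_gen i q"
    using range_poly_gen_scal_mult(1)[OF assms(2), of "- 1"] by auto
  then show ?thesis
    using assms(1) by (metis (no_types, lifting) add_uminus_conv_diff image_iff poly_gen_add rangeI)
qed

lemma geom_nth_range: "geom w i $ k \<in> range (poly_gen i)"
  by (auto simp: geom_def intro!: range_poly_gen_sum range_poly_gen_scal_power)

text \<open>With \<open>U\<close> the resolvent, \<open>a\<close> the indeterminate and
  \<open>M\<close> the expectation of \<open>U\<close>, the geometric recursion gives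
  \<open>w\<close> times the expectation of \<open>U * a\<close> as \<open>M - 1\<close>, which the
  hypothesis turns into \<open>w * v * M\<close>. The factor \<open>w \<noteq> 0\<close>
  cancels.\<close>

lemma centred_geom:
  assumes \<phi>: "\<phi> [] = 1" and w: "w $ 0 = 0" "w \<noteq> 0"
    and M: "(Abs_fps (\<lambda>n. \<phi> (replicate n i)) oo w) * (1 - w * v) = 1"
  shows "(geom w i * fps_const (gen i) - fps_scal v * geom w i) $ n \<in> centred \<phi> i"
proof (rule centredI)
  let ?U = "geom w i" and ?M = "Abs_fps (\<lambda>n. \<phi> (replicate n i)) oo w"
  show "(?U * fps_const (gen i) - fps_scal v * ?U) $ n \<in> range (poly_gen i)"
    using range_poly_gen_scal_mult(2)[OF geom_nth_range[of w i n], of 1]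
    by (auto simp: fps_mult_nth[of "fps_scal v"]
        intro!: range_poly_gen_diff range_poly_gen_sum range_poly_gen_scal_mult(1) geom_nth_range)
  have "?M = fps_functional \<phi> (1 + fps_scal w * (?U * fps_const (gen i)))"
    using geom_rec[OF w(1), of i] by (simp add: geom_commute fps_functional_geom flip: fps_functional_geom)
  then have "w * fps_functional \<phi> (?U * fps_const (gen i)) = ?M - 1"
    by (simp add: fps_functional_add fps_functional_scal fps_functional_1 \<phi>)
  then have "w * fps_functional \<phi> (?U * fps_const (gen i) - fps_scal v * ?U) = ?M - 1 - w * v * ?M"
    by (simp add: fps_functional_diff fps_functional_scal fps_functional_geom algebra_simps)
  also have "\<dots> = 0" using M by (simp add: algebra_simps)
  finally have "fps_functional \<phi> (?U * fps_const (gen i) - fps_scal v * ?U) = 0"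
    using w(2) by simp
  then show "word_functional \<phi> ((?U * fps_const (gen i) - fps_scal v * ?U) $ n) = 0"
    by (metis fps_functional_nth fps_zero_nth)
qed

text \<open>For \<open>U = (1 - z u a)\<^sup>-\<^sup>1\<close> and \<open>V = (1 - z v b)\<^sup>-\<^sup>1\<close> the elements \<open>(1 - z u v) U - 1 = z u (a - v) U\<close>
  and \<open>(1 - z u v) V - 1 = z v (b - u) V\<close> are centred when \<open>u, v\<close> solve the subordination equations.
  The identity expresses \<open>1 - z a b\<close> by them without dividing by \<open>z u v\<close>.\<close>

lemma resolvent_identity:
  fixes z u v a b U V :: "'a :: ring_1"
  assumes central: "\<And>x. x * z = z * x" "\<And>x. x * u = u * x" "\<And>x. x * v = v * x"
    and U: "U * (1 - z * u * a) = 1" and V: "(1 - z * v * b) * V = 1"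
  shows "1 - z * (U * a - v * U) * (b * V - u * V) = (1 - z * u * v) * U * (1 - z * a * b) * V"
proof -
  have central': "x * (z * y) = z * (x * y)" "x * (u * y) = u * (x * y)" "x * (v * y) = v * (x * y)" for x y
    by (metis central mult.assoc)+
  note comms = central[of a] central[of b] central[of U] central'[of a] central'[of b] central'[of U]
    central(1)[of u] central(1,2)[of v] central'(1)[of u] central'(1,2)[of v]
  \<comment> \<open>The terms \<open>z * u * a\<close> and \<open>z * v * b\<close> cancel in this
    identity, which keeps \<open>a\<close> to the left of \<open>b\<close>; \<open>U\<close> from
    the left and \<open>V\<close> from the right then turn its factors into resolvents.\<close>
  have "(1 - z * u * a) * (1 - z * v * b) - z * ((a - v) * (b - u)) = (1 - z * u * v) * (1 - z * a * b)"
    by (simp add: algebra_simps comms)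
  then have "U * ((1 - z * u * a) * (1 - z * v * b) - z * ((a - v) * (b - u))) * V
      = U * ((1 - z * u * v) * (1 - z * a * b)) * V"
    by simp
  also have "U * ((1 - z * u * a) * (1 - z * v * b) - z * ((a - v) * (b - u))) * V
      = (U * (1 - z * u * a)) * ((1 - z * v * b) * V) - U * (z * ((a - v) * (b - u))) * V"
    by (simp only: algebra_simps)
  also have "\<dots> = 1 - U * (z * ((a - v) * (b - u))) * V"
    by (simp only: U V mult_1)
  also have "U * (z * ((a - v) * (b - u))) * V = z * (U * a - v * U) * (b * V - u * V)"
    by (simp add: algebra_simps comms)
  also have "U * ((1 - z * u * v) * (1 - z * a * b)) * V = (1 - z * u * v) * U * (1 - z * a * b) * V"
    by (simp add: algebra_simps comms)
  finally show ?thesis .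
qed


lemma geometric_identities:
  fixes z u v a U :: "'a :: ring_1"
  assumes central: "\<And>x. x * z = z * x" "\<And>x. x * u = u * x"
    and comm: "a * U = U * a" and rec: "U = 1 + z * u * (a * U)"
  shows "U * (1 - z * u * a) = 1" "(1 - z * u * a) * U = 1"
    "(1 - z * u * v) * U = 1 + z * (u * (a * U - v * U))"
proof -
  have r: "z * (u * (a * U)) = U - 1"
    using rec by (metis add_diff_cancel_left' mult.assoc)
  have "U * (z * u * a) = z * (u * (a * U))"
    by (metis central comm mult.assoc)
  then show "U * (1 - z * u * a) = 1" by (simp add: right_diff_distrib r)
  show "(1 - z * u * a) * U = 1" by (simp add: left_diff_distrib mult.assoc r)
  show "(1 - z * u * v) * U = 1 + z * (u * (a * U - v * U))"
    by (simp add: left_diff_distrib right_diff_distrib mult.assoc r)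
qed

lemma gen_prod_power:
  "(gen i * gen j) ^ n = Poly_Mapping.single (Word (concat (replicate n [i, j]))) 1"
  by (induction n) (auto simp: gen_def mult_single plus_word_def simp flip: single_one zero_word_def)

text \<open>The hypotheses say that both outer transforms take the value \<open>X * u * v\<close> at
  the inner ones, which centres \<open>A\<close> and \<open>B\<close>. The series
  \<open>Z = (1 - X * v * b) * G\<close> solves \<open>Z = 1 + X * (u * A + A * B * Z)\<close>, so
  \<open>Z - 1\<close> alternates, and \<open>(1 - X * u * v) * G = Z + X * v * B * Z\<close> has
  expectation \<open>1\<close>.\<close>

lemma free_product_moments:
  fixes u v :: "complex fps"
  assumes \<phi>: "free_pair \<phi>" and nz: "u \<noteq> 0" "v \<noteq> 0"
    and M1: "(Abs_fps (\<lambda>n. \<phi> (replicate n False)) oo (fps_X * u)) * (1 - fps_X * u * v) = 1"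
    and M2: "(Abs_fps (\<lambda>n. \<phi> (replicate n True)) oo (fps_X * v)) * (1 - fps_X * u * v) = 1"
  shows "Abs_fps (\<lambda>n. \<phi> (concat (replicate n [False, True]))) * (1 - fps_X * u * v) = 1"
proof -
  have \<phi>1: "\<phi> [] = 1" using \<phi> by (simp add: free_pair_def)
  define a b where "a = fps_const (gen False)" and "b = fps_const (gen True)"
  define U V where "U = geom (fps_X * u) False" and "V = geom (fps_X * v) True"
  define u' v' where "u' = fps_scal u" and "v' = fps_scal v"
  let ?z = "fps_X :: free_alg fps"
  define A B where "A = U * a - v' * U" and "B = b * V - u' * V"
  define G where "G = Abs_fps (\<lambda>n. (gen False * gen True) ^ n)"
  define Z where "Z = (1 - ?z * v' * b) * G"
  have central: "x * ?z = ?z * x" "x * u' = u' * x" "x * v' = v' * x" for x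
    by (simp_all add: u'_def v'_def fps_scal_commute fps_mult_fps_X_commute)
  have Urec: "U = 1 + ?z * u' * (a * U)" "a * U = U * a"
    and Vrec: "V = 1 + ?z * v' * (b * V)" "b * V = V * b"
    using geom_rec[of "fps_X * u" False] geom_rec[of "fps_X * v" True] geom_commute
    by (simp_all add: U_def V_def u'_def v'_def a_def b_def fps_scal_mult)
  note U_ids = geometric_identities[OF central(1,2) Urec(2,1)]
    and V_ids = geometric_identities[OF central(1,3) Vrec(2,1)]
  note UU = U_ids(1) and VV = V_ids(2) and VV' = V_ids(1)
  have "G = 1 + ?z * (a * b * G)"
    by (rule fps_ext) (auto simp: G_def a_def b_def mult.assoc power_eq_if split: if_splits)
  then have GG: "(1 - ?z * a * b) * G = 1" by (simp add: algebra_simps)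
  have id: "1 - ?z * A * B = (1 - ?z * u' * v') * U * (1 - ?z * a * b) * V"
    unfolding A_def B_def by (rule resolvent_identity[OF central UU VV])
  have "(1 - ?z * A * B) * Z = (1 - ?z * u' * v') * U * ((1 - ?z * a * b) * ((V * (1 - ?z * v' * b)) * G))"
    unfolding id Z_def by (simp only: mult.assoc)
  also have "\<dots> = (1 - ?z * u' * v') * U" by (simp only: VV' GG mult_1 mult_1_right)
  also have "\<dots> = 1 + ?z * (u' * A)"
    using U_ids(3)[of v'] by (simp add: A_def Urec(2))
  finally have Z: "Z = 1 + ?z * (u' * A + A * (B * Z))"
    by (simp add: algebra_simps)
  have "(1 - ?z * u' * v') * G = (1 - ?z * u' * v') * ((V * (1 - ?z * v' * b)) * G)"
    by (simp only: VV' mult_1)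
  also have "\<dots> = ((1 - ?z * u' * v') * V) * Z" unfolding Z_def by (simp only: mult.assoc)
  also have "(1 - ?z * u' * v') * V = 1 + ?z * (v' * B)"
    using V_ids(3)[of u'] by (simp add: B_def mult.assoc central(2)[of v'])
  also have "(1 + ?z * (v' * B)) * Z = Z + ?z * (v' * (B * Z))"
    by (simp add: algebra_simps)
  finally have G: "(1 - ?z * u' * v') * G = Z + ?z * (v' * (B * Z))" .
  have A: "A $ n \<in> centred \<phi> False" for n
    unfolding A_def U_def a_def v'_def
    using nz M1 by (intro centred_geom \<phi>1) auto
  have B: "B $ n \<in> centred \<phi> True" for n
    unfolding B_def Vrec(2) unfolding V_def b_def u'_def
    using nz M2 by (intro centred_geom \<phi>1) (auto simp: mult_ac)
  \<comment> \<open>Split off \<open>B * 1\<close>: it is centred itself, while \<open>B\<close>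
    times \<open>Z - 1\<close> alternates starting with \<open>b\<close>.\<close>
  have BZ_step: "(B * Z) $ m \<in> alt_span \<phi> True"
    if "\<And>j. j \<le> m \<Longrightarrow> Z $ j - 1 $ j \<in> alt_span \<phi> False" for m
    unfolding fps_mult_nth
  proof (rule alt_span_sum)
    fix i assume "i \<in> {0..m}"
    have 1: "B $ i * x \<in> alt_span \<phi> True" if "x \<in> alt_span \<phi> False" for x
      using centred_mult_alt_span[OF B, of x] that by simp
    have 2: "B $ i * 1 $ (m - i) \<in> alt_span \<phi> True"
      using B[of i] centred_subset_alt_span[of \<phi> True] by (auto intro: alt_span.intros)
    have "B $ i * Z $ (m - i) = B $ i * (Z $ (m - i) - 1 $ (m - i)) + B $ i * 1 $ (m - i)"
      by (simp add: algebra_simps)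
    then show "B $ i * Z $ (m - i) \<in> alt_span \<phi> True"
      using 1[OF that[of "m - i"]] 2 alt_span_add by (metis diff_le_self)
  qed
  \<comment> \<open>Because of the factor \<open>X\<close>, the coefficient \<open>n\<close> of
    \<open>Z\<close> involves only earlier coefficients.\<close>
  have Zspan: "Z $ n - 1 $ n \<in> alt_span \<phi> False" for n
  proof (induction n rule: less_induct)
    case (less n)
    show ?case
    proof (cases n)
      case 0
      then show ?thesis by (subst Z) (simp add: alt_span_0)
    next
      case (Suc m)
      have "(u' * A) $ m \<in> alt_span \<phi> False"
        unfolding fps_mult_nth u'_def fps_scal_nth using A centred_subset_alt_span
        by (intro alt_span_sum alt_span_scal) blast
      moreover have "(A * (B * Z)) $ m \<in> alt_span \<phi> False"
        unfolding fps_mult_nth[of A] using less Suc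
        by (intro alt_span_sum centred_mult_alt_span A) (auto intro!: BZ_step)
      moreover have "Z $ n - 1 $ n = (u' * A) $ m + (A * (B * Z)) $ m"
        by (subst Z) (simp add: Suc)
      ultimately show ?thesis by (simp add: alt_span_add)
    qed
  qed
  have "fps_functional \<phi> ((1 - ?z * u' * v') * G) = 1"
  proof (rule fps_ext)
    fix n
    have "word_functional \<phi> (Z $ n) = word_functional \<phi> (1 $ n)"
      using word_functional_alt_span[OF \<phi> Zspan[of n]] by (simp add: word_functional_diff)
    moreover have "word_functional \<phi> ((v' * (B * Z)) $ m) = 0" for m
      unfolding v'_def fps_mult_nth[of "fps_scal v"] fps_scal_nth using Zspan
      by (intro word_functional_alt_span[OF \<phi>, of _ True] alt_span_sum alt_span_scal BZ_step)
    ultimately show "fps_functional \<phi> ((1 - ?z * u' * v') * G) $ n = 1 $ n"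
      unfolding G by (auto simp: word_functional_add word_functional_1 \<phi>1)
  qed
  moreover have "1 - ?z * u' * v' = fps_scal (1 - fps_X * u * v)"
    by (simp add: u'_def v'_def fps_scal_mult fps_scal_diff)
  moreover have "fps_functional \<phi> G = Abs_fps (\<lambda>n. \<phi> (concat (replicate n [False, True])))"
    by (simp add: fps_eq_iff G_def gen_prod_power word_functional_single)
  ultimately show ?thesis
    by (simp add: fps_functional_scal mult.commute)
qed

section \<open>Free pairs with prescribed marginals\<close>

text \<open>The functional on \<open>w\<close> times a product of centred powers, multiplied out
  from the left: each factor is either kept, extending the prefix \<open>w\<close>, or replaced by
  its moment with a minus sign.\<close>

primrec centred_moment ::
  "(bool \<Rightarrow> nat \<Rightarrow> complex) \<Rightarrow> (bool list \<Rightarrow> complex) \<Rightarrow> bool list \<Rightarrow> (bool \<times> nat) list \<Rightarrow> complex" where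
  "centred_moment m \<phi> w [] = \<phi> w"
| "centred_moment m \<phi> w (r # rs) = centred_moment m \<phi> (w @ replicate (snd r) (fst r)) rs
      - m (fst r) (snd r) * centred_moment m \<phi> w rs"

abbreviation unruns :: "(bool \<times> nat) list \<Rightarrow> bool list" where
  "unruns rs \<equiv> concat (map (\<lambda>r. replicate (snd r) (fst r)) rs)"

fun runs :: "bool list \<Rightarrow> (bool \<times> nat) list" where
  "runs [] = []"
| "runs (x # xs) = (case runs xs of [] \<Rightarrow> [(x, 1)]
     | r # rs \<Rightarrow> if fst r = x then (x, Suc (snd r)) # rs else (x, 1) # r # rs)"

lemma unruns_runs: "unruns (runs w) = w"
  by (induction w) (auto split: list.splits)

lemma runs_replicate_append:
  assumes "runs w = [] \<or> fst (hd (runs w)) \<noteq> i"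
  shows "runs (replicate (Suc k) i @ w) = (i, Suc k) # runs w"
  using assms by (induction k) (auto split: list.splits)

lemma runs_unruns:
  assumes "distinct_adj (map fst rs)" "\<forall>r\<in>set rs. snd r > 0"
  shows "runs (unruns rs) = rs"
  using assms
proof (induction rs)
  case (Cons r rs)
  obtain i k where r: "r = (i, Suc k)" using Cons.prems(2) by (cases r) (auto simp: gr0_conv_Suc)
  have "runs (unruns rs) = rs" using Cons by (auto simp: distinct_adj_Cons)
  moreover have "rs = [] \<or> fst (hd rs) \<noteq> i"
    using Cons.prems(1) r by (auto simp: distinct_adj_Cons hd_map)
  ultimately show ?case using runs_replicate_append[of "unruns rs" i k] by (simp add: r)
qed auto

lemma runs_pos: "\<forall>r\<in>set (runs w). snd r > 0"
proof (induction w)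
  case (Cons x xs)
  then show ?case
    by (cases "runs xs") (simp_all split del: if_split, simp split: if_split)
qed simp

text \<open>After multiplying out, the full word occurs once with coefficient \<open>1\<close>, and
  all other terms are strictly shorter because every run is nonempty.\<close>

lemma centred_moment_cong:
  assumes "\<forall>r\<in>set rs. snd r > 0" "length (w @ unruns rs) = n"
    and "\<And>w. length w < n \<Longrightarrow> \<phi> w = \<psi> w"
  shows "centred_moment m \<phi> w rs - \<phi> (w @ unruns rs) = centred_moment m \<psi> w rs - \<psi> (w @ unruns rs)"
proof -
  have lt: "centred_moment m \<phi> w rs = centred_moment m \<psi> w rs" if "length (w @ unruns rs) < n" for w rs
    using that
  proof (induction rs arbitrary: w)
    case (Cons r rs)
    then show ?case by (simp del: length_concat)
  qed (use assms(3) in auto)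
  show ?thesis using assms(1,2)
  proof (induction rs arbitrary: w)
    case (Cons r rs)
    have "centred_moment m \<phi> w rs = centred_moment m \<psi> w rs"
      using Cons.prems by (intro lt) (auto simp del: length_concat)
    then show ?case using Cons.IH[of "w @ replicate (snd r) (fst r)"] Cons.prems
      by (simp del: length_concat)
  qed simp
qed


text \<open>Freeness prescribes the value at a word with runs \<open>x\<^sub>1, \<dots>, x\<^sub>n\<close> by the vanishing of the product of
  the \<open>x\<^sub>i - m (x\<^sub>i)\<close>, whose other terms are values at shorter words.\<close>

primrec free_approx :: "(bool \<Rightarrow> nat \<Rightarrow> complex) \<Rightarrow> nat \<Rightarrow> bool list \<Rightarrow> complex" where
  "free_approx m 0 = (\<lambda>w. if w = [] then 1 else 0)"
| "free_approx m (Suc n) = (\<lambda>w. if length w \<le> n then free_approx m n w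
     else free_approx m n w - centred_moment m (free_approx m n) [] (runs w))"

definition free_state :: "(bool \<Rightarrow> nat \<Rightarrow> complex) \<Rightarrow> bool list \<Rightarrow> complex" where
  "free_state m w = free_approx m (length w) w"

lemma free_approx_eq: "length w \<le> n \<Longrightarrow> free_approx m n w = free_state m w"
proof (induction n)
  case (Suc n)
  show ?case
  proof (cases "length w \<le> n")
    case False
    then have "length w = Suc n" using Suc.prems by simp
    then show ?thesis by (simp add: free_state_def)
  qed (simp add: Suc)
qed (simp add: free_state_def)

text \<open>Passing from stage \<open>n\<close> to the final functional changes the centred moment
  at a word of length \<open>Suc n\<close> by the change of its own value alone, and that value was
  corrected by exactly this centred moment.\<close>

lemma centred_moment_runs:
  assumes "w \<noteq> []"
  shows "centred_moment m (free_state m) [] (runs w) = 0"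
proof -
  obtain n where n: "length w = Suc n" using assms by (cases w) auto
  have "centred_moment m (free_state m) [] (runs w) - free_state m ([] @ unruns (runs w))
      = centred_moment m (free_approx m n) [] (runs w) - free_approx m n ([] @ unruns (runs w))"
    by (rule centred_moment_cong[of _ _ "Suc n"]) (simp_all add: runs_pos unruns_runs n free_approx_eq del: length_concat)
  moreover have "free_state m w = free_approx m n w - centred_moment m (free_approx m n) [] (runs w)"
    by (simp add: free_state_def n)
  ultimately show ?thesis by (simp add: unruns_runs)
qed

lemma free_state_Nil: "free_state m [] = 1"
  by (simp add: free_state_def)

lemma free_state_replicate:
  assumes "m i 0 = 1"
  shows "free_state m (replicate n i) = m i n"
proof (cases n)
  case (Suc k)
  have "runs (replicate n i) = [(i, n)]"
    using runs_replicate_append[of "[]" i k] Suc by simp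
  then show ?thesis
    using centred_moment_runs[of "replicate n i" m] Suc by (simp add: free_state_Nil)
qed (simp add: free_state_Nil assms)

text \<open>Centring fixes the constant coefficient of \<open>p\<close>, so \<open>p\<close> is a
  combination of the centred powers \<open>x ^ k - m i k\<close> with
  \<open>k \<ge> 1\<close>.\<close>

lemma centred_moment_joint_moment_Cons:
  assumes "m i 0 = 1" "(\<Sum>k\<le>degree p. coeff p k * m i k) = 0"
  shows "centred_moment m (\<lambda>w. joint_moment \<phi> w ((i, p) # ss)) w rs =
    (\<Sum>k=1..degree p. coeff p k * centred_moment m (\<lambda>w. joint_moment \<phi> w ss) w (rs @ [(i, k)]))"
proof (induction rs arbitrary: w)
  case Nil
  have eq: "{..degree p} = insert 0 {1..degree p}" by auto
  have "coeff p 0 = - (\<Sum>k=1..degree p. coeff p k * m i k)"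
    using assms by (simp add: eq add_eq_0_iff)
  then show ?case
    by (simp add: eq algebra_simps sum_subtractf sum_distrib_left)
next
  case (Cons r rs)
  then show ?case
    by (simp add: algebra_simps sum_subtractf sum_distrib_left del: joint_moment.simps)
qed

lemma free_pair_free_state:
  assumes m0: "\<And>i. m i 0 = 1"
  shows "free_pair (free_state m)"
proof -
  let ?\<phi> = "free_state m"
  \<comment> \<open>The polynomials move one at a time from \<open>ss\<close> into \<open>rs\<close>
    as centred powers. Neighbours differ and exponents are positive, so in the end \<open>rs\<close>
    is the list of runs of an actual word.\<close>
  have *: "centred_moment m (\<lambda>w. joint_moment ?\<phi> w ss) [] rs = 0"
    if "distinct_adj (map fst rs @ map fst ss)" "\<forall>r\<in>set rs. snd r > 0"
      "\<forall>s\<in>set ss. joint_moment ?\<phi> [] [s] = 0" "rs \<noteq> [] \<or> ss \<noteq> []" for rs ss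
    using that
  proof (induction ss arbitrary: rs)
    case Nil
    then have "unruns rs \<noteq> []" by (cases rs) auto
    then show ?case
      using centred_moment_runs[of "unruns rs" m] runs_unruns[of rs] Nil by simp
  next
    case (Cons s ss)
    obtain i p where s: "s = (i, p)" by (cases s)
    have "(\<Sum>k\<le>degree p. coeff p k * m i k) = 0"
      using Cons.prems(3) by (simp add: s free_state_replicate m0)
    moreover have "centred_moment m (\<lambda>w. joint_moment ?\<phi> w ss) [] (rs @ [(i, k)]) = 0"
      if "k \<in> {1..degree p}" for k
      using Cons.prems that by (intro Cons.IH) (auto simp: s)
    ultimately show ?case
      unfolding s by (subst centred_moment_joint_moment_Cons) (simp_all add: m0 del: joint_moment.simps)
  qed
  show ?thesis
    unfolding free_pair_def using *[of "[]"] by (auto simp: free_state_Nil)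
qed

section \<open>Stabilisation of coefficients\<close>

definition fps_agree :: "nat \<Rightarrow> 'a fps \<Rightarrow> 'a fps \<Rightarrow> bool" where
  "fps_agree k f g \<longleftrightarrow> (\<forall>j\<le>k. f $ j = g $ j)"

lemma fps_agree_mult:
  fixes f g :: "'a :: comm_ring_1 fps"
  shows "fps_agree k f f' \<Longrightarrow> fps_agree k g g' \<Longrightarrow> fps_agree k (f * g) (f' * g')"
  unfolding fps_agree_def fps_mult_nth by (auto intro!: sum.cong)

lemma fps_agree_power:
  fixes f g :: "'a :: comm_ring_1 fps"
  shows "fps_agree k f g \<Longrightarrow> fps_agree k (f ^ n) (g ^ n)"
  by (induction n) (auto intro: fps_agree_mult simp: fps_agree_def[of _ 1])

lemma fps_agree_compose:
  fixes f g :: "'a :: comm_ring_1 fps"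
  assumes "fps_agree k f g"
  shows "fps_agree k (q oo f) (q oo g)"
  using fps_agree_power[OF assms] unfolding fps_agree_def fps_compose_nth by (auto intro!: sum.cong)

text \<open>This gain of one coefficient per step is what freezes the iterates.\<close>

lemma fps_agree_X_mult:
  fixes f g :: "'a :: comm_ring_1 fps"
  shows "fps_agree k f g \<Longrightarrow> fps_agree (Suc k) (fps_X * f) (fps_X * g)"
  unfolding fps_agree_def by (auto simp: Suc_le_eq less_Suc_eq_le)

lemma fps_agree_inverse:
  fixes f g :: "'a :: field fps"
  assumes "fps_agree k f g" "f $ 0 \<noteq> 0"
  shows "fps_agree k (inverse f) (inverse g)"
proof -
  have g0: "g $ 0 \<noteq> 0" using assms by (auto simp: fps_agree_def)
  have d: "inverse f - inverse g = (g - f) * (inverse f * inverse g)"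
    using inverse_mult_eq_1[OF assms(2)] inverse_mult_eq_1[OF g0]
    by (simp add: algebra_simps)
  show ?thesis
    unfolding fps_agree_def
  proof (intro allI impI)
    fix j assume "j \<le> k"
    then have "(inverse f - inverse g) $ j = 0"
      unfolding d fps_mult_nth[of "g - f"] using assms(1) by (intro sum.neutral) (auto simp: fps_agree_def)
    then show "inverse f $ j = inverse g $ j" by simp
  qed
qed

definition eta_fps :: "complex measure \<Rightarrow> complex fps" where
  "eta_fps \<mu> = 1 - inverse (Abs_fps (moment \<mu>))"

lemma moment_0: "prob_on A \<mu> \<Longrightarrow> moment \<mu> 0 = 1"
  using prob_space.prob_space[OF prob_on_prob_space] by (simp add: moment_def)

lemma eta_fps_nth:
  assumes "prob_on A \<mu>"
  shows "eta_fps \<mu> $ 0 = 0" "eta_fps \<mu> $ 1 = moment \<mu> 1"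
    "Abs_fps (moment \<mu>) * (1 - eta_fps \<mu>) = 1" "Abs_fps (moment \<mu>) = inverse (1 - eta_fps \<mu>)"
proof -
  have M0: "Abs_fps (moment \<mu>) $ 0 \<noteq> 0" using moment_0[OF assms] by simp
  show "eta_fps \<mu> $ 0 = 0" "eta_fps \<mu> $ 1 = moment \<mu> 1"
    using moment_0[OF assms] by (simp_all add: eta_fps_def fps_inverse_def)
  show "Abs_fps (moment \<mu>) * (1 - eta_fps \<mu>) = 1"
    using inverse_mult_eq_1'[OF M0] by (simp add: eta_fps_def)
  show "Abs_fps (moment \<mu>) = inverse (1 - eta_fps \<mu>)"
    using fps_inverse_idempotent[OF M0] by (simp add: eta_fps_def)
qed

text \<open>An expansion makes the function holomorphic on a full disc about \<open>0\<close>, where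
  a short piece of the negative axis determines it. This moves identities known only off the slit to
  coefficients at \<open>0\<close>.\<close>

lemma fps_eq_negative:
  fixes F G :: "complex fps"
  assumes f: "f has_fps_expansion F" and g: "g has_fps_expansion G"
    and eq: "\<And>x. - 1 < x \<Longrightarrow> x < 0 \<Longrightarrow> f (of_real x) = g (of_real x)"
  shows "F = G"
proof -
  obtain A where A: "open A" "0 \<in> A" "f holomorphic_on A"
    using has_fps_expansion_imp_holomorphic[OF f] by metis
  obtain B where B: "open B" "0 \<in> B" "g holomorphic_on B"
    using has_fps_expansion_imp_holomorphic[OF g] by metis
  obtain e where e: "e > 0" "ball 0 e \<subseteq> A \<inter> B"
    using A(1,2) B(1,2) by (meson IntI open_Int open_contains_ball)
  define d where "d = min e 1"
  have d: "d > 0" "d \<le> 1" "ball 0 d \<subseteq> A" "ball 0 d \<subseteq> B" using e by (auto simp: d_def)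
  have "f z = g z" if "z \<in> ball 0 d" for z
  proof (rule holomorphic_eq_negative[where f = f and g = g and D = "ball 0 d" and e = d])
    show "f holomorphic_on ball 0 d" "g holomorphic_on ball 0 d"
      using A(3) B(3) d by (auto intro: holomorphic_on_subset)
    show "complex_of_real ` {- d<..<0} \<subseteq> ball 0 d" by auto
    show "f (of_real x) = g (of_real x)" if "- d < x" "x < 0" for x
      using eq[of x] that d by simp
  qed (use d that in auto)
  moreover have "eventually (\<lambda>z :: complex. z \<in> ball 0 d) (nhds 0)"
    using d by (intro eventually_nhds_in_open) auto
  ultimately have "eventually (\<lambda>z. f z = g z) (nhds 0)"
    by (auto elim: eventually_mono)
  then have "g has_fps_expansion F"
    using f has_fps_expansion_cong[OF _ refl, of f g F] by simp
  then show ?thesis using g by (rule fps_expansion_unique_complex)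
qed

lemma mixed_moment_eq:
  assumes kb: "\<forall>t\<in>S. t ^ i * cnj t ^ j = (if b then t ^ k else cnj (t ^ k))" and \<mu>: "prob_on S \<mu>"
  shows "(LINT t|\<mu>. t ^ i * cnj t ^ j) = (if b then moment \<mu> k else cnj (moment \<mu> k))"
proof -
  have m: "(\<lambda>t. t ^ i * cnj t ^ j) \<in> borel_measurable borel" "(\<lambda>t. cnj (t ^ k)) \<in> borel_measurable borel"
    "(\<lambda>t :: complex. t ^ k) \<in> borel_measurable borel"
    by (intro borel_measurable_continuous_onI continuous_intros)+
  show ?thesis
  proof (cases b)
    case True
    then have "(LINT t|\<mu>. t ^ i * cnj t ^ j) = (LINT t|\<mu>. t ^ k)"
      using kb by (intro prob_on_integral_cong[OF \<mu> _ m(1,3)]) simp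
    then show ?thesis using True by (simp add: moment_def)
  next
    case False
    then have "(LINT t|\<mu>. t ^ i * cnj t ^ j) = (LINT t|\<mu>. cnj (t ^ k))"
      using kb by (intro prob_on_integral_cong[OF \<mu> _ m(1,2)]) simp
    also have "\<dots> = cnj (moment \<mu> k)" unfolding moment_def by (rule Bochner_Integration.integral_cnj)
    finally show ?thesis using False by simp
  qed
qed

section \<open>The iteration in a common setting\<close>

text \<open>The class \<open>E\<close> plays the role of the \<open>\<eta>\<close>-transforms of the measures on \<open>S\<close> other than
  \<open>\<delta>\<^sub>0\<close>.\<close>

locale eta_setting =
  fixes S D :: "complex set" and E :: "(complex \<Rightarrow> complex) \<Rightarrow> bool"
  assumes closed_S: "closed S"
    and mixed: "\<And>i j. \<exists>k b. \<forall>t\<in>S. t ^ i * cnj t ^ j = (if b then t ^ k else cnj (t ^ k))"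
    and open_D: "open D" and connected_D: "connected D"
    and neg_D: "\<And>x. - 1 < x \<Longrightarrow> x < 0 \<Longrightarrow> of_real x \<in> D"
    and regular_D: "\<And>z. z \<in> D \<Longrightarrow> regular_at S z"
    and phi_nonzero: "\<And>\<mu> z. prob_on S \<mu> \<Longrightarrow> z \<in> D \<Longrightarrow> phi \<mu> z \<noteq> 0"
    and determines: "\<And>\<mu> \<nu>. prob_on S \<mu> \<Longrightarrow> prob_on S \<nu> \<Longrightarrow> (\<And>z. z \<in> D \<Longrightarrow> eta \<mu> z = eta \<nu> z) \<Longrightarrow> \<mu> = \<nu>"
    and E_eta: "\<And>\<mu>. prob_on S \<mu> \<Longrightarrow> \<mu> \<noteq> delta0 \<Longrightarrow> E (eta \<mu>)"
    and realize: "\<And>f. E f \<Longrightarrow> \<exists>\<nu>. prob_on S \<nu> \<and> \<nu> \<noteq> delta0 \<and> (\<forall>z\<in>D. eta \<nu> z = f z)"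
    and E_D: "\<And>f z. E f \<Longrightarrow> z \<in> D \<Longrightarrow> f z \<in> D"
    and E_comp: "\<And>f g. E f \<Longrightarrow> E g \<Longrightarrow> E (\<lambda>z. f (g z))"
    and E_orth: "\<And>R \<mu> g. prob_on (S \<inter> cball 0 R) \<mu> \<Longrightarrow> \<mu> \<noteq> delta0 \<Longrightarrow> E g \<Longrightarrow> E (\<lambda>z. z * eta_quot \<mu> (g z))"
    and E_lim: "\<And>f. E f \<Longrightarrow> (f \<longlongrightarrow> 0) (at 0 within of_real ` {- 1<..<0})"
    and support: "\<And>r. r > 0 \<Longrightarrow> \<exists>R. \<forall>\<nu> F. prob_on S \<nu> \<longrightarrow> F holomorphic_on ball 0 r \<longrightarrow>
       (\<forall>z\<in>ball 0 r. norm (F z) \<le> 1 / 2) \<longrightarrow> (\<forall>z\<in>D \<inter> ball 0 r. eta \<nu> z = F z) \<longrightarrow> prob_on (S \<inter> cball 0 R) \<nu>"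
    and Helly: "\<And>R M. (\<And>n :: nat. prob_on (S \<inter> cball 0 R) (M n)) \<Longrightarrow>
       \<exists>r N. strict_mono r \<and> prob_on (S \<inter> cball 0 R) N \<and> weakly_converges (M \<circ> r) N"
begin

section \<open>Transforms and convolutions near \<open>0\<close>\<close>

lemma compact_SR: "compact (S \<inter> cball 0 R)"
  using closed_S by (simp add: closed_Int_compact)

lemma prob_on_S: "prob_on (S \<inter> cball 0 R) \<mu> \<Longrightarrow> prob_on S \<mu>"
  by (rule prob_on_mono) auto

lemma eta_eq_quot: "eta \<mu> w = w * eta_quot \<mu> w"
  by (simp add: eta_quot_def)

text \<open>For compact support the transform lives on \<open>D\<close> and on a disc about
  \<open>0\<close> at once. Inner transforms take values in \<open>D\<close> at points of
  \<open>D\<close> and near \<open>0\<close> at points near \<open>0\<close>, so the union is the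
  domain on which outer ones are needed.\<close>

lemma regular_SR:
  assumes "R \<ge> 1" "z \<in> D \<union> ball 0 (1 / (3 * R))"
  shows "regular_at (S \<inter> cball 0 R) z"
proof (cases "z \<in> D")
  case True
  then show ?thesis using regular_at_mono[OF regular_D] by blast
next
  case False
  then have "norm z * (3 * R) < 1" using assms by (simp add: field_simps)
  then have "norm z * R < 1" using assms(1) mult_nonneg_nonneg[of "norm z" R] by linarith
  then show ?thesis by (intro regular_at_near_0) auto
qed

lemma phi_nonzero_SR:
  assumes "prob_on (S \<inter> cball 0 R) \<mu>" "R \<ge> 1" "z \<in> D \<union> ball 0 (1 / (3 * R))"
  shows "phi \<mu> z \<noteq> 0"
  using assms phi_nonzero[OF prob_on_S] prob_on_cball_eta(2)[OF assms(1) _ assms(2), of z] by auto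

lemma eta_holomorphic_SR:
  assumes "prob_on (S \<inter> cball 0 R) \<mu>" "R \<ge> 1"
  shows "eta \<mu> holomorphic_on D \<union> ball 0 (1 / (3 * R))"
  using regular_SR[OF assms(2)] phi_nonzero_SR[OF assms] by (intro eta_holomorphic[OF assms(1)])

lemma eta_quot_holomorphic:
  assumes "prob_on (S \<inter> cball 0 R) \<mu>" "R \<ge> 1"
  shows "eta_quot \<mu> holomorphic_on D \<union> ball 0 (1 / (3 * R))"
proof -
  have "(\<lambda>z. if z = 0 then deriv (eta \<mu>) 0 else (eta \<mu> z - eta \<mu> 0) / (z - 0))
      holomorphic_on D \<union> ball 0 (1 / (3 * R))"
    using open_D by (intro pole_lemma_open eta_holomorphic_SR[OF assms]) auto
  then show ?thesis by (rule holomorphic_transform) (auto simp: eta_quot_def)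
qed

lemma eta_quot_bound:
  assumes \<mu>: "prob_on (S \<inter> cball 0 R) \<mu>" "R \<ge> 1" and w: "norm w < 1 / (3 * R)"
  shows "norm (eta_quot \<mu> w) \<le> 3 * R"
proof -
  have *: "norm (eta_quot \<mu> w) \<le> 3 * R" if "w \<noteq> 0" "norm w < 1 / (3 * R)" for w
  proof -
    have "norm (eta \<mu> w) \<le> 3 * R * norm w"
      using that by (intro prob_on_cball_eta(3)[OF \<mu>(1)] \<mu>(2)) auto
    then show ?thesis using that by (simp add: eta_quot_def norm_divide divide_le_eq)
  qed
  show ?thesis
  proof (cases "w = 0")
    case True
    have pos: "0 < 1 / (3 * R)" using \<mu>(2) by simp
    have "continuous_on (ball 0 (1 / (3 * R))) (eta_quot \<mu>)"
      using eta_quot_holomorphic[OF \<mu>] by (meson holomorphic_on_imp_continuous_on holomorphic_on_subset sup_ge2)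
    then have "isCont (eta_quot \<mu>) 0"
      using pos by (simp add: continuous_on_eq_continuous_at)
    then have "((\<lambda>w. norm (eta_quot \<mu> w)) \<longlongrightarrow> norm (eta_quot \<mu> 0)) (at 0)"
      by (intro tendsto_norm) (simp add: isCont_def)
    moreover have "eventually (\<lambda>w. norm (eta_quot \<mu> w) \<le> 3 * R) (at 0)"
      unfolding eventually_at using pos * by (intro exI[of _ "1 / (3 * R)"]) auto
    ultimately show ?thesis
      unfolding True by (intro tendsto_upperbound[of _ _ "at 0"]) auto
  qed (use * w in auto)
qed

text \<open>The definite description is resolved here: closure of the class gives a measure by
  realisation, and its transform pins it down.\<close>

lemma orth_conv_props:
  assumes \<mu>: "prob_on (S \<inter> cball 0 R) \<mu>" "\<mu> \<noteq> delta0" and \<nu>: "prob_on S \<nu>" "\<nu> \<noteq> delta0"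
  shows "prob_on S (orth_conv S D \<mu> \<nu>)" "orth_conv S D \<mu> \<nu> \<noteq> delta0"
    "\<And>z. z \<in> D \<Longrightarrow> eta (orth_conv S D \<mu> \<nu>) z = z * eta_quot \<mu> (eta \<nu> z)"
proof -
  obtain \<kappa> where \<kappa>: "prob_on S \<kappa>" "\<kappa> \<noteq> delta0" "\<forall>z\<in>D. eta \<kappa> z = z * eta_quot \<mu> (eta \<nu> z)"
    using realize[OF E_orth[OF \<mu> E_eta[OF \<nu>]]] by blast
  have "orth_conv S D \<mu> \<nu> = \<kappa>"
    unfolding orth_conv_def using \<kappa> by (intro the_equality) (auto intro!: determines)
  then show "prob_on S (orth_conv S D \<mu> \<nu>)" "orth_conv S D \<mu> \<nu> \<noteq> delta0"
    "\<And>z. z \<in> D \<Longrightarrow> eta (orth_conv S D \<mu> \<nu>) z = z * eta_quot \<mu> (eta \<nu> z)"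
    using \<kappa> by auto
qed

lemma monotone_conv_props:
  assumes \<mu>: "prob_on S \<mu>" "\<mu> \<noteq> delta0" and \<nu>: "prob_on S \<nu>" "\<nu> \<noteq> delta0"
  shows "prob_on S (monotone_conv S D \<mu> \<nu>)"
    "\<And>z. z \<in> D \<Longrightarrow> eta (monotone_conv S D \<mu> \<nu>) z = eta \<mu> (eta \<nu> z)"
proof -
  obtain \<kappa> where \<kappa>: "prob_on S \<kappa>" "\<forall>z\<in>D. eta \<kappa> z = eta \<mu> (eta \<nu> z)"
    using realize[OF E_comp[OF E_eta[OF \<mu>] E_eta[OF \<nu>]]] by blast
  have "monotone_conv S D \<mu> \<nu> = \<kappa>"
    unfolding monotone_conv_def using \<kappa> by (intro the_equality) (auto intro!: determines)
  then show "prob_on S (monotone_conv S D \<mu> \<nu>)"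
    "\<And>z. z \<in> D \<Longrightarrow> eta (monotone_conv S D \<mu> \<nu>) z = eta \<mu> (eta \<nu> z)"
    using \<kappa> by auto
qed

text \<open>For \<open>norm z < r\<close> the bound gives
  \<open>norm (F z) < 3 * R * r = 1 / (9 * R)\<close>, inside the disc where the next quotient is at
  most \<open>3 * R\<close>; so \<open>z * eta_quot \<mu>1 (F z)\<close> again obeys the bound. The
  function \<open>F\<close> stands for the transform near \<open>0\<close> while the support is
  still unknown.\<close>

lemma orth_iter_props:
  assumes "prob_on (S \<inter> cball 0 R) \<mu>1" "\<mu>1 \<noteq> delta0" "prob_on (S \<inter> cball 0 R) \<mu>2" "\<mu>2 \<noteq> delta0"
    and R: "R \<ge> 1" and r: "r = 1 / (27 * R ^ 2)"
  shows "prob_on S (orth_iter S D n \<mu>1 \<mu>2) \<and> orth_iter S D n \<mu>1 \<mu>2 \<noteq> delta0 \<and>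
    (\<exists>F. F holomorphic_on ball 0 r \<and> (\<forall>z\<in>ball 0 r. norm (F z) \<le> 3 * R * norm z) \<and>
       (\<forall>z\<in>D \<inter> ball 0 r. eta (orth_iter S D n \<mu>1 \<mu>2) z = F z))"
  using assms(1-4)
proof (induction n arbitrary: \<mu>1 \<mu>2)
  case 0
  have "r \<le> 1 / (3 * R)"
    unfolding r power2_eq_square using R by (intro divide_left_mono) (auto intro: mult_mono)
  then have "ball 0 r \<subseteq> ball (0 :: complex) (1 / (3 * R))" by auto
  moreover have "eta \<mu>1 holomorphic_on ball 0 (1 / (3 * R))"
    using eta_holomorphic_SR[OF 0(1) R] by (rule holomorphic_on_subset) auto
  ultimately have "eta \<mu>1 holomorphic_on ball 0 r" by (rule holomorphic_on_subset[rotated])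
  moreover have "\<forall>z\<in>ball 0 r. norm (eta \<mu>1 z) \<le> 3 * R * norm z"
    using \<open>r \<le> 1 / (3 * R)\<close> by (intro ballI prob_on_cball_eta(3)[OF 0(1)] R) auto
  ultimately show ?case
    using 0(2) prob_on_S[OF 0(1)] by (intro conjI exI[of _ "eta \<mu>1"]) simp_all
next
  case (Suc n)
  let ?\<nu> = "orth_iter S D n \<mu>2 \<mu>1"
  have IH: "prob_on S ?\<nu>" "?\<nu> \<noteq> delta0" using Suc.IH[OF Suc.prems(3,4,1,2)] by auto
  obtain F where F: "F holomorphic_on ball 0 r" "\<And>z. z \<in> ball 0 r \<Longrightarrow> norm (F z) \<le> 3 * R * norm z"
    "\<And>z. z \<in> D \<inter> ball 0 r \<Longrightarrow> eta ?\<nu> z = F z"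
    using Suc.IH[OF Suc.prems(3,4,1,2)] by blast
  note props = orth_conv_props[OF Suc.prems(1,2) IH]
  have F_lt: "norm (F z) < 1 / (3 * R)" if "z \<in> ball 0 r" for z
  proof -
    have "norm (F z) \<le> 3 * R * norm z" by (rule F(2)[OF that])
    also have "\<dots> < 3 * R * r" using that R by auto
    also have "\<dots> \<le> 1 / (3 * R)" unfolding r using R by (simp add: field_simps power2_eq_square)
    finally show ?thesis .
  qed
  define F' where "F' z = z * eta_quot \<mu>1 (F z)" for z
  have "(eta_quot \<mu>1 \<circ> F) holomorphic_on ball 0 r"
    using F(1) eta_quot_holomorphic[OF Suc.prems(1) R] F_lt
    by (intro holomorphic_on_compose_gen[of _ _ _ "ball 0 (1 / (3 * R))"]) (auto intro: holomorphic_on_subset)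
  then have "F' holomorphic_on ball 0 r"
    unfolding F'_def by (intro holomorphic_intros) (simp add: comp_def)
  moreover have "norm (F' z) \<le> 3 * R * norm z" if "z \<in> ball 0 r" for z
    unfolding F'_def norm_mult using eta_quot_bound[OF Suc.prems(1) R F_lt[OF that]]
    by (subst mult.commute, intro mult_right_mono) auto
  moreover have "eta (orth_iter S D (Suc n) \<mu>1 \<mu>2) z = F' z" if "z \<in> D \<inter> ball 0 r" for z
    using props(3)[of z] F(3)[OF that] that by (simp add: F'_def)
  ultimately show ?case
    using props(1,2) by (intro conjI exI[of _ F']) simp_all
qed

section \<open>Passage to the limit and coefficient identities\<close>

lemma mixed_moment:
  "\<exists>k b. \<forall>\<mu>. prob_on S \<mu> \<longrightarrow>
    (LINT t|\<mu>. t ^ i * cnj t ^ j) = (if b then moment \<mu> k else cnj (moment \<mu> k))"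
proof -
  obtain k b where kb: "\<forall>t\<in>S. t ^ i * cnj t ^ j = (if b then t ^ k else cnj (t ^ k))"
    using mixed[of i j] by (elim exE) (rule that)
  show ?thesis by (intro exI[of _ k] exI[of _ b] allI impI) (rule mixed_moment_eq[OF kb])
qed

text \<open>Selection yields a limit of a subsequence only. The moments are eventually constant,
  hence those of the limit, and therefore converge along the whole sequence.\<close>

lemma limit_exists:
  assumes M: "\<And>n :: nat. prob_on (S \<inter> cball 0 R) (M n)"
    and stable: "\<And>k n. n \<ge> k \<Longrightarrow> moment (M n) k = c k"
  shows "\<exists>N. prob_on (S \<inter> cball 0 R) N \<and> weakly_converges M N \<and> eta_converges D M N \<and>
    (\<forall>k. moment N k = c k) \<and> (\<forall>z\<in>D. (\<lambda>n. eta (M n) z) \<longlonglongrightarrow> eta N z)"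
proof -
  obtain r N where rN: "strict_mono r" "prob_on (S \<inter> cball 0 R) N" "weakly_converges (M \<circ> r) N"
    using Helly[of R M, OF M] by (elim exE conjE) (rule that)
  have mom_ev: "(\<lambda>n. moment (M n) k) \<longlonglongrightarrow> c k" for k
    using stable by (intro tendsto_eventually eventually_sequentiallyI[of k])
  have mom: "moment N k = c k" for k
  proof (rule LIMSEQ_unique)
    show "(\<lambda>n. moment ((M \<circ> r) n) k) \<longlonglongrightarrow> moment N k"
      unfolding moment_def using M rN(2)
      by (intro weakly_converges_complex[OF compact_SR _ _ rN(3)] borel_measurable_continuous_onI continuous_intros) auto
    show "(\<lambda>n. moment ((M \<circ> r) n) k) \<longlonglongrightarrow> c k"
      using LIMSEQ_subseq_LIMSEQ[OF mom_ev rN(1), of k] by (simp add: comp_def)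
  qed
  have w: "weakly_converges M N"
  proof (rule weakly_converges_moments[OF compact_SR M rN(2)])
    fix i j
    obtain k b where "\<forall>\<mu>. prob_on S \<mu> \<longrightarrow>
        (LINT t|\<mu>. t ^ i * cnj t ^ j) = (if b then moment \<mu> k else cnj (moment \<mu> k))"
      using mixed_moment[of i j] by (elim exE) (rule that)
    then have eq: "(LINT t|\<mu>. t ^ i * cnj t ^ j) = (if b then moment \<mu> k else cnj (moment \<mu> k))"
      if "prob_on (S \<inter> cball 0 R) \<mu>" for \<mu>
      using prob_on_S[OF that] by (elim allE impE)
    show "(\<lambda>n. LINT t|M n. t ^ i * cnj t ^ j) \<longlonglongrightarrow> (LINT t|N. t ^ i * cnj t ^ j)"
      using mom_ev[of k] mom[of k] by (simp add: eq M rN(2) tendsto_cnj)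
  qed
  have regular: "regular_at (S \<inter> cball 0 R) z" if "z \<in> D" for z
    by (rule regular_at_mono[OF regular_D[OF that]]) auto
  have conv: "eta_converges D M N"
    using regular phi_nonzero prob_on_S by (intro eta_convergesI[OF compact_SR M rN(2) w]) auto
  have "(\<lambda>n. eta (M n) z) \<longlonglongrightarrow> eta N z" if "z \<in> D" for z
  proof -
    have "uniform_limit {z} (\<lambda>n. eta (M n)) (eta N) sequentially"
      by (rule conv[unfolded eta_converges_def, rule_format]) (use that in simp)
    then show ?thesis by (rule tendsto_uniform_limitI) simp
  qed
  then show ?thesis using rN(2) w conv mom by blast
qed

lemma moments_determine:
  assumes K: "compact K" "compact K'" and M: "prob_on (S \<inter> K) M" and N: "prob_on (S \<inter> K') N"
    and eq: "\<And>k. moment M k = moment N k"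
  shows "M = N"
proof (rule eqI_mixed_moments)
  show c: "compact (S \<inter> (K \<union> K'))" using closed_S K by (simp add: closed_Int_compact compact_Un)
  show M': "prob_on (S \<inter> (K \<union> K')) M" and N': "prob_on (S \<inter> (K \<union> K')) N"
    using M N by (auto intro: prob_on_mono)
  fix i j
  obtain k b where "\<forall>\<mu>. prob_on S \<mu> \<longrightarrow>
      (LINT t|\<mu>. t ^ i * cnj t ^ j) = (if b then moment \<mu> k else cnj (moment \<mu> k))"
    using mixed_moment[of i j] by (elim exE) (rule that)
  moreover have "prob_on S M" "prob_on S N" using M N by (auto intro: prob_on_mono)
  ultimately show "(LINT t|M. t ^ i * cnj t ^ j) = (LINT t|N. t ^ i * cnj t ^ j)"
    using eq by metis
qed

lemma eta_fps_expansion: "prob_on (S \<inter> cball 0 R) \<mu> \<Longrightarrow> eta \<mu> has_fps_expansion eta_fps \<mu>"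
  unfolding eta_fps_def by (rule eta_has_fps_expansion) auto

lemma eta_quot_fps_expansion:
  assumes \<mu>: "prob_on (S \<inter> cball 0 R) \<mu>" "R \<ge> 1"
  obtains q where "eta_quot \<mu> has_fps_expansion q" "q $ 0 = moment \<mu> 1"
proof -
  let ?q = "fps_expansion (eta_quot \<mu>) 0"
  have q: "eta_quot \<mu> has_fps_expansion ?q"
    using open_D \<mu>(2) by (intro has_fps_expansion_fps_expansion[OF _ _ eta_quot_holomorphic[OF \<mu>]]) auto
  have "eta_quot \<mu> 0 = moment \<mu> 1"
    using deriv_eta_0[OF \<mu>(1) Int_lower2] by (simp add: eta_quot_def)
  then have q0: "?q $ 0 = moment \<mu> 1"
    using fps_nth_fps_expansion[OF q, of 0] by simp
  show thesis by (rule that[OF q q0])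
qed

text \<open>The factor \<open>A\<close> is \<open>z\<close> in the orthogonal recursion and
  \<open>1\<close> for plain compositions.\<close>

lemma eta_fps_compose:
  assumes \<sigma>: "prob_on (S \<inter> cball 0 R1) \<sigma>" and \<tau>: "prob_on (S \<inter> cball 0 R2) \<tau>"
    and A: "A has_fps_expansion a" and G: "G has_fps_expansion g"
    and eq: "\<And>z. z \<in> D \<Longrightarrow> eta \<sigma> z = A z * G (eta \<tau> z)"
  shows "eta_fps \<sigma> = a * (g oo eta_fps \<tau>)"
proof (rule fps_eq_negative[OF eta_fps_expansion[OF \<sigma>]])
  have "(G \<circ> eta \<tau>) has_fps_expansion (g oo eta_fps \<tau>)"
    by (intro has_fps_expansion_compose G eta_fps_expansion[OF \<tau>] eta_fps_nth(1)[OF \<tau>])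
  then show "(\<lambda>z. A z * (G \<circ> eta \<tau>) z) has_fps_expansion a * (g oo eta_fps \<tau>)"
    by (intro has_fps_expansion_mult A)
  show "eta \<sigma> (of_real x) = A (of_real x) * (G \<circ> eta \<tau>) (of_real x)" if "- 1 < x" "x < 0" for x
    using eq[OF neg_D[OF that]] by simp
qed


text \<open>A nonzero mean makes \<open>eta \<mu>\<close> injective near \<open>0\<close>. Both
  inner transforms tend to \<open>0\<close> along the negative axis, so they agree on its last
  stretch and hence on \<open>D\<close>. This gives uniqueness of the s-free pair, also among
  measures of unbounded support.\<close>

lemma eta_injective_near_0:
  assumes \<mu>: "prob_on (S \<inter> cball 0 R) \<mu>" "R \<ge> 1" "moment \<mu> 1 \<noteq> 0"
    and \<sigma>: "prob_on S \<sigma>" "\<sigma> \<noteq> delta0" and \<tau>: "prob_on S \<tau>" "\<tau> \<noteq> delta0"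
    and eq: "\<And>z. z \<in> D \<Longrightarrow> eta \<mu> (eta \<sigma> z) = eta \<mu> (eta \<tau> z)"
  shows "\<sigma> = \<tau>"
proof -
  have "0 \<in> D \<union> ball 0 (1 / (3 * R))" "open (D \<union> ball 0 (1 / (3 * R)))"
    using \<mu>(2) open_D by auto
  moreover have "deriv (eta \<mu>) 0 \<noteq> 0" using deriv_eta_0[OF \<mu>(1) Int_lower2] \<mu>(3) by simp
  ultimately obtain \<epsilon> where \<epsilon>: "\<epsilon> > 0" "inj_on (eta \<mu>) (ball 0 \<epsilon>)"
    using has_complex_derivative_locally_injective[OF eta_holomorphic_SR[OF \<mu>(1,2)]] by metis
  have "eventually (\<lambda>z. eta \<kappa> z \<in> ball 0 \<epsilon>) (at 0 within of_real ` {- 1<..<0})"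
    if "prob_on S \<kappa>" "\<kappa> \<noteq> delta0" for \<kappa>
    using \<epsilon>(1) by (intro topological_tendstoD[OF E_lim[OF E_eta[OF that]]]) auto
  from eventually_conj[OF this[OF \<sigma>] this[OF \<tau>]]
  obtain d where d: "d > 0" "\<forall>z\<in>of_real ` {- 1<..<0}. z \<noteq> 0 \<and> dist z 0 < d \<longrightarrow>
      eta \<sigma> z \<in> ball 0 \<epsilon> \<and> eta \<tau> z \<in> ball 0 \<epsilon>"
    unfolding eventually_at by (elim exE conjE) (rule that)
  define e where "e = min d 1"
  have e: "e > 0" "e \<le> d" "e \<le> 1" using d(1) by (auto simp: e_def)
  have neg: "eta \<sigma> (of_real x) = eta \<tau> (of_real x)" if x: "- e < x" "x < 0" for x
  proof -
    have "eta \<sigma> (of_real x) \<in> ball 0 \<epsilon> \<and> eta \<tau> (of_real x) \<in> ball 0 \<epsilon>"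
      using x e by (intro d(2)[rule_format] imageI) auto
    moreover have "eta \<mu> (eta \<sigma> (of_real x)) = eta \<mu> (eta \<tau> (of_real x))"
      using x e by (intro eq neg_D) auto
    ultimately show ?thesis using \<epsilon>(2) by (auto simp: inj_on_def)
  qed
  show ?thesis
  proof (rule determines[OF \<sigma>(1) \<tau>(1)])
    fix z assume z: "z \<in> D"
    have hol: "eta \<kappa> holomorphic_on D" if "prob_on S \<kappa>" for \<kappa>
      using regular_D phi_nonzero[OF that] by (intro eta_holomorphic[OF that])
    show "eta \<sigma> z = eta \<tau> z"
    proof (rule holomorphic_eq_negative[where f = "eta \<sigma>" and g = "eta \<tau>" and e = e, OF hol hol open_D connected_D])
      show "complex_of_real ` {- e<..<0} \<subseteq> D"
        using e neg_D by auto
    qed (use \<sigma> \<tau> e neg z in auto)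
  qed
qed

text \<open>The recursion is multiplication by \<open>fps_X\<close> after composition with a fixed
  quotient, with the two measures exchanged; hence the simultaneous induction on both sequences. The
  base case is the vanishing of constant terms.\<close>

lemma iter_stable:
  assumes "prob_on (S \<inter> cball 0 R) \<mu>1" "moment \<mu>1 1 \<noteq> 0" "prob_on (S \<inter> cball 0 R) \<mu>2" "moment \<mu>2 1 \<noteq> 0"
    and R: "R \<ge> 1" and ne: "\<mu>1 \<noteq> delta0" "\<mu>2 \<noteq> delta0"
    and R1: "\<And>n. prob_on (S \<inter> cball 0 R1) (orth_iter S D n \<mu>1 \<mu>2)" "\<And>n. prob_on (S \<inter> cball 0 R1) (orth_iter S D n \<mu>2 \<mu>1)"
  shows "fps_agree k (eta_fps (orth_iter S D k \<mu>1 \<mu>2)) (eta_fps (orth_iter S D (k + m) \<mu>1 \<mu>2))"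
    "moment (orth_iter S D k \<mu>1 \<mu>2) 1 = moment \<mu>1 1"
proof -
  have rec: "\<exists>q. q $ 0 = moment \<mu> 1 \<and> (\<forall>n. eta_fps (orth_iter S D (Suc n) \<mu> \<nu>) = fps_X * (q oo eta_fps (orth_iter S D n \<nu> \<mu>)))"
    if \<mu>: "prob_on (S \<inter> cball 0 R) \<mu>" "\<mu> \<noteq> delta0" and \<nu>: "prob_on (S \<inter> cball 0 R) \<nu>" "\<nu> \<noteq> delta0"
      and it: "\<And>n. prob_on (S \<inter> cball 0 R1) (orth_iter S D n \<mu> \<nu>)" "\<And>n. prob_on (S \<inter> cball 0 R1) (orth_iter S D n \<nu> \<mu>)"
    for \<mu> \<nu>
  proof -
    obtain q where q: "eta_quot \<mu> has_fps_expansion q" "q $ 0 = moment \<mu> 1"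
      by (rule eta_quot_fps_expansion[OF \<mu>(1) R])
    have "eta_fps (orth_iter S D (Suc n) \<mu> \<nu>) = fps_X * (q oo eta_fps (orth_iter S D n \<nu> \<mu>))" for n
    proof (rule eta_fps_compose[OF it(1) it(2) has_fps_expansion_fps_X q(1)])
      fix z assume "z \<in> D"
      have "orth_iter S D n \<nu> \<mu> \<noteq> delta0"
        using orth_iter_props[OF \<nu> \<mu> R refl, of n] by blast
      then show "eta (orth_iter S D (Suc n) \<mu> \<nu>) z = z * eta_quot \<mu> (eta (orth_iter S D n \<nu> \<mu>) z)"
        using orth_conv_props(3)[OF \<mu> prob_on_S[OF it(2)[of n]]] \<open>z \<in> D\<close> by simp
    qed
    then show ?thesis using q(2) by blast
  qed
  obtain q1 where q1: "q1 $ 0 = moment \<mu>1 1"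
    "\<And>n. eta_fps (orth_iter S D (Suc n) \<mu>1 \<mu>2) = fps_X * (q1 oo eta_fps (orth_iter S D n \<mu>2 \<mu>1))"
    using rec[OF assms(1) ne(1) assms(3) ne(2) R1] by metis
  obtain q2 where q2: "q2 $ 0 = moment \<mu>2 1"
    "\<And>n. eta_fps (orth_iter S D (Suc n) \<mu>2 \<mu>1) = fps_X * (q2 oo eta_fps (orth_iter S D n \<mu>1 \<mu>2))"
    using rec[OF assms(3) ne(2) assms(1) ne(1) R1(2,1)] by metis
  have "fps_agree k (eta_fps (orth_iter S D k \<mu>1 \<mu>2)) (eta_fps (orth_iter S D (k + m) \<mu>1 \<mu>2)) \<and>
      fps_agree k (eta_fps (orth_iter S D k \<mu>2 \<mu>1)) (eta_fps (orth_iter S D (k + m) \<mu>2 \<mu>1))" for k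
  proof (induction k)
    case 0
    show ?case using eta_fps_nth(1)[OF R1(1)[of 0]] eta_fps_nth(1)[OF R1(2)[of 0]]
        eta_fps_nth(1)[OF R1(1)[of m]] eta_fps_nth(1)[OF R1(2)[of m]] by (simp add: fps_agree_def)
  next
    case (Suc k)
    then show ?case
      unfolding add_Suc q1(2) q2(2) by (intro conjI fps_agree_X_mult fps_agree_compose) auto
  qed
  then show "fps_agree k (eta_fps (orth_iter S D k \<mu>1 \<mu>2)) (eta_fps (orth_iter S D (k + m) \<mu>1 \<mu>2))" by blast
  show "moment (orth_iter S D k \<mu>1 \<mu>2) 1 = moment \<mu>1 1"
  proof (cases k)
    case (Suc n)
    have "eta_fps (orth_iter S D k \<mu>1 \<mu>2) $ 1 = moment \<mu>1 1"
      unfolding Suc q1(2) using q1(1) by simp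
    then show ?thesis using eta_fps_nth(2)[OF R1(1)] by metis
  qed simp
qed

lemma moment_eq_of_agree:
  assumes "prob_on A \<sigma>" "prob_on B \<tau>" "fps_agree k (eta_fps \<sigma>) (eta_fps \<tau>)"
  shows "moment \<tau> k = moment \<sigma> k"
proof -
  have "fps_agree k (1 - eta_fps \<sigma>) (1 - eta_fps \<tau>)"
    using assms(3) by (simp add: fps_agree_def)
  moreover have "(1 - eta_fps \<sigma>) $ 0 \<noteq> 0" using eta_fps_nth(1)[OF assms(1)] by simp
  ultimately have "fps_agree k (Abs_fps (moment \<sigma>)) (Abs_fps (moment \<tau>))"
    unfolding eta_fps_nth(4)[OF assms(1)] eta_fps_nth(4)[OF assms(2)] by (rule fps_agree_inverse)
  then show ?thesis by (simp add: fps_agree_def)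
qed

text \<open>With \<open>u\<close> and \<open>v\<close> the transforms of \<open>\<sigma>2\<close>
  and \<open>\<sigma>1\<close> divided by \<open>z\<close>, the equations say that the transform of
  \<open>\<nu>\<close> is \<open>z * u * v\<close>. Every admissible functional then has the moments
  of \<open>\<nu>\<close>, and \<open>free_state\<close> supplies one.\<close>

lemma free_conv_eqI:
  assumes \<mu>1: "prob_on (S \<inter> cball 0 R) \<mu>1" "moment \<mu>1 1 \<noteq> 0"
    and \<mu>2: "prob_on (S \<inter> cball 0 R) \<mu>2" "moment \<mu>2 1 \<noteq> 0"
    and \<sigma>1: "prob_on (S \<inter> cball 0 R1) \<sigma>1" "moment \<sigma>1 1 \<noteq> 0" and \<sigma>2: "prob_on (S \<inter> cball 0 R1) \<sigma>2" "moment \<sigma>2 1 \<noteq> 0"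
    and \<nu>: "prob_on (S \<inter> cball 0 R1) \<nu>"
    and eq: "eta_fps \<nu> = eta_fps \<mu>1 oo eta_fps \<sigma>2" "eta_fps \<nu> = eta_fps \<mu>2 oo eta_fps \<sigma>1"
      "fps_X * eta_fps \<nu> = eta_fps \<sigma>1 * eta_fps \<sigma>2"
  shows "free_conv S \<mu>1 \<mu>2 = \<nu>"
proof -
  define u v where "u = fps_shift 1 (eta_fps \<sigma>2)" and "v = fps_shift 1 (eta_fps \<sigma>1)"
  have Xu: "fps_X * u = eta_fps \<sigma>2" and Xv: "fps_X * v = eta_fps \<sigma>1"
    using eta_fps_nth(1)[OF \<sigma>2(1)] eta_fps_nth(1)[OF \<sigma>1(1)]
    by (simp_all add: u_def v_def fps_eq_iff)
  have nz: "u \<noteq> 0" "v \<noteq> 0"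
    using Xu Xv \<sigma>1(2) \<sigma>2(2) eta_fps_nth(2)[OF \<sigma>1(1)] eta_fps_nth(2)[OF \<sigma>2(1)] by auto
  have "fps_X * eta_fps \<nu> = fps_X * (fps_X * u * v)"
    unfolding eq(3) Xu[symmetric] Xv[symmetric] by (simp add: mult_ac)
  then have \<nu>uv: "eta_fps \<nu> = fps_X * u * v" by simp
  have comp: "(Abs_fps (moment \<mu>) oo w) * (1 - fps_X * u * v) = 1"
    if \<mu>: "prob_on (S \<inter> cball 0 R) \<mu>" and w: "w $ 0 = 0" "eta_fps \<nu> = eta_fps \<mu> oo w" for \<mu> w
  proof -
    have "(Abs_fps (moment \<mu>) * (1 - eta_fps \<mu>)) oo w = 1"
      by (simp add: eta_fps_nth(3)[OF \<mu>])
    then show ?thesis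
      unfolding \<nu>uv[symmetric] w(2) by (simp add: fps_compose_mult_distrib[OF w(1)] fps_compose_sub_distrib)
  qed
  have c1: "(Abs_fps (moment \<mu>1) oo (fps_X * u)) * (1 - fps_X * u * v) = 1"
    by (rule comp[OF \<mu>1(1)]) (simp, simp only: Xu eq(1))
  have c2: "(Abs_fps (moment \<mu>2) oo (fps_X * v)) * (1 - fps_X * u * v) = 1"
    by (rule comp[OF \<mu>2(1)]) (simp, simp only: Xv eq(2))
  have mom: "\<phi> (concat (replicate n [False, True])) = moment \<nu> n"
    if \<phi>: "free_pair \<phi>" "\<forall>n. \<phi> (replicate n False) = moment \<mu>1 n" "\<forall>n. \<phi> (replicate n True) = moment \<mu>2 n" for \<phi> n
  proof -
    let ?W = "Abs_fps (\<lambda>n. \<phi> (concat (replicate n [False, True])))"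
    have W: "?W * (1 - eta_fps \<nu>) = 1"
      unfolding \<nu>uv using \<phi>(2,3) c1 c2 by (intro free_product_moments \<phi>(1) nz) simp_all
    have ne: "1 - eta_fps \<nu> \<noteq> 0" using eta_fps_nth(3)[OF \<nu>] by auto
    have "?W * (1 - eta_fps \<nu>) = Abs_fps (moment \<nu>) * (1 - eta_fps \<nu>)"
      by (simp only: W eta_fps_nth(3)[OF \<nu>])
    then have "?W = Abs_fps (moment \<nu>)" by (rule mult_right_cancel[OF ne, THEN iffD1])
    then show ?thesis by (simp add: fps_eq_iff)
  qed
  define m where "m b = (if b then moment \<mu>2 else moment \<mu>1)" for b
  define \<phi>0 where "\<phi>0 = free_state m"
  have m0: "m i 0 = 1" for i using moment_0[OF \<mu>1(1)] moment_0[OF \<mu>2(1)] by (simp add: m_def)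
  have \<phi>0: "free_pair \<phi>0" "\<forall>n. \<phi>0 (replicate n False) = moment \<mu>1 n" "\<forall>n. \<phi>0 (replicate n True) = moment \<mu>2 n"
    using free_pair_free_state[of m] free_state_replicate[of m] m0 by (auto simp: \<phi>0_def m_def)
  show ?thesis
    unfolding free_conv_def
  proof (rule the_equality)
    have "AE t in \<nu>. t \<in> cball 0 R1" using prob_on_AE[OF \<nu>] by auto
    then have "compactly_supported \<nu>"
      unfolding compactly_supported_def using compact_cball by blast
    then show "prob_on S \<nu> \<and> compactly_supported \<nu> \<and> (\<exists>\<phi>. free_pair \<phi> \<and> (\<forall>n. \<phi> (replicate n False) = moment \<mu>1 n) \<and>
        (\<forall>n. \<phi> (replicate n True) = moment \<mu>2 n) \<and> (\<forall>n. \<phi> (concat (replicate n [False, True])) = moment \<nu> n))"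
      using prob_on_S[OF \<nu>] \<phi>0 mom[OF \<phi>0] by (intro conjI exI[of _ \<phi>0]) auto
  next
    fix \<kappa> assume \<kappa>: "prob_on S \<kappa> \<and> compactly_supported \<kappa> \<and> (\<exists>\<phi>. free_pair \<phi> \<and> (\<forall>n. \<phi> (replicate n False) = moment \<mu>1 n) \<and>
        (\<forall>n. \<phi> (replicate n True) = moment \<mu>2 n) \<and> (\<forall>n. \<phi> (concat (replicate n [False, True])) = moment \<kappa> n))"
    then obtain K where K: "compact K" "AE t in \<kappa>. t \<in> K" by (auto simp: compactly_supported_def)
    have "prob_on (S \<inter> K) \<kappa>" using \<kappa> K(2) by (intro prob_on_IntI) auto
    moreover have "moment \<kappa> n = moment \<nu> n" for n using \<kappa> mom by metis
    ultimately show "\<kappa> = \<nu>" by (intro moments_determine[OF K(1) compact_cball _ \<nu>]) auto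
  qed
qed

theorem iteration_converges:
  assumes \<mu>1: "prob_on (S \<inter> cball 0 R) \<mu>1" "moment \<mu>1 1 \<noteq> 0" "\<mu>1 \<noteq> delta0"
    and \<mu>2: "prob_on (S \<inter> cball 0 R) \<mu>2" "moment \<mu>2 1 \<noteq> 0" "\<mu>2 \<noteq> delta0"
    and R: "R \<ge> 1"
  shows "weakly_converges (\<lambda>n. orth_iter S D n \<mu>1 \<mu>2) (sfree_conv S D \<mu>1 \<mu>2)"
    "weakly_converges (\<lambda>n. monotone_conv S D \<mu>1 (orth_iter S D n \<mu>2 \<mu>1)) (free_conv S \<mu>1 \<mu>2)"
    "eta_converges D (\<lambda>n. orth_iter S D n \<mu>1 \<mu>2) (sfree_conv S D \<mu>1 \<mu>2)"
    "eta_converges D (\<lambda>n. monotone_conv S D \<mu>1 (orth_iter S D n \<mu>2 \<mu>1)) (free_conv S \<mu>1 \<mu>2)"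
proof -
  define a b l where "a n = orth_iter S D n \<mu>1 \<mu>2" and "b n = orth_iter S D n \<mu>2 \<mu>1"
    and "l n = monotone_conv S D \<mu>1 (b n)" for n
  define r where "r = 1 / (27 * R ^ 2)"
  have r: "r > 0" using R by (simp add: r_def)
  \<comment> \<open>The constant \<open>27\<close> leaves room for one more transform: values below
    \<open>1 / (9 * R)\<close> are mapped by \<open>eta \<mu>1\<close> to values of norm at most
    \<open>1 / 3\<close>, as the monotone convolutions require.\<close>
  have r_le: "3 * R * r \<le> 1 / (9 * R)" "1 / (9 * R) \<le> 1 / 9" "1 / (9 * R) < 1 / (3 * R)"
    unfolding r_def using R by (simp_all add: field_simps power2_eq_square)
  obtain R1 where R1: "\<forall>\<nu> F. prob_on S \<nu> \<longrightarrow> F holomorphic_on ball 0 r \<longrightarrow>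
       (\<forall>z\<in>ball 0 r. norm (F z) \<le> 1 / 2) \<longrightarrow> (\<forall>z\<in>D \<inter> ball 0 r. eta \<nu> z = F z) \<longrightarrow> prob_on (S \<inter> cball 0 R1) \<nu>"
    using support[OF r] by (elim exE) (rule that)
  have small: "norm (F z) < 1 / (9 * R)" if "\<forall>z\<in>ball 0 r. norm (F z) \<le> 3 * R * norm z" "z \<in> ball 0 r" for F :: "complex \<Rightarrow> complex" and z
  proof -
    have "norm (F z) \<le> 3 * R * norm z" using that by blast
    also have "\<dots> < 3 * R * r" using that(2) R by auto
    finally show ?thesis using r_le by linarith
  qed
  have iter: "prob_on (S \<inter> cball 0 R1) (orth_iter S D n \<mu> \<nu>) \<and> orth_iter S D n \<mu> \<nu> \<noteq> delta0"
    if h: "prob_on (S \<inter> cball 0 R) \<mu>" "\<mu> \<noteq> delta0" "prob_on (S \<inter> cball 0 R) \<nu>" "\<nu> \<noteq> delta0" for \<mu> \<nu> n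
  proof -
    obtain F where F: "F holomorphic_on ball 0 r" "\<forall>z\<in>ball 0 r. norm (F z) \<le> 3 * R * norm z"
      "\<forall>z\<in>D \<inter> ball 0 r. eta (orth_iter S D n \<mu> \<nu>) z = F z"
      using orth_iter_props[OF h R r_def, of n] by (elim exE conjE) (rule that)
    have "\<forall>z\<in>ball 0 r. norm (F z) \<le> 1 / 2"
    proof
      show "norm (F z) \<le> 1 / 2" if "z \<in> ball 0 r" for z
        using small[OF F(2) that] r_le(2) by linarith
    qed
    then show ?thesis
      using R1[rule_format, of "orth_iter S D n \<mu> \<nu>" F] F(1,3) orth_iter_props[OF h R r_def, of n] by simp
  qed
  have a: "prob_on (S \<inter> cball 0 R1) (a n)" "a n \<noteq> delta0" and b: "prob_on (S \<inter> cball 0 R1) (b n)" "b n \<noteq> delta0" for n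
    using iter[OF \<mu>1(1,3) \<mu>2(1,3), of n] iter[OF \<mu>2(1,3) \<mu>1(1,3), of n] by (auto simp: a_def b_def)
  have l_eta: "eta (l n) z = eta \<mu>1 (eta (b n) z)" if "z \<in> D" for n z
    unfolding l_def using monotone_conv_props(2)[OF prob_on_S[OF \<mu>1(1)] \<mu>1(3) prob_on_S[OF b(1)] b(2) that] .
  have l: "prob_on (S \<inter> cball 0 R1) (l n)" for n
  proof -
    obtain F where F: "F holomorphic_on ball 0 r" "\<forall>z\<in>ball 0 r. norm (F z) \<le> 3 * R * norm z"
      "\<forall>z\<in>D \<inter> ball 0 r. eta (orth_iter S D n \<mu>2 \<mu>1) z = F z"
      using orth_iter_props[OF \<mu>2(1,3) \<mu>1(1,3) R r_def, of n] by (elim exE conjE) (rule that)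
    have Fs: "norm (F z) < 1 / (9 * R)" if "z \<in> ball 0 r" for z using small[OF F(2) that] .
    have "F ` ball 0 r \<subseteq> D \<union> ball 0 (1 / (3 * R))" using Fs r_le(3) by fastforce
    then have hol: "(eta \<mu>1 \<circ> F) holomorphic_on ball 0 r"
      by (intro holomorphic_on_compose_gen[OF F(1) eta_holomorphic_SR[OF \<mu>1(1) R]])
    have bd: "\<forall>z\<in>ball 0 r. norm ((eta \<mu>1 \<circ> F) z) \<le> 1 / 2"
    proof
      fix z :: complex assume z: "z \<in> ball 0 r"
      have "norm (eta \<mu>1 (F z)) \<le> 3 * R * norm (F z)"
        using Fs[OF z] r_le(3) by (intro prob_on_cball_eta(3)[OF \<mu>1(1)] R) auto
      also have "\<dots> \<le> 3 * R * (1 / (9 * R))" using Fs[OF z] R by (intro mult_left_mono) auto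
      also have "\<dots> \<le> 1 / 2" using R by simp
      finally show "norm ((eta \<mu>1 \<circ> F) z) \<le> 1 / 2" by simp
    qed
    have "\<forall>z\<in>D \<inter> ball 0 r. eta (l n) z = (eta \<mu>1 \<circ> F) z"
      using l_eta F(3) by (simp add: b_def)
    moreover have "prob_on S (l n)"
      unfolding l_def by (rule monotone_conv_props(1)[OF prob_on_S[OF \<mu>1(1)] \<mu>1(3) prob_on_S[OF b(1)] b(2)])
    ultimately show ?thesis
      using R1[rule_format, of "l n" "eta \<mu>1 \<circ> F"] hol bd by simp
  qed
  note stable1 = iter_stable[OF \<mu>1(1,2) \<mu>2(1,2) R \<mu>1(3) \<mu>2(3), of R1, folded a_def b_def, OF a(1) b(1)]
  note stable2 = iter_stable[OF \<mu>2(1,2) \<mu>1(1,2) R \<mu>2(3) \<mu>1(3), of R1, folded a_def b_def, OF b(1) a(1)]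
  have a_mom: "moment (a n) k = moment (a k) k" if "k \<le> n" for n k
    using moment_eq_of_agree[OF a(1) a(1) stable1(1)[of k "n - k"]] that by simp
  have b_mom: "moment (b n) k = moment (b k) k" if "k \<le> n" for n k
    using moment_eq_of_agree[OF b(1) b(1) stable2(1)[of k "n - k"]] that by simp
  have l_fps: "eta_fps (l n) = eta_fps \<mu>1 oo eta_fps (b n)" for n
    using eta_fps_compose[OF l b(1) has_fps_expansion_1 eta_fps_expansion[OF \<mu>1(1)]] l_eta by simp
  have l_mom: "moment (l n) k = moment (l k) k" if "k \<le> n" for n k
    using moment_eq_of_agree[OF l[of k] l[of n], of k] stable2(1)[of k "n - k"] that
    by (simp add: l_fps fps_agree_compose)
  obtain \<sigma>1 where \<sigma>1: "prob_on (S \<inter> cball 0 R1) \<sigma>1" "weakly_converges a \<sigma>1" "eta_converges D a \<sigma>1"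
    "\<And>k. moment \<sigma>1 k = moment (a k) k" "\<And>z. z \<in> D \<Longrightarrow> (\<lambda>n. eta (a n) z) \<longlonglongrightarrow> eta \<sigma>1 z"
    using limit_exists[of R1 a, OF a(1) a_mom] by metis
  obtain \<sigma>2 where \<sigma>2: "prob_on (S \<inter> cball 0 R1) \<sigma>2" "weakly_converges b \<sigma>2" "eta_converges D b \<sigma>2"
    "\<And>k. moment \<sigma>2 k = moment (b k) k" "\<And>z. z \<in> D \<Longrightarrow> (\<lambda>n. eta (b n) z) \<longlonglongrightarrow> eta \<sigma>2 z"
    using limit_exists[of R1 b, OF b(1) b_mom] by metis
  obtain \<nu> where \<nu>: "prob_on (S \<inter> cball 0 R1) \<nu>" "weakly_converges l \<nu>" "eta_converges D l \<nu>"
    "\<And>z. z \<in> D \<Longrightarrow> (\<lambda>n. eta (l n) z) \<longlonglongrightarrow> eta \<nu> z"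
    using limit_exists[of R1 l, OF l l_mom] by metis
  \<comment> \<open>The mean is constant along each iteration, so the limits inherit a nonzero mean
    and differ from \<open>delta0\<close>.\<close>
  have \<sigma>_mom: "moment \<sigma>1 1 \<noteq> 0" "moment \<sigma>2 1 \<noteq> 0"
    using \<sigma>1(4)[of 1] \<sigma>2(4)[of 1] stable1(2)[of 1] stable2(2)[of 1] \<mu>1(2) \<mu>2(2) by simp_all
  have "moment delta0 1 = 0" by (simp add: moment_def integral_return)
  then have \<sigma>_ne: "\<sigma>1 \<noteq> delta0" "\<sigma>2 \<noteq> delta0" using \<sigma>_mom by auto
  have in_D: "eta \<sigma>1 z \<in> D" "eta \<sigma>2 z \<in> D" if "z \<in> D" for z
    using E_D[OF E_eta that] prob_on_S \<sigma>1(1) \<sigma>2(1) \<sigma>_ne by blast+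
  \<comment> \<open>The recursion passes to the limit because the quotient is continuous at
    \<open>eta \<tau> z\<close>, a point of the open set \<open>D\<close>.\<close>
  have limit_eq: "eta \<sigma> z = z * eta_quot \<mu> (eta \<tau> z)"
    if \<mu>: "prob_on (S \<inter> cball 0 R) \<mu>" and z: "z \<in> D"
      and c: "(\<lambda>n. eta (c n) z) \<longlonglongrightarrow> eta \<sigma> z" and d: "(\<lambda>n. eta (d n) z) \<longlonglongrightarrow> eta \<tau> z" and \<tau>: "eta \<tau> z \<in> D"
      and rec: "\<And>n. eta (c (Suc n)) z = z * eta_quot \<mu> (eta (d n) z)" for \<mu> \<sigma> \<tau> z and c d :: "nat \<Rightarrow> complex measure"
  proof (rule LIMSEQ_unique)
    show "(\<lambda>n. eta (c (Suc n)) z) \<longlonglongrightarrow> eta \<sigma> z" using c by (rule LIMSEQ_Suc)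
    have "continuous_on (D \<union> ball 0 (1 / (3 * R))) (eta_quot \<mu>)"
      by (rule holomorphic_on_imp_continuous_on[OF eta_quot_holomorphic[OF \<mu> R]])
    then have "isCont (eta_quot \<mu>) (eta \<tau> z)"
      using open_D \<tau> by (simp add: continuous_on_eq_continuous_at open_Un)
    then have "(\<lambda>n. z * eta_quot \<mu> (eta (d n) z)) \<longlonglongrightarrow> z * eta_quot \<mu> (eta \<tau> z)"
      by (intro tendsto_mult tendsto_const isCont_tendsto_compose[OF _ d])
    then show "(\<lambda>n. eta (c (Suc n)) z) \<longlonglongrightarrow> z * eta_quot \<mu> (eta \<tau> z)" by (simp only: rec)
  qed
  have \<sigma>1_eq: "eta \<sigma>1 z = z * eta_quot \<mu>1 (eta \<sigma>2 z)" if z: "z \<in> D" for z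
  proof (rule limit_eq[OF \<mu>1(1) z \<sigma>1(5)[OF z] \<sigma>2(5)[OF z] in_D(2)[OF z]])
    show "eta (a (Suc n)) z = z * eta_quot \<mu>1 (eta (b n) z)" for n
      using orth_conv_props(3)[OF \<mu>1(1,3) prob_on_S[OF b(1)] b(2) z, of n] by (simp add: a_def b_def)
  qed
  have \<sigma>2_eq: "eta \<sigma>2 z = z * eta_quot \<mu>2 (eta \<sigma>1 z)" if z: "z \<in> D" for z
  proof (rule limit_eq[OF \<mu>2(1) z \<sigma>2(5)[OF z] \<sigma>1(5)[OF z] in_D(1)[OF z]])
    show "eta (b (Suc n)) z = z * eta_quot \<mu>2 (eta (a n) z)" for n
      using orth_conv_props(3)[OF \<mu>2(1,3) prob_on_S[OF a(1)] a(2) z, of n] by (simp add: a_def b_def)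
  qed
  have \<nu>_eq1: "eta \<nu> z = eta \<mu>1 (eta \<sigma>2 z)" if z: "z \<in> D" for z
  proof (rule LIMSEQ_unique[OF \<nu>(4)[OF z]])
    have "continuous_on (D \<union> ball 0 (1 / (3 * R))) (eta \<mu>1)"
      by (rule holomorphic_on_imp_continuous_on[OF eta_holomorphic_SR[OF \<mu>1(1) R]])
    then have "isCont (eta \<mu>1) (eta \<sigma>2 z)"
      using open_D in_D(2)[OF z] by (simp add: continuous_on_eq_continuous_at open_Un)
    then show "(\<lambda>n. eta (l n) z) \<longlonglongrightarrow> eta \<mu>1 (eta \<sigma>2 z)"
      unfolding l_eta[OF z] by (rule isCont_tendsto_compose[OF _ \<sigma>2(5)[OF z]])
  qed
  \<comment> \<open>At \<open>w = eta \<sigma>2 z\<close> one has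
    \<open>eta \<mu>1 w = w * eta_quot \<mu>1 w\<close>, and \<open>z\<close> times the quotient is
    \<open>eta \<sigma>1 z\<close>.\<close>
  have \<nu>_eq3: "z * eta \<nu> z = eta \<sigma>1 z * eta \<sigma>2 z" if z: "z \<in> D" for z
  proof -
    have "z * eta \<nu> z = (z * eta_quot \<mu>1 (eta \<sigma>2 z)) * eta \<sigma>2 z"
      unfolding \<nu>_eq1[OF z] eta_eq_quot[of \<mu>1 "eta \<sigma>2 z"] by (simp add: mult_ac)
    then show ?thesis by (simp only: \<sigma>1_eq[OF z, symmetric])
  qed
  have \<nu>_eq2: "eta \<nu> z = eta \<mu>2 (eta \<sigma>1 z)" if z: "z \<in> D" for z
  \<comment> \<open>The factor \<open>z\<close> is cancelled from the symmetric product identity; at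
    \<open>0\<close>, a point of the disc, both sides vanish.\<close>
  proof (cases "z = 0")
    case False
    have "z * eta \<mu>2 (eta \<sigma>1 z) = eta \<sigma>1 z * (z * eta_quot \<mu>2 (eta \<sigma>1 z))"
      unfolding eta_eq_quot[of \<mu>2 "eta \<sigma>1 z"] by (simp add: mult_ac)
    also have "\<dots> = z * eta \<nu> z" unfolding \<sigma>2_eq[OF z, symmetric] \<nu>_eq3[OF z] ..
    finally show ?thesis using False by simp
  qed simp
  have f1: "eta_fps \<nu> = eta_fps \<mu>1 oo eta_fps \<sigma>2" and f2: "eta_fps \<nu> = eta_fps \<mu>2 oo eta_fps \<sigma>1"
    using eta_fps_compose[OF \<nu>(1) \<sigma>2(1) has_fps_expansion_1 eta_fps_expansion[OF \<mu>1(1)]] \<nu>_eq1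
      eta_fps_compose[OF \<nu>(1) \<sigma>1(1) has_fps_expansion_1 eta_fps_expansion[OF \<mu>2(1)]] \<nu>_eq2 by simp_all
  have f3: "fps_X * eta_fps \<nu> = eta_fps \<sigma>1 * eta_fps \<sigma>2"
  proof (rule fps_eq_negative)
    show "(\<lambda>z. z * eta \<nu> z) has_fps_expansion fps_X * eta_fps \<nu>"
      by (intro has_fps_expansion_mult has_fps_expansion_fps_X eta_fps_expansion[OF \<nu>(1)])
    show "(\<lambda>z. eta \<sigma>1 z * eta \<sigma>2 z) has_fps_expansion eta_fps \<sigma>1 * eta_fps \<sigma>2"
      by (intro has_fps_expansion_mult eta_fps_expansion[OF \<sigma>1(1)] eta_fps_expansion[OF \<sigma>2(1)])
  qed (use \<nu>_eq3 neg_D in auto)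
  have free: "free_conv S \<mu>1 \<mu>2 = \<nu>"
    by (rule free_conv_eqI[OF \<mu>1(1,2) \<mu>2(1,2) \<sigma>1(1) \<sigma>_mom(1) \<sigma>2(1) \<sigma>_mom(2) \<nu>(1) f1 f2 f3])
  have "(THE (\<tau>1, \<tau>2). prob_on S \<tau>1 \<and> \<tau>1 \<noteq> delta0 \<and> prob_on S \<tau>2 \<and> \<tau>2 \<noteq> delta0 \<and>
       (\<forall>z\<in>D. eta (free_conv S \<mu>1 \<mu>2) z = eta \<mu>1 (eta \<tau>2 z) \<and>
              eta (free_conv S \<mu>1 \<mu>2) z = eta \<mu>2 (eta \<tau>1 z))) = (\<sigma>1, \<sigma>2)"
    unfolding free
  proof (rule the_equality)
    show "case (\<sigma>1, \<sigma>2) of (\<tau>1, \<tau>2) \<Rightarrow> prob_on S \<tau>1 \<and> \<tau>1 \<noteq> delta0 \<and> prob_on S \<tau>2 \<and> \<tau>2 \<noteq> delta0 \<and>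
       (\<forall>z\<in>D. eta \<nu> z = eta \<mu>1 (eta \<tau>2 z) \<and> eta \<nu> z = eta \<mu>2 (eta \<tau>1 z))"
      using prob_on_S[OF \<sigma>1(1)] prob_on_S[OF \<sigma>2(1)] \<sigma>_ne \<nu>_eq1 \<nu>_eq2 by simp
  next
    fix p assume hp: "case p of (\<tau>1, \<tau>2) \<Rightarrow> prob_on S \<tau>1 \<and> \<tau>1 \<noteq> delta0 \<and> prob_on S \<tau>2 \<and> \<tau>2 \<noteq> delta0 \<and>
       (\<forall>z\<in>D. eta \<nu> z = eta \<mu>1 (eta \<tau>2 z) \<and> eta \<nu> z = eta \<mu>2 (eta \<tau>1 z))"
    obtain \<tau>1 \<tau>2 where p: "p = (\<tau>1, \<tau>2)" by (cases p)
    have h: "prob_on S \<tau>1 \<and> \<tau>1 \<noteq> delta0 \<and> prob_on S \<tau>2 \<and> \<tau>2 \<noteq> delta0 \<and>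
       (\<forall>z\<in>D. eta \<nu> z = eta \<mu>1 (eta \<tau>2 z) \<and> eta \<nu> z = eta \<mu>2 (eta \<tau>1 z))"
      by (rule hp[unfolded p prod.case])
    then have \<tau>_eq: "\<forall>z\<in>D. eta \<nu> z = eta \<mu>1 (eta \<tau>2 z) \<and> eta \<nu> z = eta \<mu>2 (eta \<tau>1 z)"
      by (elim conjE)
    have \<tau>: "prob_on S \<tau>1" "\<tau>1 \<noteq> delta0" "prob_on S \<tau>2" "\<tau>2 \<noteq> delta0"
      using h by simp_all
    have "\<tau>1 = \<sigma>1"
      using \<tau>_eq \<nu>_eq2
      by (intro eta_injective_near_0[OF \<mu>2(1) R \<mu>2(2) \<tau>(1,2) prob_on_S[OF \<sigma>1(1)] \<sigma>_ne(1)]) metis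
    moreover have "\<tau>2 = \<sigma>2"
      using \<tau>_eq \<nu>_eq1
      by (intro eta_injective_near_0[OF \<mu>1(1) R \<mu>1(2) \<tau>(3,4) prob_on_S[OF \<sigma>2(1)] \<sigma>_ne(2)]) metis
    ultimately show "p = (\<sigma>1, \<sigma>2)" by (simp add: p)
  qed
  then have sfree: "sfree_conv S D \<mu>1 \<mu>2 = \<sigma>1"
    by (simp add: sfree_conv_def)
  show "weakly_converges (\<lambda>n. orth_iter S D n \<mu>1 \<mu>2) (sfree_conv S D \<mu>1 \<mu>2)"
    "eta_converges D (\<lambda>n. orth_iter S D n \<mu>1 \<mu>2) (sfree_conv S D \<mu>1 \<mu>2)"
    using \<sigma>1(2,3) by (simp_all add: sfree a_def[abs_def])
  show "weakly_converges (\<lambda>n. monotone_conv S D \<mu>1 (orth_iter S D n \<mu>2 \<mu>1)) (free_conv S \<mu>1 \<mu>2)"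
    "eta_converges D (\<lambda>n. monotone_conv S D \<mu>1 (orth_iter S D n \<mu>2 \<mu>1)) (free_conv S \<mu>1 \<mu>2)"
    using \<nu>(2,3) by (simp_all add: free l_def[abs_def] b_def)
qed

end

section \<open>The two settings\<close>

lemma not_prob_on_empty: "\<not> prob_on {} \<mu>"
  using prob_space.AE_False by (auto simp: prob_on_def)

section \<open>The half-line as an instance\<close>

lemma slit_class_cong:
  assumes "slit_class f" "\<And>z. z \<notin> \<real>\<^sub>\<ge>\<^sub>0 \<Longrightarrow> f z = g z"
  shows "slit_class g"
  unfolding slit_class_def
proof (intro conjI)
  show "g holomorphic_on - \<real>\<^sub>\<ge>\<^sub>0"
    using assms by (auto simp: slit_class_def intro: holomorphic_transform)
  show "\<forall>z\<in>- \<real>\<^sub>\<ge>\<^sub>0. \<exists>s t. s \<ge> 0 \<and> t \<ge> 0 \<and> s + t > 0 \<and> g z = of_real s * z - of_real t"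
    using assms by (auto simp: slit_class_def)
  have "eventually (\<lambda>z. f z = g z) (at 0 within of_real ` {..<0})"
    unfolding eventually_at_filter
    using assms(2) half_line_neg_notin by (intro always_eventually) auto
  moreover have "(f \<longlongrightarrow> 0) (at 0 within of_real ` {..<0})" using assms(1) by (simp add: slit_class_def)
  ultimately show "(g \<longlongrightarrow> 0) (at 0 within of_real ` {..<0})" by (rule Lim_transform_eventually[rotated])
qed

lemma slit_class_orth_eta:
  assumes \<mu>: "prob_on (\<real>\<^sub>\<ge>\<^sub>0 \<inter> cball 0 R) \<mu>" "\<mu> \<noteq> delta0" and g: "slit_class g"
  shows "slit_class (\<lambda>z. z * eta_quot \<mu> (g z))"
proof (rule slit_class_cong)
  have \<mu>S: "prob_on \<real>\<^sub>\<ge>\<^sub>0 \<mu>" using \<mu>(1) by (rule prob_on_mono) auto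
  define B where "B = 3 * max R 1"
  have bound: "norm (eta \<mu> w / w) \<le> B" if "norm w < 1 / B" "w \<noteq> 0" for w
  proof -
    have "norm (eta \<mu> w) \<le> 3 * max R 1 * norm w"
      using that by (intro prob_on_cball_eta(3)[OF \<mu>(1)]) (auto simp: B_def)
    then show ?thesis using that by (simp add: B_def norm_divide divide_le_eq)
  qed
  have "B > 0" by (simp add: B_def)
  then have "eventually (\<lambda>w. norm (eta \<mu> w / w) \<le> B) (at 0 within of_real ` {..<0})"
    unfolding eventually_at using bound by (intro exI[of _ "1 / B"]) auto
  then show "slit_class (\<lambda>z. z * (eta \<mu> (g z) / g z))"
    by (rule slit_class_orth[OF slit_class_eta[OF \<mu>S \<mu>(2)] g])
  show "z * (eta \<mu> (g z) / g z) = z * eta_quot \<mu> (g z)" if "z \<notin> \<real>\<^sub>\<ge>\<^sub>0" for z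
    using slit_class_notin[OF g that] by (auto simp: eta_quot_def)
qed

lemma half_line_Helly:
  assumes M: "\<And>n :: nat. prob_on (\<real>\<^sub>\<ge>\<^sub>0 \<inter> cball 0 R) (M n)"
  shows "\<exists>r N. strict_mono r \<and> prob_on (\<real>\<^sub>\<ge>\<^sub>0 \<inter> cball 0 R) N \<and> weakly_converges (M \<circ> r) N"
proof -
  have "\<real>\<^sub>\<ge>\<^sub>0 \<inter> cball (0 :: complex) R \<noteq> {}" using M[of 0] not_prob_on_empty by metis
  then have R: "R \<ge> 0" by auto
  let ?p = "\<lambda>x. complex_of_real (max 0 (min R x))"
  obtain r N where "strict_mono r" "prob_on (\<real>\<^sub>\<ge>\<^sub>0 \<inter> cball 0 R) N" "weakly_converges (M \<circ> r) N"
  proof (rule prob_on_Helly[of ?p "\<real>\<^sub>\<ge>\<^sub>0 \<inter> cball 0 R" Re "- 1" R M])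
    show "continuous_on UNIV ?p" by (intro continuous_intros)
    show "?p x \<in> \<real>\<^sub>\<ge>\<^sub>0 \<inter> cball 0 R" for x using R by auto
    show "closed (\<real>\<^sub>\<ge>\<^sub>0 \<inter> cball (0 :: complex) R)" by (intro closed_Int closed_nonneg_Reals_complex closed_cball)
    show "Re \<in> borel_measurable borel" by measurable
    fix t :: complex assume t: "t \<in> \<real>\<^sub>\<ge>\<^sub>0 \<inter> cball 0 R"
    then have Re: "0 \<le> Re t" "Re t \<le> R" using half_line_norm(2,3)[of t] by auto
    then show "- 1 < Re t \<and> Re t \<le> R" by simp
    show "?p (Re t) = t" using Re half_line_norm(1)[of t] t by simp
  qed (use M in auto)
  then show ?thesis by blast
qed

interpretation half_line: eta_setting "\<real>\<^sub>\<ge>\<^sub>0" "- \<real>\<^sub>\<ge>\<^sub>0" slit_class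
proof
  show "closed (\<real>\<^sub>\<ge>\<^sub>0 :: complex set)" by (rule closed_nonneg_Reals_complex)
  show "\<exists>k b. \<forall>t\<in>\<real>\<^sub>\<ge>\<^sub>0. t ^ i * cnj t ^ j = (if b then t ^ k else cnj (t ^ k))" for i j
  proof (intro exI[of _ "i + j"] exI[of _ True] ballI)
    fix t :: complex assume "t \<in> \<real>\<^sub>\<ge>\<^sub>0"
    then have "cnj t = t" by (simp add: complex_nonneg_Reals_iff complex_eq_iff)
    then show "t ^ i * cnj t ^ j = (if True then t ^ (i + j) else cnj (t ^ (i + j)))"
      by (simp add: power_add)
  qed
  show "open (- \<real>\<^sub>\<ge>\<^sub>0 :: complex set)" "connected (- \<real>\<^sub>\<ge>\<^sub>0 :: complex set)"
    by (rule open_slit connected_slit)+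
  show "complex_of_real x \<in> - \<real>\<^sub>\<ge>\<^sub>0" if "x < 0" for x
    using that by (simp add: complex_nonneg_Reals_iff)
  show "regular_at \<real>\<^sub>\<ge>\<^sub>0 z" if "z \<in> - \<real>\<^sub>\<ge>\<^sub>0" for z
    using that by (intro regular_at_half_line) simp
  show "phi \<mu> z \<noteq> 0" if "prob_on \<real>\<^sub>\<ge>\<^sub>0 \<mu>" "z \<in> - \<real>\<^sub>\<ge>\<^sub>0" for \<mu> z
    using that by (intro phi_half_line_nonzero) simp_all
  show "\<mu> = \<nu>" if "prob_on \<real>\<^sub>\<ge>\<^sub>0 \<mu>" "prob_on \<real>\<^sub>\<ge>\<^sub>0 \<nu>" "\<And>z. z \<in> - \<real>\<^sub>\<ge>\<^sub>0 \<Longrightarrow> eta \<mu> z = eta \<nu> z" for \<mu> \<nu>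
    by (rule half_line_eta_determines[OF that(1,2)]) (use that(3) in simp)
  show "slit_class (eta \<mu>)" if "prob_on \<real>\<^sub>\<ge>\<^sub>0 \<mu>" "\<mu> \<noteq> delta0" for \<mu>
    using that by (rule slit_class_eta)
  show "\<exists>\<nu>. prob_on \<real>\<^sub>\<ge>\<^sub>0 \<nu> \<and> \<nu> \<noteq> delta0 \<and> (\<forall>z\<in>- \<real>\<^sub>\<ge>\<^sub>0. eta \<nu> z = f z)" if "slit_class f" for f
    using that by (rule slit_class_realize)
  show "f z \<in> - \<real>\<^sub>\<ge>\<^sub>0" if "slit_class f" "z \<in> - \<real>\<^sub>\<ge>\<^sub>0" for f z
    using slit_class_notin[OF that(1)] that(2) by simp
  show "slit_class (\<lambda>z. f (g z))" if "slit_class f" "slit_class g" for f g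
    using that by (rule slit_class_comp)
  show "slit_class (\<lambda>z. z * eta_quot \<mu> (g z))"
    if "prob_on (\<real>\<^sub>\<ge>\<^sub>0 \<inter> cball 0 R) \<mu>" "\<mu> \<noteq> delta0" "slit_class g" for R \<mu> g
    using that by (rule slit_class_orth_eta)
  show "(f \<longlongrightarrow> 0) (at 0 within complex_of_real ` {- 1<..<0})" if "slit_class f" for f
    by (rule tendsto_within_subset[of _ _ _ "of_real ` {..<0}"]) (use that in \<open>auto simp: slit_class_def\<close>)
  show "\<exists>R. \<forall>\<nu> F. prob_on \<real>\<^sub>\<ge>\<^sub>0 \<nu> \<longrightarrow> F holomorphic_on ball 0 r \<longrightarrow>
       (\<forall>z\<in>ball 0 r. norm (F z) \<le> 1 / 2) \<longrightarrow> (\<forall>z\<in>- \<real>\<^sub>\<ge>\<^sub>0 \<inter> ball 0 r. eta \<nu> z = F z) \<longrightarrow>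
       prob_on (\<real>\<^sub>\<ge>\<^sub>0 \<inter> cball 0 R) \<nu>" if "r > 0" for r
  proof (intro exI[of _ "8 / r"] allI impI)
    fix \<nu> F assume "prob_on \<real>\<^sub>\<ge>\<^sub>0 \<nu>" "F holomorphic_on ball 0 r"
      "\<forall>z\<in>ball 0 r. norm (F z) \<le> 1 / 2" "\<forall>z\<in>- \<real>\<^sub>\<ge>\<^sub>0 \<inter> ball 0 r. eta \<nu> z = F z"
    then show "prob_on (\<real>\<^sub>\<ge>\<^sub>0 \<inter> cball 0 (8 / r)) \<nu>"
      by (intro half_line_support[of \<nu> r F] that) auto
  qed
  show "\<exists>r N. strict_mono r \<and> prob_on (\<real>\<^sub>\<ge>\<^sub>0 \<inter> cball 0 R) N \<and> weakly_converges (M \<circ> r) N"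
    if "\<And>n. prob_on (\<real>\<^sub>\<ge>\<^sub>0 \<inter> cball 0 R) (M n)" for R and M :: "nat \<Rightarrow> complex measure"
    using that by (rule half_line_Helly)
qed

section \<open>The circle as an instance\<close>

lemma sphere_mixed_power:
  "\<exists>k b. \<forall>t\<in>sphere 0 1. t ^ i * cnj t ^ j = (if b then t ^ k else cnj (t ^ k))"
proof (cases "j \<le> i")
  case True
  have "t ^ i * cnj t ^ j = t ^ (i - j)" if "t \<in> sphere 0 1" for t
  proof -
    have "t * cnj t = 1" using that by (simp add: complex_norm_square[symmetric])
    moreover have "t ^ i = t ^ (i - j) * t ^ j" using True by (simp flip: power_add)
    ultimately show ?thesis by (simp add: mult.assoc flip: power_mult_distrib)
  qed
  then show ?thesis by (intro exI[of _ "i - j"] exI[of _ True]) simp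
next
  case False
  have "t ^ i * cnj t ^ j = cnj (t ^ (j - i))" if "t \<in> sphere 0 1" for t
  proof -
    have "t * cnj t = 1" using that by (simp add: complex_norm_square[symmetric])
    moreover have "cnj t ^ j = cnj t ^ i * cnj t ^ (j - i)" using False by (simp flip: power_add)
    ultimately show ?thesis by (simp add: mult.assoc[symmetric] flip: power_mult_distrib)
  qed
  then show ?thesis by (intro exI[of _ "j - i"] exI[of _ False]) simp
qed

text \<open>The disc contains \<open>0\<close>, so the transform yields all moments, and on the
  circle every mixed moment is a moment or the conjugate of one.\<close>

lemma sphere_eta_determines:
  assumes \<mu>: "prob_on (sphere 0 1) \<mu>" and \<nu>: "prob_on (sphere 0 1) \<nu>"
    and eq: "\<And>z. norm z < 1 \<Longrightarrow> eta \<mu> z = eta \<nu> z"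
  shows "\<mu> = \<nu>"
proof -
  have "eventually (\<lambda>h :: complex. h \<in> ball 0 1) (nhds 0)"
    by (intro eventually_nhds_in_open) auto
  then have "eventually (\<lambda>h. phi \<mu> (0 + h) = phi \<nu> (0 + h)) (nhds 0)"
  proof eventually_elim
    case (elim h)
    then have h: "norm h < 1" by simp
    have "1 / phi \<mu> h = 1 / phi \<nu> h"
      using eq[OF h] eta_eq_phi[OF \<mu> regular_at_sphere[OF h] phi_sphere_nonzero[OF \<mu> h]]
        eta_eq_phi[OF \<nu> regular_at_sphere[OF h] phi_sphere_nonzero[OF \<nu> h]] by simp
    then have "inverse (phi \<mu> h) = inverse (phi \<nu> h)" by (simp add: inverse_eq_divide)
    then show ?case by simp
  qed
  then have mom: "moment \<mu> = moment \<nu>"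
    using phi_coeff_eqI[OF \<mu> \<nu>, of 0] regular_at_sphere[of 0] by (simp add: phi_coeff_0)
  show ?thesis
  proof (rule eqI_mixed_moments[OF _ \<mu> \<nu>])
    fix i j
    obtain k b where kb: "\<forall>t\<in>sphere 0 1. t ^ i * cnj t ^ j = (if b then t ^ k else cnj (t ^ k))"
      using sphere_mixed_power[of i j] by (elim exE) (rule that)
    show "(LINT t|\<mu>. t ^ i * cnj t ^ j) = (LINT t|\<nu>. t ^ i * cnj t ^ j)"
      unfolding mixed_moment_eq[OF kb \<mu>] mixed_moment_eq[OF kb \<nu>] mom ..
  qed simp
qed

lemma prob_on_sphere_ne_delta0: "prob_on (sphere 0 1) \<mu> \<Longrightarrow> \<mu> \<noteq> delta0"
  by (auto simp: prob_on_def AE_return)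

text \<open>Schwarz's lemma bounds the quotient by \<open>1\<close>, including its value at
  \<open>0\<close>, which is the derivative.\<close>

lemma disc_class_orth_eta:
  assumes \<mu>: "prob_on (sphere 0 1) \<mu>" and g: "disc_class g"
  shows "disc_class (\<lambda>z. z * eta_quot \<mu> (g z))"
proof -
  have hol: "eta \<mu> holomorphic_on ball 0 1" and le: "\<And>z. norm z < 1 \<Longrightarrow> norm (eta \<mu> z) \<le> norm z"
    using disc_class_eta[OF \<mu>] by (auto simp: disc_class_def)
  have "(\<lambda>z. if z = 0 then deriv (eta \<mu>) 0 else (eta \<mu> z - eta \<mu> 0) / (z - 0)) holomorphic_on ball 0 1"
    by (intro pole_lemma_open hol) auto
  then have q: "eta_quot \<mu> holomorphic_on ball 0 1"
    by (rule holomorphic_transform) (auto simp: eta_quot_def)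
  have q1: "norm (eta_quot \<mu> w) \<le> 1" if "norm w < 1" for w
  proof (cases "w = 0")
    case True
    have "norm (deriv (eta \<mu>) 0) \<le> 1"
    proof (rule Schwarz_Lemma(2)[OF hol eta_0])
      show "norm (eta \<mu> z) < 1" if "norm z < 1" for z using le[OF that] that by simp
      show "norm (0 :: complex) < 1" by simp
    qed
    then show ?thesis using True by (simp add: eta_quot_def)
  next
    case False
    then show ?thesis using le[OF that] by (simp add: eta_quot_def norm_divide divide_le_eq)
  qed
  have g1: "g holomorphic_on ball 0 1" "norm (g z) < 1" if "norm z < 1" for z
    using g that by (force simp: disc_class_def)+
  have "(eta_quot \<mu> \<circ> g) holomorphic_on ball 0 1"
    using g g1(2) by (intro holomorphic_on_compose_gen[OF _ q]) (auto simp: disc_class_def)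
  then have "(\<lambda>z. z * eta_quot \<mu> (g z)) holomorphic_on ball 0 1"
    by (intro holomorphic_intros) (simp add: comp_def)
  moreover have "norm (z * eta_quot \<mu> (g z)) \<le> norm z" if "norm z < 1" for z
    using mult_left_mono[OF q1[OF g1(2)[OF that]] norm_ge_zero[of z]] by (simp add: norm_mult)
  ultimately show ?thesis by (simp add: disc_class_def)
qed

interpretation circle: eta_setting "sphere 0 1" "ball 0 1" disc_class
proof
  have sub: "prob_on (sphere 0 1) \<mu>" if "prob_on (sphere 0 1 \<inter> cball 0 R) \<mu>" for \<mu> R
    using that by (rule prob_on_mono) auto
  show "\<exists>k b. \<forall>t\<in>sphere 0 1. t ^ i * cnj t ^ j = (if b then t ^ k else cnj (t ^ k))" for i j
    by (rule sphere_mixed_power)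
  show "regular_at (sphere 0 1) z" if "z \<in> ball 0 1" for z
    using that by (intro regular_at_sphere) simp
  show "phi \<mu> z \<noteq> 0" if "prob_on (sphere 0 1) \<mu>" "z \<in> ball 0 1" for \<mu> z
    using that by (intro phi_sphere_nonzero) simp_all
  show "\<mu> = \<nu>" if "prob_on (sphere 0 1) \<mu>" "prob_on (sphere 0 1) \<nu>" "\<And>z. z \<in> ball 0 1 \<Longrightarrow> eta \<mu> z = eta \<nu> z" for \<mu> \<nu>
    by (rule sphere_eta_determines[OF that(1,2)]) (use that(3) in simp)
  show "disc_class (eta \<mu>)" if "prob_on (sphere 0 1) \<mu>" for \<mu>
    using that by (rule disc_class_eta)
  show "\<exists>\<nu>. prob_on (sphere 0 1) \<nu> \<and> \<nu> \<noteq> delta0 \<and> (\<forall>z\<in>ball 0 1. eta \<nu> z = f z)" if "disc_class f" for f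
    using disc_class_realize[OF that] prob_on_sphere_ne_delta0 by metis
  show "f z \<in> ball 0 1" if "disc_class f" "z \<in> ball 0 1" for f z
    using that unfolding disc_class_def by force
  show "disc_class (\<lambda>z. f (g z))" if "disc_class f" "disc_class g" for f g
    using that by (rule disc_class_comp)
  show "disc_class (\<lambda>z. z * eta_quot \<mu> (g z))" if "prob_on (sphere 0 1 \<inter> cball 0 R) \<mu>" "disc_class g" for R \<mu> g
    using sub[OF that(1)] that(2) by (rule disc_class_orth_eta)
  show "(f \<longlongrightarrow> 0) (at 0 within complex_of_real ` {- 1<..<0})" if "disc_class f" for f
  proof (rule Lim_null_comparison)
    show "eventually (\<lambda>z. norm (f z) \<le> norm z) (at 0 within complex_of_real ` {- 1<..<0})"
      unfolding eventually_at using that by (intro exI[of _ 1]) (auto simp: disc_class_def)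
    show "(norm \<longlongrightarrow> 0) (at (0 :: complex) within complex_of_real ` {- 1<..<0})"
      by (rule tendsto_norm_zero) (rule tendsto_ident_at)
  qed
  \<comment> \<open>The circle is bounded, so \<open>R = 1\<close> confines all supports.\<close>
  show "\<exists>R. \<forall>\<nu> F. prob_on (sphere 0 1) \<nu> \<longrightarrow> F holomorphic_on ball 0 r \<longrightarrow>
       (\<forall>z\<in>ball 0 r. norm (F z) \<le> 1 / 2) \<longrightarrow> (\<forall>z\<in>ball 0 1 \<inter> ball 0 r. eta \<nu> z = F z) \<longrightarrow>
       prob_on (sphere 0 1 \<inter> cball 0 R) \<nu>" for r :: real
    by (intro exI[of _ 1] allI impI) (auto elim: prob_on_mono)
  show "\<exists>r N. strict_mono r \<and> prob_on (sphere 0 1 \<inter> cball 0 R) N \<and> weakly_converges (M \<circ> r) N"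
    if M: "\<And>n. prob_on (sphere 0 1 \<inter> cball 0 R) (M n)" for R and M :: "nat \<Rightarrow> complex measure"
  proof -
    \<comment> \<open>A set carrying a probability measure is nonempty, which forces
      \<open>R \<ge> 1\<close>, so the intersection is the whole circle.\<close>
    have "sphere 0 1 \<inter> cball (0 :: complex) R \<noteq> {}" using M[of 0] not_prob_on_empty by metis
    then have eq: "sphere 0 1 \<inter> cball (0 :: complex) R = sphere 0 1" by auto
    obtain r N where "strict_mono r" "prob_on (sphere 0 1) N" "weakly_converges (M \<circ> r) N"
      by (rule sphere_Helly[of M]) (use M eq in auto)
    then show ?thesis unfolding eq by blast
  qed
qed (auto simp: connected_ball)

theorem corollary8p2:
  shows
    "(\<forall>\<mu>1 \<mu>2 S D. S = \<real>\<^sub>\<ge>\<^sub>0 \<and> D = - \<real>\<^sub>\<ge>\<^sub>0 \<and>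
        prob_on S \<mu>1 \<and> compactly_supported \<mu>1 \<and> \<mu>1 \<noteq> delta0 \<and>
        prob_on S \<mu>2 \<and> compactly_supported \<mu>2 \<and> \<mu>2 \<noteq> delta0 \<longrightarrow>
        weakly_converges (\<lambda>n. orth_iter S D n \<mu>1 \<mu>2) (sfree_conv S D \<mu>1 \<mu>2) \<and>
        weakly_converges (\<lambda>n. monotone_conv S D \<mu>1 (orth_iter S D n \<mu>2 \<mu>1)) (free_conv S \<mu>1 \<mu>2) \<and>
        eta_converges D (\<lambda>n. orth_iter S D n \<mu>1 \<mu>2) (sfree_conv S D \<mu>1 \<mu>2) \<and>
        eta_converges D (\<lambda>n. monotone_conv S D \<mu>1 (orth_iter S D n \<mu>2 \<mu>1)) (free_conv S \<mu>1 \<mu>2)) \<and>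
     (\<forall>\<mu>1 \<mu>2 S D. S = sphere 0 1 \<and> D = ball 0 1 \<and>
        prob_on S \<mu>1 \<and> (LINT t|\<mu>1. t) \<noteq> 0 \<and>
        prob_on S \<mu>2 \<and> (LINT t|\<mu>2. t) \<noteq> 0 \<longrightarrow>
        weakly_converges (\<lambda>n. orth_iter S D n \<mu>1 \<mu>2) (sfree_conv S D \<mu>1 \<mu>2) \<and>
        weakly_converges (\<lambda>n. monotone_conv S D \<mu>1 (orth_iter S D n \<mu>2 \<mu>1)) (free_conv S \<mu>1 \<mu>2) \<and>
        eta_converges D (\<lambda>n. orth_iter S D n \<mu>1 \<mu>2) (sfree_conv S D \<mu>1 \<mu>2) \<and>
        eta_converges D (\<lambda>n. monotone_conv S D \<mu>1 (orth_iter S D n \<mu>2 \<mu>1)) (free_conv S \<mu>1 \<mu>2))"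
proof (rule conjI; intro allI impI; elim conjE)
  fix \<mu>1 \<mu>2 :: "complex measure" and S D :: "complex set"
  assume SD: "S = \<real>\<^sub>\<ge>\<^sub>0" "D = - \<real>\<^sub>\<ge>\<^sub>0"
    and \<mu>1: "prob_on S \<mu>1" "compactly_supported \<mu>1" "\<mu>1 \<noteq> delta0"
    and \<mu>2: "prob_on S \<mu>2" "compactly_supported \<mu>2" "\<mu>2 \<noteq> delta0"
  \<comment> \<open>Stated for all larger radii so that both measures can share a single
    \<open>R \<ge> 1\<close>.\<close>
  have bounded: "\<exists>R. \<forall>R'\<ge>R. prob_on (\<real>\<^sub>\<ge>\<^sub>0 \<inter> cball 0 R') \<mu>"
    if \<mu>: "prob_on \<real>\<^sub>\<ge>\<^sub>0 \<mu>" "compactly_supported \<mu>" for \<mu>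
  proof -
    obtain K where K: "compact K" "AE t in \<mu>. t \<in> K"
      using \<mu>(2) by (auto simp: compactly_supported_def)
    obtain R where R: "\<forall>t\<in>K. norm t \<le> R"
      using compact_imp_bounded[OF K(1)] by (auto simp: bounded_iff)
    have "prob_on (\<real>\<^sub>\<ge>\<^sub>0 \<inter> cball 0 R') \<mu>" if "R' \<ge> R" for R'
      using prob_on_IntI[OF \<mu>(1) K(2)] by (rule prob_on_mono) (use R that in force)
    then show ?thesis by blast
  qed
  obtain R1 where R1: "\<forall>R'\<ge>R1. prob_on (\<real>\<^sub>\<ge>\<^sub>0 \<inter> cball 0 R') \<mu>1"
    using bounded[OF \<mu>1(1,2)[unfolded SD]] by (elim exE) (rule that)
  obtain R2 where R2: "\<forall>R'\<ge>R2. prob_on (\<real>\<^sub>\<ge>\<^sub>0 \<inter> cball 0 R') \<mu>2"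
    using bounded[OF \<mu>2(1,2)[unfolded SD]] by (elim exE) (rule that)
  define R where "R = max 1 (max R1 R2)"
  have R: "R \<ge> 1" and p: "prob_on (\<real>\<^sub>\<ge>\<^sub>0 \<inter> cball 0 R) \<mu>1" "prob_on (\<real>\<^sub>\<ge>\<^sub>0 \<inter> cball 0 R) \<mu>2"
    using R1 R2 by (simp_all add: R_def)
  show "weakly_converges (\<lambda>n. orth_iter S D n \<mu>1 \<mu>2) (sfree_conv S D \<mu>1 \<mu>2) \<and>
        weakly_converges (\<lambda>n. monotone_conv S D \<mu>1 (orth_iter S D n \<mu>2 \<mu>1)) (free_conv S \<mu>1 \<mu>2) \<and>
        eta_converges D (\<lambda>n. orth_iter S D n \<mu>1 \<mu>2) (sfree_conv S D \<mu>1 \<mu>2) \<and>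
        eta_converges D (\<lambda>n. monotone_conv S D \<mu>1 (orth_iter S D n \<mu>2 \<mu>1)) (free_conv S \<mu>1 \<mu>2)"
    unfolding SD
    by (intro conjI half_line.iteration_converges[OF p(1) half_line_moment_1_nonzero[OF p(1) \<mu>1(3)] \<mu>1(3)
          p(2) half_line_moment_1_nonzero[OF p(2) \<mu>2(3)] \<mu>2(3) R])
next
  fix \<mu>1 \<mu>2 :: "complex measure" and S D :: "complex set"
  assume SD: "S = sphere 0 1" "D = ball 0 1"
    and \<mu>1: "prob_on S \<mu>1" "(LINT t|\<mu>1. t) \<noteq> 0" and \<mu>2: "prob_on S \<mu>2" "(LINT t|\<mu>2. t) \<noteq> 0"
  have p: "prob_on (sphere 0 1 \<inter> cball 0 1) \<mu>1" "prob_on (sphere 0 1 \<inter> cball 0 1) \<mu>2"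
    using \<mu>1(1) \<mu>2(1) unfolding SD by (auto elim: prob_on_mono)
  have m: "moment \<mu>1 1 \<noteq> 0" "moment \<mu>2 1 \<noteq> 0" using \<mu>1(2) \<mu>2(2) by (simp_all add: moment_def)
  have ne: "\<mu>1 \<noteq> delta0" "\<mu>2 \<noteq> delta0"
    using prob_on_sphere_ne_delta0 \<mu>1(1) \<mu>2(1) unfolding SD by blast+
  show "weakly_converges (\<lambda>n. orth_iter S D n \<mu>1 \<mu>2) (sfree_conv S D \<mu>1 \<mu>2) \<and>
        weakly_converges (\<lambda>n. monotone_conv S D \<mu>1 (orth_iter S D n \<mu>2 \<mu>1)) (free_conv S \<mu>1 \<mu>2) \<and>
        eta_converges D (\<lambda>n. orth_iter S D n \<mu>1 \<mu>2) (sfree_conv S D \<mu>1 \<mu>2) \<and>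
        eta_converges D (\<lambda>n. monotone_conv S D \<mu>1 (orth_iter S D n \<mu>2 \<mu>1)) (free_conv S \<mu>1 \<mu>2)"
    unfolding SD
    by (intro conjI circle.iteration_converges[OF p(1) m(1) ne(1) p(2) m(2) ne(2)]) simp_all
qed

end
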